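(* Neither of the implications $\mathrm{CCC}_3\to\mathrm{CCC}_2$ and $\mathrm{CCC}_2\to\mathrm{CCC}_1$ (both provable in $\mathsf{ZF}$) is reversible in $\mathsf{ZF}+\mathsf{DC}$. That is: (1) it is consistent with $\mathsf{ZF}+\mathsf{DC}$ that there exists a notion of forcing which satisfies $\mathrm{CCC}_1$ but not $\mathrm{CCC}_2$; and (2) it is consistent with $\mathsf{ZF}+\mathsf{DC}$ that there exists a notion of forcing which satisfies $\mathrm{CCC}_2$ but not $\mathrm{CCC}_3$.
   Context: Consistency statements are relative to the consistency of $\mathsf{ZFC}$ (equivalently, of $\mathsf{ZF}$). $\mathsf{DC}$ is the Principle of Dependent Choice. A notion of forcing (or forcing) is a preordered set $\mathbb P$ with a maximum $\mathbf 1_{\mathbb P}$. Conditions $p,q\in\mathbb P$ are compatible if they have a common extension (some $r\le p,q$), and incompatible otherwise. A set $A\subseteq\mathbb P$ is an antichain if any two distinct elements of $A$ are incompatible; it is a maximal antichain if it is maximal under inclusion among antichains. A set $D\subseteq\mathbb P$ is predense if every $p\in\mathbb P$ is compatible with some $q\in D$. $\mathrm{CCC}_1$: every maximal antichain in $\mathbb P$ is countable. $\mathrm{CCC}_2$: every antichain in $\mathbb P$ is countable. $\mathrm{CCC}_3$: every predense subset of $\mathbb P$ contains a countable predense subset. $\mathrm{CCC}_i\to\mathrm{CCC}_j$ means that every notion of forcing satisfying $\mathrm{CCC}_i$ satisfies $\mathrm{CCC}_j$. *)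

theory Defs
  imports Main
begin

section \<open>First-order logic over one binary relation symbol\<close>

text \<open>
  Formulas of the language of set theory in de Bruijn style: a variable is a number, and inside
  a quantifier index 0 is the bound variable while \<open>Suc i\<close> is the variable called \<open>i\<close> outside.
\<close>

datatype fm =
    Mem nat nat  (infix "\<^bold>\<in>" 150)
  | Eq nat nat   (infix "\<^bold>=" 150)
  | Fls          ("\<^bold>\<bottom>")
  | Imp fm fm    (infixr "\<^bold>\<longrightarrow>" 110)
  | Forall fm       ("\<^bold>\<forall>_" [140] 140)

definition Neg :: "fm \<Rightarrow> fm" ("\<^bold>\<not>_" [140] 140) where
  "\<^bold>\<not>p = (p \<^bold>\<longrightarrow> \<^bold>\<bottom>)"

definition Con :: "fm \<Rightarrow> fm \<Rightarrow> fm" (infixr "\<^bold>\<and>" 130) where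
  "p \<^bold>\<and> q = \<^bold>\<not>(p \<^bold>\<longrightarrow> \<^bold>\<not>q)"

definition Dis :: "fm \<Rightarrow> fm \<Rightarrow> fm" (infixr "\<^bold>\<or>" 120) where
  "p \<^bold>\<or> q = (\<^bold>\<not>p \<^bold>\<longrightarrow> q)"

definition Iff :: "fm \<Rightarrow> fm \<Rightarrow> fm" (infix "\<^bold>\<longleftrightarrow>" 105) where
  "p \<^bold>\<longleftrightarrow> q = ((p \<^bold>\<longrightarrow> q) \<^bold>\<and> (q \<^bold>\<longrightarrow> p))"

definition Exi :: "fm \<Rightarrow> fm" ("\<^bold>\<exists>_" [140] 140) where
  "\<^bold>\<exists>p = \<^bold>\<not>(\<^bold>\<forall>(\<^bold>\<not>p))"

text \<open>In the bounded quantifiers the bound \<open>x\<close> is named in the outer context.\<close>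

definition BAll :: "nat \<Rightarrow> fm \<Rightarrow> fm" where
  "BAll x p = \<^bold>\<forall>(0 \<^bold>\<in> Suc x \<^bold>\<longrightarrow> p)"

definition BEx :: "nat \<Rightarrow> fm \<Rightarrow> fm" where
  "BEx x p = \<^bold>\<exists>(0 \<^bold>\<in> Suc x \<^bold>\<and> p)"

abbreviation scons :: "'a \<Rightarrow> (nat \<Rightarrow> 'a) \<Rightarrow> nat \<Rightarrow> 'a" (infixr "##" 65) where
  "a ## e \<equiv> case_nat a e"

primrec ren :: "(nat \<Rightarrow> nat) \<Rightarrow> fm \<Rightarrow> fm" where
  "ren r (i \<^bold>\<in> j) = r i \<^bold>\<in> r j"
| "ren r (i \<^bold>= j) = r i \<^bold>= r j"
| "ren r \<^bold>\<bottom> = \<^bold>\<bottom>"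
| "ren r (p \<^bold>\<longrightarrow> q) = (ren r p \<^bold>\<longrightarrow> ren r q)"
| "ren r (\<^bold>\<forall>p) = \<^bold>\<forall>(ren (0 ## (\<lambda>n. Suc (r n))) p)"

text \<open>\<open>inst p k\<close> substitutes the variable \<open>k\<close> for index 0 and lowers the other indices.\<close>

definition inst :: "fm \<Rightarrow> nat \<Rightarrow> fm" where
  "inst p k = ren (k ## (\<lambda>n. n)) p"

text \<open>\<open>bnd p\<close> is the least \<open>n\<close> such that all free variables of \<open>p\<close> are below \<open>n\<close>.\<close>

primrec bnd :: "fm \<Rightarrow> nat" where
  "bnd (i \<^bold>\<in> j) = max (Suc i) (Suc j)"
| "bnd (i \<^bold>= j) = max (Suc i) (Suc j)"
| "bnd \<^bold>\<bottom> = 0"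
| "bnd (p \<^bold>\<longrightarrow> q) = max (bnd p) (bnd q)"
| "bnd (\<^bold>\<forall>p) = bnd p - 1"

definition closure :: "fm \<Rightarrow> fm" where
  "closure p = (Forall ^^ bnd p) p"

text \<open>
  Classical natural deduction with equality. The premise set may be infinite. Shifting it in the
  rule \<open>AllI\<close> is the eigenvariable condition.
\<close>

inductive derivable :: "fm set \<Rightarrow> fm \<Rightarrow> bool" (infix "\<^bold>\<turnstile>" 50) where
  Assm: "p \<in> \<Gamma> \<Longrightarrow> \<Gamma> \<^bold>\<turnstile> p"
| ImpI: "insert p \<Gamma> \<^bold>\<turnstile> q \<Longrightarrow> \<Gamma> \<^bold>\<turnstile> p \<^bold>\<longrightarrow> q"
| ImpE: "\<Gamma> \<^bold>\<turnstile> p \<^bold>\<longrightarrow> q \<Longrightarrow> \<Gamma> \<^bold>\<turnstile> p \<Longrightarrow> \<Gamma> \<^bold>\<turnstile> q"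
| Raa:  "insert (\<^bold>\<not>p) \<Gamma> \<^bold>\<turnstile> \<^bold>\<bottom> \<Longrightarrow> \<Gamma> \<^bold>\<turnstile> p"
| AllI: "ren Suc ` \<Gamma> \<^bold>\<turnstile> p \<Longrightarrow> \<Gamma> \<^bold>\<turnstile> \<^bold>\<forall>p"
| AllE: "\<Gamma> \<^bold>\<turnstile> \<^bold>\<forall>p \<Longrightarrow> \<Gamma> \<^bold>\<turnstile> inst p k"
| EqI:  "\<Gamma> \<^bold>\<turnstile> k \<^bold>= k"
| EqE:  "\<Gamma> \<^bold>\<turnstile> i \<^bold>= j \<Longrightarrow> \<Gamma> \<^bold>\<turnstile> inst p i \<Longrightarrow> \<Gamma> \<^bold>\<turnstile> inst p j"

definition consistent :: "fm set \<Rightarrow> bool" where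
  "consistent \<Gamma> \<longleftrightarrow> \<not> \<Gamma> \<^bold>\<turnstile> \<^bold>\<bottom>"


section \<open>Set-theoretic notions as formulas\<close>

text \<open>
  All arguments are indices in the context where the formula is used. The lemmas on satisfaction
  at the end of the theory state what each of these formulas says in an arbitrary structure.
\<close>

definition sub_fm :: "nat \<Rightarrow> nat \<Rightarrow> fm" where
  "sub_fm x y = BAll x (0 \<^bold>\<in> Suc y)"

definition empty_fm :: "nat \<Rightarrow> fm" where
  "empty_fm x = \<^bold>\<forall>(\<^bold>\<not>(0 \<^bold>\<in> Suc x))"

definition upair_fm :: "nat \<Rightarrow> nat \<Rightarrow> nat \<Rightarrow> fm" where \<comment> \<open>\<open>z = {x, y}\<close>\<close>
  "upair_fm x y z = \<^bold>\<forall>(0 \<^bold>\<in> Suc z \<^bold>\<longleftrightarrow> 0 \<^bold>= Suc x \<^bold>\<or> 0 \<^bold>= Suc y)"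

definition opair_fm :: "nat \<Rightarrow> nat \<Rightarrow> nat \<Rightarrow> fm" where \<comment> \<open>\<open>z = {{x, x}, {x, y}}\<close>\<close>
  "opair_fm x y z = \<^bold>\<exists>(\<^bold>\<exists>(upair_fm (x+2) (x+2) 1 \<^bold>\<and> upair_fm (x+2) (y+2) 0 \<^bold>\<and> upair_fm 1 0 (z+2)))"

definition pair_in_fm :: "nat \<Rightarrow> nat \<Rightarrow> nat \<Rightarrow> fm" where \<comment> \<open>\<open>(x, y) \<in> r\<close>\<close>
  "pair_in_fm x y r = BEx r (opair_fm (x+1) (y+1) 0)"

definition rel_fm :: "nat \<Rightarrow> nat \<Rightarrow> nat \<Rightarrow> fm" where \<comment> \<open>\<open>r \<subseteq> a \<times> b\<close>\<close>
  "rel_fm r a b = BAll r (BEx (a+1) (BEx (b+2) (opair_fm 1 0 2)))"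

definition func_fm :: "nat \<Rightarrow> nat \<Rightarrow> nat \<Rightarrow> fm" where \<comment> \<open>\<open>f : a \<rightarrow> b\<close>\<close>
  "func_fm f a b = (rel_fm f a b \<^bold>\<and>
     BAll a (BEx (b+1) (pair_in_fm 1 0 (f+2) \<^bold>\<and> BAll (b+2) (pair_in_fm 2 0 (f+3) \<^bold>\<longrightarrow> 0 \<^bold>= 1))))"

definition inj_fm :: "nat \<Rightarrow> nat \<Rightarrow> nat \<Rightarrow> fm" where
  "inj_fm f a b = (func_fm f a b \<^bold>\<and>
     BAll a (BAll (a+1) (BAll (b+2) (pair_in_fm 2 0 (f+3) \<^bold>\<and> pair_in_fm 1 0 (f+3) \<^bold>\<longrightarrow> 2 \<^bold>= 1))))"

definition succ_fm :: "nat \<Rightarrow> nat \<Rightarrow> fm" where \<comment> \<open>\<open>y = x \<union> {x}\<close>\<close>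
  "succ_fm x y = \<^bold>\<forall>(0 \<^bold>\<in> Suc y \<^bold>\<longleftrightarrow> 0 \<^bold>\<in> Suc x \<^bold>\<or> 0 \<^bold>= Suc x)"

definition inductive_fm :: "nat \<Rightarrow> fm" where
  "inductive_fm w = (BEx w (empty_fm 0) \<^bold>\<and> BAll w (BEx (w+1) (succ_fm 1 0)))"

definition omega_fm :: "nat \<Rightarrow> fm" where
  "omega_fm w = (inductive_fm w \<^bold>\<and> \<^bold>\<forall>(inductive_fm 0 \<^bold>\<longrightarrow> sub_fm (w+1) 0))"

definition countable_fm :: "nat \<Rightarrow> fm" where
  "countable_fm a = \<^bold>\<exists>(\<^bold>\<exists>(omega_fm 1 \<^bold>\<and> inj_fm 0 (a+2) 1))"


section \<open>ZF, the Axiom of Choice and Dependent Choice\<close>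

definition Extensionality_Ax :: fm where
  "Extensionality_Ax = \<^bold>\<forall>(\<^bold>\<forall>(\<^bold>\<forall>(0 \<^bold>\<in> 2 \<^bold>\<longleftrightarrow> 0 \<^bold>\<in> 1) \<^bold>\<longrightarrow> 1 \<^bold>= 0))"

definition Foundation_Ax :: fm where
  "Foundation_Ax = \<^bold>\<forall>(\<^bold>\<exists>(0 \<^bold>\<in> 1) \<^bold>\<longrightarrow> BEx 0 (BAll 0 (\<^bold>\<not>(0 \<^bold>\<in> 2))))"

definition Pairing_Ax :: fm where
  "Pairing_Ax = \<^bold>\<forall>(\<^bold>\<forall>(\<^bold>\<exists>(upair_fm 2 1 0)))"

definition Union_Ax :: fm where
  "Union_Ax = \<^bold>\<forall>(\<^bold>\<exists>(\<^bold>\<forall>(0 \<^bold>\<in> 1 \<^bold>\<longleftrightarrow> BEx 2 (1 \<^bold>\<in> 0))))"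

definition Powerset_Ax :: fm where
  "Powerset_Ax = \<^bold>\<forall>(\<^bold>\<exists>(\<^bold>\<forall>(0 \<^bold>\<in> 1 \<^bold>\<longleftrightarrow> sub_fm 0 2)))"

definition Infinity_Ax :: fm where
  "Infinity_Ax = \<^bold>\<exists>(inductive_fm 0)"

text \<open>
  In \<open>Separation \<phi>\<close>, variable 0 of \<open>\<phi>\<close> is the element, variable 1 the set separated from and the
  others are parameters. In \<open>Replacement \<phi>\<close>, variables 0 and 1 of \<open>\<phi>\<close> are argument and value,
  variable 2 is the domain and the others are parameters. The renamings keep \<open>\<phi>\<close> from mentioning
  the set whose existence is asserted.
\<close>

definition Separation :: "fm \<Rightarrow> fm" where
  "Separation \<phi> = closure (\<^bold>\<forall>(\<^bold>\<exists>(\<^bold>\<forall>(0 \<^bold>\<in> 1 \<^bold>\<longleftrightarrow> 0 \<^bold>\<in> 2 \<^bold>\<and> ren (0 ## (\<lambda>n. n+2)) \<phi>))))"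

definition Replacement :: "fm \<Rightarrow> fm" where
  "Replacement \<phi> = closure (\<^bold>\<forall>(
     BAll 0 (\<^bold>\<forall>(\<^bold>\<forall>(ren (2 ## 1 ## (\<lambda>n. n+3)) \<phi> \<^bold>\<and> ren (2 ## 0 ## (\<lambda>n. n+3)) \<phi> \<^bold>\<longrightarrow> 1 \<^bold>= 0))) \<^bold>\<longrightarrow>
     \<^bold>\<exists>(\<^bold>\<forall>(0 \<^bold>\<in> 1 \<^bold>\<longleftrightarrow> BEx 2 (ren (0 ## 1 ## (\<lambda>n. n+3)) \<phi>)))))"

definition ZF :: "fm set" where
  "ZF = {Extensionality_Ax, Foundation_Ax, Pairing_Ax, Union_Ax, Powerset_Ax, Infinity_Ax}
        \<union> range Separation \<union> range Replacement"

text \<open>Every family of nonempty sets has a choice function.\<close>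

definition AC :: fm where
  "AC = \<^bold>\<forall>(BAll 0 (\<^bold>\<exists>(0 \<^bold>\<in> 1)) \<^bold>\<longrightarrow>
     \<^bold>\<exists>(\<^bold>\<exists>(func_fm 1 2 0 \<^bold>\<and> BAll 2 (BAll 1 (pair_in_fm 1 0 3 \<^bold>\<longrightarrow> 0 \<^bold>\<in> 1)))))"

definition ZFC :: "fm set" where
  "ZFC = insert AC ZF"

text \<open>
  If \<open>r\<close> is a relation on a nonempty set \<open>a\<close> and every \<open>x \<in> a\<close> has some \<open>y \<in> a\<close> with \<open>(x, y) \<in> r\<close>,
  then there is \<open>f : \<omega> \<rightarrow> a\<close> with \<open>(f n, f (n + 1)) \<in> r\<close> for all \<open>n\<close>.
\<close>

definition DC :: fm where
  "DC = \<^bold>\<forall>(\<^bold>\<forall>(\<^bold>\<exists>(0 \<^bold>\<in> 2) \<^bold>\<and> BAll 1 (BEx 2 (pair_in_fm 1 0 2)) \<^bold>\<longrightarrow>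
     \<^bold>\<exists>(\<^bold>\<exists>(omega_fm 1 \<^bold>\<and> func_fm 0 1 3 \<^bold>\<and>
       BAll 1 (BAll 2 (succ_fm 1 0 \<^bold>\<longrightarrow>
         BAll 5 (BAll 6 (pair_in_fm 3 1 4 \<^bold>\<and> pair_in_fm 2 0 4 \<^bold>\<longrightarrow> pair_in_fm 1 0 6))))))))"


section \<open>Notions of forcing and chain conditions\<close>

text \<open>A preordered set is a set \<open>P\<close> with a set \<open>L \<subseteq> P \<times> P\<close> of pairs; \<open>(p, q) \<in> L\<close> means \<open>p \<le> q\<close>.\<close>

definition forcing_fm :: "nat \<Rightarrow> nat \<Rightarrow> fm" where
  "forcing_fm P L = (rel_fm L P P \<^bold>\<and>
     BAll P (pair_in_fm 0 0 (L+1)) \<^bold>\<and>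
     BAll P (BAll (P+1) (BAll (P+2)
       (pair_in_fm 2 1 (L+3) \<^bold>\<and> pair_in_fm 1 0 (L+3) \<^bold>\<longrightarrow> pair_in_fm 2 0 (L+3)))) \<^bold>\<and>
     BEx P (BAll (P+1) (pair_in_fm 0 1 (L+2))))"

definition compat_fm :: "nat \<Rightarrow> nat \<Rightarrow> nat \<Rightarrow> nat \<Rightarrow> fm" where
  "compat_fm P L p q = BEx P (pair_in_fm 0 (p+1) (L+1) \<^bold>\<and> pair_in_fm 0 (q+1) (L+1))"

definition antichain_fm :: "nat \<Rightarrow> nat \<Rightarrow> nat \<Rightarrow> fm" where
  "antichain_fm P L A = (sub_fm A P \<^bold>\<and>
     BAll A (BAll (A+1) (\<^bold>\<not>(1 \<^bold>= 0) \<^bold>\<longrightarrow> \<^bold>\<not>(compat_fm (P+2) (L+2) 1 0))))"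

definition maximal_antichain_fm :: "nat \<Rightarrow> nat \<Rightarrow> nat \<Rightarrow> fm" where
  "maximal_antichain_fm P L A = (antichain_fm P L A \<^bold>\<and>
     \<^bold>\<forall>(antichain_fm (P+1) (L+1) 0 \<^bold>\<and> sub_fm (A+1) 0 \<^bold>\<longrightarrow> 0 \<^bold>= (A+1)))"

definition predense_fm :: "nat \<Rightarrow> nat \<Rightarrow> nat \<Rightarrow> fm" where
  "predense_fm P L D = (sub_fm D P \<^bold>\<and> BAll P (BEx (D+1) (compat_fm (P+2) (L+2) 1 0)))"

definition CCC1 :: "nat \<Rightarrow> nat \<Rightarrow> fm" where
  "CCC1 P L = \<^bold>\<forall>(maximal_antichain_fm (P+1) (L+1) 0 \<^bold>\<longrightarrow> countable_fm 0)"

definition CCC2 :: "nat \<Rightarrow> nat \<Rightarrow> fm" where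
  "CCC2 P L = \<^bold>\<forall>(antichain_fm (P+1) (L+1) 0 \<^bold>\<longrightarrow> countable_fm 0)"

definition CCC3 :: "nat \<Rightarrow> nat \<Rightarrow> fm" where
  "CCC3 P L = \<^bold>\<forall>(predense_fm (P+1) (L+1) 0 \<^bold>\<longrightarrow>
     \<^bold>\<exists>(sub_fm 0 1 \<^bold>\<and> countable_fm 0 \<^bold>\<and> predense_fm (P+2) (L+2) 0))"

text \<open>
  The sentences ``every notion of forcing with property \<open>C\<close> has property \<open>D\<close>'' and ``some notion of
  forcing has property \<open>C\<close> but not property \<open>D\<close>''.
\<close>

definition CCC_implies :: "(nat \<Rightarrow> nat \<Rightarrow> fm) \<Rightarrow> (nat \<Rightarrow> nat \<Rightarrow> fm) \<Rightarrow> fm" where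
  "CCC_implies C D = \<^bold>\<forall>(\<^bold>\<forall>(forcing_fm 1 0 \<^bold>\<longrightarrow> C 1 0 \<^bold>\<longrightarrow> D 1 0))"

definition CCC_separated :: "(nat \<Rightarrow> nat \<Rightarrow> fm) \<Rightarrow> (nat \<Rightarrow> nat \<Rightarrow> fm) \<Rightarrow> fm" where
  "CCC_separated C D = \<^bold>\<exists>(\<^bold>\<exists>(forcing_fm 1 0 \<^bold>\<and> C 1 0 \<^bold>\<and> \<^bold>\<not>(D 1 0)))"


section \<open>Meaning of the formulas in a structure\<close>

primrec sat :: "('a \<Rightarrow> 'a \<Rightarrow> bool) \<Rightarrow> (nat \<Rightarrow> 'a) \<Rightarrow> fm \<Rightarrow> bool" where
  "sat E e (i \<^bold>\<in> j) = E (e i) (e j)"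
| "sat E e (i \<^bold>= j) = (e i = e j)"
| "sat E e \<^bold>\<bottom> = False"
| "sat E e (p \<^bold>\<longrightarrow> q) = (sat E e p \<longrightarrow> sat E e q)"
| "sat E e (\<^bold>\<forall>p) = (\<forall>a. sat E (a ## e) p)"

lemma scons_simps [simp]:
  "(a ## e) 1 = e 0"
  "(a ## e) (numeral k) = e (pred_numeral k)"
  "(a ## e) (n + 1) = e n"
  "(a ## e) (n + numeral k) = e (n + pred_numeral k)"
  by (simp_all add: numeral_eq_Suc)

lemma sat_connectives [simp]:
  "sat E e (\<^bold>\<not>p) = (\<not> sat E e p)"
  "sat E e (p \<^bold>\<and> q) = (sat E e p \<and> sat E e q)"
  "sat E e (p \<^bold>\<or> q) = (sat E e p \<or> sat E e q)"
  "sat E e (p \<^bold>\<longleftrightarrow> q) = (sat E e p \<longleftrightarrow> sat E e q)"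
  "sat E e (\<^bold>\<exists>p) = (\<exists>a. sat E (a ## e) p)"
  "sat E e (BAll x p) = (\<forall>a. E a (e x) \<longrightarrow> sat E (a ## e) p)"
  "sat E e (BEx x p) = (\<exists>a. E a (e x) \<and> sat E (a ## e) p)"
  by (auto simp: Neg_def Con_def Dis_def Iff_def Exi_def BAll_def BEx_def)

lemma sat_ren [simp]: "sat E e (ren r p) = sat E (\<lambda>n. e (r n)) p"
proof (induction p arbitrary: e r)
  case (Forall p)
  have "(\<lambda>n. (a ## e) ((0 ## (\<lambda>n. Suc (r n))) n)) = a ## (\<lambda>n. e (r n))" for a
    by (auto split: nat.split)
  with Forall show ?case by simp
qed simp_all

lemma sat_inst: "sat E e (inst p k) = sat E (e k ## e) p"
proof -
  have "(\<lambda>n. e ((k ## (\<lambda>n. n)) n)) = e k ## e"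
    by (auto split: nat.split)
  then show ?thesis by (simp add: inst_def)
qed

theorem soundness: "\<Gamma> \<^bold>\<turnstile> p \<Longrightarrow> \<forall>q\<in>\<Gamma>. sat E e q \<Longrightarrow> sat E e p"
proof (induction arbitrary: e rule: derivable.induct)
  case (AllI \<Gamma> p)
  have "sat E (a ## e) p" for a
    by (rule AllI.IH) (use AllI.prems in simp)
  then show ?case by simp
next
  case (EqE \<Gamma> i j p)
  from EqE.IH(1)[OF EqE.prems] EqE.IH(2)[OF EqE.prems] show ?case by (simp add: sat_inst)
qed (auto simp: sat_inst)

lemma sat_bnd: "(\<And>i. i < bnd p \<Longrightarrow> e i = e' i) \<Longrightarrow> sat E e p = sat E e' p"
proof (induction p arbitrary: e e')
  case (Imp p q)
  have "sat E e p = sat E e' p" "sat E e q = sat E e' q"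
    by (rule Imp.IH, use Imp.prems in simp)+
  then show ?case by simp
next
  case (Forall p)
  have "sat E (a ## e) p = sat E (a ## e') p" for a
    by (rule Forall.IH) (use Forall.prems in \<open>auto split: nat.split\<close>)
  then show ?case by simp
qed simp_all

lemma sat_closure [simp]: "sat E e (closure p) \<longleftrightarrow> (\<forall>e'. sat E e' p)"
proof -
  have *: "sat E e ((Forall ^^ n) p) \<longleftrightarrow> (\<forall>e'. (\<forall>i. e' (i + n) = e i) \<longrightarrow> sat E e' p)" for n
  proof (induction n arbitrary: e)
    case 0
    show ?case by (simp flip: fun_eq_iff)
  next
    case (Suc n)
    have "sat E e ((Forall ^^ Suc n) p) \<longleftrightarrow>
          (\<forall>a e'. (\<forall>i. e' (i + n) = (a ## e) i) \<longrightarrow> sat E e' p)"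
      by (simp add: Suc.IH)
    also have "\<dots> \<longleftrightarrow> (\<forall>e'. (\<forall>i. e' (i + Suc n) = e i) \<longrightarrow> sat E e' p)"
    proof -
      have "(\<exists>a. \<forall>i. e' (i + n) = (a ## e) i) \<longleftrightarrow> (\<forall>i. e' (i + Suc n) = e i)" for e'
      proof
        assume "\<exists>a. \<forall>i. e' (i + n) = (a ## e) i"
        then obtain a where "\<forall>i. e' (i + n) = (a ## e) i" by blast
        from this[rule_format, of "Suc i" for i] show "\<forall>i. e' (i + Suc n) = e i" by simp
      next
        assume "\<forall>i. e' (i + Suc n) = e i"
        then have "\<forall>i. e' (i + n) = (e' n ## e) i" by (auto split: nat.split)
        then show "\<exists>a. \<forall>i. e' (i + n) = (a ## e) i" by blast
      qed
      then show ?thesis by blast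
    qed
    finally show ?case .
  qed
  show ?thesis
  proof
    assume l: "sat E e (closure p)"
    show "\<forall>e'. sat E e' p"
    proof
      fix e'
      let ?f = "\<lambda>i. if i < bnd p then e' i else e (i - bnd p)"
      have "sat E ?f p" using l by (simp add: closure_def *)
      moreover have "sat E ?f p = sat E e' p" by (rule sat_bnd) simp
      ultimately show "sat E e' p" by simp
    qed
  qed (simp add: closure_def *)
qed

context
  fixes E :: "'a \<Rightarrow> 'a \<Rightarrow> bool"  (infix "\<epsilon>" 50)
begin

definition "is_sub x y \<longleftrightarrow> (\<forall>z. z \<epsilon> x \<longrightarrow> z \<epsilon> y)"
definition "is_empty x \<longleftrightarrow> (\<forall>z. \<not> z \<epsilon> x)"
definition "is_upair x y z \<longleftrightarrow> (\<forall>u. u \<epsilon> z \<longleftrightarrow> u = x \<or> u = y)"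
definition "is_opair x y z \<longleftrightarrow> (\<exists>a b. is_upair x x a \<and> is_upair x y b \<and> is_upair a b z)"
definition "pair_in x y r \<longleftrightarrow> (\<exists>z. z \<epsilon> r \<and> is_opair x y z)"
definition "is_rel r a b \<longleftrightarrow> (\<forall>z. z \<epsilon> r \<longrightarrow> (\<exists>x. x \<epsilon> a \<and> (\<exists>y. y \<epsilon> b \<and> is_opair x y z)))"
definition "is_func f a b \<longleftrightarrow> is_rel f a b \<and>
  (\<forall>x. x \<epsilon> a \<longrightarrow> (\<exists>!y. y \<epsilon> b \<and> pair_in x y f))"
definition "is_inj f a b \<longleftrightarrow> is_func f a b \<and>
  (\<forall>x x' y. x \<epsilon> a \<longrightarrow> x' \<epsilon> a \<longrightarrow> y \<epsilon> b \<longrightarrow> pair_in x y f \<longrightarrow> pair_in x' y f \<longrightarrow> x = x')"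
definition "is_succ x y \<longleftrightarrow> (\<forall>z. z \<epsilon> y \<longleftrightarrow> z \<epsilon> x \<or> z = x)"
definition "is_inductive w \<longleftrightarrow> (\<exists>z. z \<epsilon> w \<and> is_empty z) \<and>
  (\<forall>x. x \<epsilon> w \<longrightarrow> (\<exists>y. y \<epsilon> w \<and> is_succ x y))"
definition "is_omega w \<longleftrightarrow> is_inductive w \<and> (\<forall>v. is_inductive v \<longrightarrow> is_sub w v)"
definition "is_countable a \<longleftrightarrow> (\<exists>w f. is_omega w \<and> is_inj f a w)"

definition "is_forcing P L \<longleftrightarrow> is_rel L P P \<and>
  (\<forall>p. p \<epsilon> P \<longrightarrow> pair_in p p L) \<and>
  (\<forall>p q r. p \<epsilon> P \<longrightarrow> q \<epsilon> P \<longrightarrow> r \<epsilon> P \<longrightarrow> pair_in p q L \<longrightarrow> pair_in q r L \<longrightarrow> pair_in p r L) \<and>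
  (\<exists>m. m \<epsilon> P \<and> (\<forall>p. p \<epsilon> P \<longrightarrow> pair_in p m L))"
definition "is_compat P L p q \<longleftrightarrow> (\<exists>r. r \<epsilon> P \<and> pair_in r p L \<and> pair_in r q L)"
definition "is_antichain P L A \<longleftrightarrow> is_sub A P \<and>
  (\<forall>p q. p \<epsilon> A \<longrightarrow> q \<epsilon> A \<longrightarrow> p \<noteq> q \<longrightarrow> \<not> is_compat P L p q)"
definition "is_maximal_antichain P L A \<longleftrightarrow> is_antichain P L A \<and>
  (\<forall>B. is_antichain P L B \<longrightarrow> is_sub A B \<longrightarrow> B = A)"
definition "is_predense P L D \<longleftrightarrow> is_sub D P \<and>
  (\<forall>p. p \<epsilon> P \<longrightarrow> (\<exists>q. q \<epsilon> D \<and> is_compat P L p q))"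
definition "is_CCC1 P L \<longleftrightarrow> (\<forall>A. is_maximal_antichain P L A \<longrightarrow> is_countable A)"
definition "is_CCC2 P L \<longleftrightarrow> (\<forall>A. is_antichain P L A \<longrightarrow> is_countable A)"
definition "is_CCC3 P L \<longleftrightarrow> (\<forall>D. is_predense P L D \<longrightarrow>
  (\<exists>C. is_sub C D \<and> is_countable C \<and> is_predense P L C))"

lemma sat_sub [simp]: "sat E e (sub_fm x y) = is_sub (e x) (e y)"
  by (simp add: sub_fm_def is_sub_def)

lemma sat_empty [simp]: "sat E e (empty_fm x) = is_empty (e x)"
  by (simp add: empty_fm_def is_empty_def)

lemma sat_upair [simp]: "sat E e (upair_fm x y z) = is_upair (e x) (e y) (e z)"
  by (simp add: upair_fm_def is_upair_def)

lemma sat_opair [simp]: "sat E e (opair_fm x y z) = is_opair (e x) (e y) (e z)"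
  by (simp add: opair_fm_def is_opair_def)

lemma sat_pair_in [simp]: "sat E e (pair_in_fm x y r) = pair_in (e x) (e y) (e r)"
  by (simp add: pair_in_fm_def pair_in_def)

lemma sat_rel [simp]: "sat E e (rel_fm r a b) = is_rel (e r) (e a) (e b)"
  by (simp add: rel_fm_def is_rel_def)

lemma sat_func [simp]: "sat E e (func_fm f a b) = is_func (e f) (e a) (e b)"
  by (simp add: func_fm_def is_func_def Ex1_def) blast

lemma sat_inj [simp]: "sat E e (inj_fm f a b) = is_inj (e f) (e a) (e b)"
  by (simp add: inj_fm_def is_inj_def) blast

lemma sat_succ [simp]: "sat E e (succ_fm x y) = is_succ (e x) (e y)"
  by (simp add: succ_fm_def is_succ_def)

lemma sat_inductive [simp]: "sat E e (inductive_fm w) = is_inductive (e w)"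
  by (simp add: inductive_fm_def is_inductive_def)

lemma sat_omega [simp]: "sat E e (omega_fm w) = is_omega (e w)"
  by (simp add: omega_fm_def is_omega_def)

lemma sat_countable [simp]: "sat E e (countable_fm a) = is_countable (e a)"
  by (simp add: countable_fm_def is_countable_def)

lemma sat_forcing [simp]: "sat E e (forcing_fm P L) = is_forcing (e P) (e L)"
  by (simp add: forcing_fm_def is_forcing_def) blast

lemma sat_compat [simp]: "sat E e (compat_fm P L p q) = is_compat (e P) (e L) (e p) (e q)"
  by (simp add: compat_fm_def is_compat_def)

lemma sat_antichain [simp]: "sat E e (antichain_fm P L A) = is_antichain (e P) (e L) (e A)"
  by (simp add: antichain_fm_def is_antichain_def)

lemma sat_maximal_antichain [simp]:
  "sat E e (maximal_antichain_fm P L A) = is_maximal_antichain (e P) (e L) (e A)"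
  by (simp add: maximal_antichain_fm_def is_maximal_antichain_def) blast

lemma sat_predense [simp]: "sat E e (predense_fm P L D) = is_predense (e P) (e L) (e D)"
  by (simp add: predense_fm_def is_predense_def)

lemma sat_CCC [simp]:
  "sat E e (CCC1 P L) = is_CCC1 (e P) (e L)"
  "sat E e (CCC2 P L) = is_CCC2 (e P) (e L)"
  "sat E e (CCC3 P L) = is_CCC3 (e P) (e L)"
  by (simp_all add: CCC1_def is_CCC1_def CCC2_def is_CCC2_def CCC3_def is_CCC3_def)

lemma sat_CCC_implies:
  "sat E e (CCC_implies CCC3 CCC2) \<longleftrightarrow> (\<forall>P L. is_forcing P L \<longrightarrow> is_CCC3 P L \<longrightarrow> is_CCC2 P L)"
  "sat E e (CCC_implies CCC2 CCC1) \<longleftrightarrow> (\<forall>P L. is_forcing P L \<longrightarrow> is_CCC2 P L \<longrightarrow> is_CCC1 P L)"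
  by (simp_all add: CCC_implies_def)

lemma sat_CCC_separated:
  "sat E e (CCC_separated CCC1 CCC2) \<longleftrightarrow> (\<exists>P L. is_forcing P L \<and> is_CCC1 P L \<and> \<not> is_CCC2 P L)"
  "sat E e (CCC_separated CCC2 CCC3) \<longleftrightarrow> (\<exists>P L. is_forcing P L \<and> is_CCC2 P L \<and> \<not> is_CCC3 P L)"
  by (simp_all add: CCC_separated_def)

lemma sat_Extensionality: "sat E e Extensionality_Ax \<longleftrightarrow> (\<forall>x y. (\<forall>z. z \<epsilon> x \<longleftrightarrow> z \<epsilon> y) \<longrightarrow> x = y)"
  by (simp add: Extensionality_Ax_def)

lemma sat_Foundation: "sat E e Foundation_Ax \<longleftrightarrow>
    (\<forall>x. (\<exists>y. y \<epsilon> x) \<longrightarrow> (\<exists>y. y \<epsilon> x \<and> (\<forall>z. z \<epsilon> y \<longrightarrow> \<not> z \<epsilon> x)))"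
  by (simp add: Foundation_Ax_def)

lemma sat_Pairing: "sat E e Pairing_Ax \<longleftrightarrow> (\<forall>x y. \<exists>z. is_upair x y z)"
  by (simp add: Pairing_Ax_def)

lemma sat_Union: "sat E e Union_Ax \<longleftrightarrow> (\<forall>x. \<exists>u. \<forall>z. z \<epsilon> u \<longleftrightarrow> (\<exists>y. y \<epsilon> x \<and> z \<epsilon> y))"
  by (simp add: Union_Ax_def)

lemma sat_Powerset: "sat E e Powerset_Ax \<longleftrightarrow> (\<forall>x. \<exists>p. \<forall>z. z \<epsilon> p \<longleftrightarrow> is_sub z x)"
  by (simp add: Powerset_Ax_def)

lemma sat_Infinity: "sat E e Infinity_Ax \<longleftrightarrow> (\<exists>w. is_inductive w)"
  by (simp add: Infinity_Ax_def)

lemma sat_Separation: "sat E e (Separation \<phi>) \<longleftrightarrow>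
    (\<forall>e a. \<exists>b. \<forall>x. x \<epsilon> b \<longleftrightarrow> x \<epsilon> a \<and> sat E (x ## a ## e) \<phi>)"
proof -
  have "(\<lambda>n. (x ## b ## a ## e) ((0 ## (\<lambda>n. n+2)) n)) = x ## a ## e" for x b a :: 'a and e
    by (auto split: nat.split)
  then show ?thesis by (simp add: Separation_def del: add_2_eq_Suc')
qed

lemma sat_Replacement: "sat E e (Replacement \<phi>) \<longleftrightarrow>
    (\<forall>e a. (\<forall>x. x \<epsilon> a \<longrightarrow> (\<forall>y y'. sat E (x ## y ## a ## e) \<phi> \<and> sat E (x ## y' ## a ## e) \<phi> \<longrightarrow> y = y'))
       \<longrightarrow> (\<exists>b. \<forall>y. y \<epsilon> b \<longleftrightarrow> (\<exists>x. x \<epsilon> a \<and> sat E (x ## y ## a ## e) \<phi>)))"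
proof -
  have "(\<lambda>n. (y' ## y ## x ## a ## e) ((2 ## 1 ## (\<lambda>n. n+3)) n)) = x ## y ## a ## e"
       "(\<lambda>n. (y' ## y ## x ## a ## e) ((2 ## 0 ## (\<lambda>n. n+3)) n)) = x ## y' ## a ## e"
       "(\<lambda>n. (x ## y ## b ## a ## e) ((0 ## 1 ## (\<lambda>n. n+3)) n)) = x ## y ## a ## e"
    for x y y' a b :: 'a and e
    by (auto simp: numeral_eq_Suc split: nat.split)
  then show ?thesis by (simp add: Replacement_def del: One_nat_def)
qed

lemma sat_AC: "sat E e AC \<longleftrightarrow>
    (\<forall>F. (\<forall>x. x \<epsilon> F \<longrightarrow> (\<exists>y. y \<epsilon> x)) \<longrightarrow>
       (\<exists>f U. is_func f F U \<and> (\<forall>x. x \<epsilon> F \<longrightarrow> (\<forall>y. y \<epsilon> U \<longrightarrow> pair_in x y f \<longrightarrow> y \<epsilon> x))))"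
  by (simp add: AC_def)

lemma sat_DC: "sat E e DC \<longleftrightarrow>
    (\<forall>a r. (\<exists>x. x \<epsilon> a) \<and> (\<forall>x. x \<epsilon> a \<longrightarrow> (\<exists>y. y \<epsilon> a \<and> pair_in x y r)) \<longrightarrow>
       (\<exists>w f. is_omega w \<and> is_func f w a \<and>
          (\<forall>n m. n \<epsilon> w \<longrightarrow> m \<epsilon> w \<longrightarrow> is_succ n m \<longrightarrow>
             (\<forall>x y. x \<epsilon> a \<longrightarrow> y \<epsilon> a \<longrightarrow> pair_in n x f \<and> pair_in m y f \<longrightarrow> pair_in x y r))))"
  by (simp add: DC_def)

end

end

theory Submission
  imports Defs "HOL-Library.Countable_Set"
begin

text \<open>
  By completeness, start from a countable model of \<open>ZFC\<close>, possibly ill-founded. Adjoin with countable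
  conditions a generic subset of \<open>I \<times> I\<close>, where \<open>I\<close> is uncountable, and pass to the symmetric extension
  for the group of all bit flips, with countable sets of rows as supports. The extension satisfies \<open>DC\<close>
  since the forcing is countably closed. For \<open>\<alpha> \<in> I\<close> let \<open>B\<^sub>\<alpha>\<close> be the set of all translates of row \<open>\<alpha>\<close> by
  ground model sets. A flip of one undecided bit in row \<open>\<alpha>\<close> shows that a set with support \<open>S\<close> cannot
  choose from \<open>B\<^sub>\<alpha>\<close> for \<open>\<alpha> \<notin> S\<close>, so every partial choice function on the family is countable and none
  is total.

  Preorder the union of the family plus a top element so that two elements below the top are compatible
  iff they lie in the same \<open>B\<^sub>\<alpha>\<close>. Antichains are then partial choice functions, hence countable, while
  a countable predense set of non-top elements would yield a total choice function. If uncountably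
  many one-element cells are added, there are uncountable antichains, but the only maximal antichain
  is the top element.
\<close>

section \<open>Completeness\<close>

text \<open>Two requirements pull against each other. Dependent choice asks for supports closed
  under countable unions and for lower bounds of countable descending sequences; the failure of
  choice asks that no single support and no single condition control everything. Countable supports
  and countable domains, against an uncountable set that indexes both the rows and the bits of one
  row, meet both: a row outside a given support always exists, and every condition leaves one of its
  bits undecided. Translates of a row replace the row itself since a single row could be picked by
  its index, whereas the set of all translates is invariant under the group.

  Since membership in the model may be ill-founded, names cannot be evaluated by recursion: the
  extension consists of all elements of the ground model, taken as names, modulo equality forced by
  a condition in the generic filter. The two implications provable in ZF take the same semantic
  route: they are checked in every model with carrier \<open>nat\<close> and brought back by
  completeness.\<close>

instance fm :: countable
  by countable_datatype

section \<open>Renaming, weakening, compactness and generalisation for the deduction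
  calculus\<close>

lemma scons_lift: "(\<lambda>n. (0 ## (\<lambda>n. Suc (r n))) ((0 ## (\<lambda>n. Suc (s n))) n)) = (0 ## (\<lambda>n. Suc (r (s n))))"
  by (auto split: nat.split)

lemma ren_ren: "ren r (ren s p) = ren (\<lambda>n. r (s n)) p"
proof (induction p arbitrary: r s)
  case (Forall p)
  show ?case by (simp only: ren.simps Forall.IH scons_lift)
qed simp_all

lemma ren_cong: "(\<And>i. i < bnd p \<Longrightarrow> r i = s i) \<Longrightarrow> ren r p = ren s p"
proof (induction p arbitrary: r s)
  case (Imp p q)
  have "ren r p = ren s p" "ren r q = ren s q"
    by (rule Imp.IH, use Imp.prems in simp)+
  then show ?case by simp
next
  case (Forall p)
  have "ren (0 ## (\<lambda>n. Suc (r n))) p = ren (0 ## (\<lambda>n. Suc (s n))) p"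
    by (rule Forall.IH) (use Forall.prems in \<open>auto split: nat.split\<close>)
  then show ?case by simp
qed simp_all

lemma scons_id: "(0 ## (\<lambda>n. Suc n)) = (\<lambda>n. n)"
  by (auto split: nat.split)

lemma ren_id [simp]: "ren (\<lambda>n. n) p = p"
  by (induction p) (simp_all add: scons_id)

lemma ren_closed: "bnd p = 0 \<Longrightarrow> ren r p = p"
  using ren_cong[of p r "\<lambda>n. n"] by simp

lemma ren_Neg [simp]: "ren r (\<^bold>\<not>p) = \<^bold>\<not>(ren r p)"
  by (simp add: Neg_def)

lemma ren_inst: "ren r (inst p k) = inst (ren (0 ## (\<lambda>n. Suc (r n))) p) (r k)"
proof -
  have "(\<lambda>n. r ((k ## (\<lambda>n. n)) n)) = (\<lambda>n. (r k ## (\<lambda>n. n)) ((0 ## (\<lambda>n. Suc (r n))) n))"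
    by (auto split: nat.split)
  then show ?thesis by (simp add: inst_def ren_ren)
qed

lemma inst_lift: "inst (ren (0 ## (\<lambda>n. Suc (e n))) p) a = ren (a ## e) p"
proof -
  have "(\<lambda>n. (a ## (\<lambda>n. n)) ((0 ## (\<lambda>n. Suc (e n))) n)) = a ## e"
    by (auto split: nat.split)
  then show ?thesis by (simp add: inst_def ren_ren)
qed

lemma derivable_mono: "\<Gamma> \<^bold>\<turnstile> p \<Longrightarrow> \<Gamma> \<subseteq> \<Delta> \<Longrightarrow> \<Delta> \<^bold>\<turnstile> p"
proof (induction arbitrary: \<Delta> rule: derivable.induct)
  case (ImpI p \<Gamma> q)
  show ?case by (rule derivable.ImpI, rule ImpI.IH) (use ImpI.prems in blast)
next
  case (Raa p \<Gamma>)
  show ?case by (rule derivable.Raa, rule Raa.IH) (use Raa.prems in blast)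
next
  case (AllI \<Gamma> p)
  show ?case by (rule derivable.AllI, rule AllI.IH) (use AllI.prems in blast)
qed (blast intro: derivable.intros)+

lemma derivable_ren: "\<Gamma> \<^bold>\<turnstile> p \<Longrightarrow> ren r ` \<Gamma> \<^bold>\<turnstile> ren r p"
proof (induction arbitrary: r rule: derivable.induct)
  case (AllI \<Gamma> p)
  have "ren (0 ## (\<lambda>n. Suc (r n))) ` ren Suc ` \<Gamma> = ren Suc ` ren r ` \<Gamma>"
    by (simp add: image_image ren_ren)
  with AllI.IH[of "0 ## (\<lambda>n. Suc (r n))"] show ?case
    by (simp add: derivable.AllI)
next
  case (AllE \<Gamma> p k)
  from AllE.IH[of r] show ?case
    by (simp add: ren_inst derivable.AllE)
next
  case (EqE \<Gamma> i j p)
  from EqE.IH(1)[of r] EqE.IH(2)[of r] show ?case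
    unfolding ren_inst ren.simps by (rule derivable.EqE)
next
  case (Raa p \<Gamma>)
  from Raa.IH[of r] show ?case by (simp add: derivable.Raa)
next
  case (ImpI p \<Gamma> q)
  from ImpI.IH[of r] show ?case by (simp add: derivable.ImpI)
next
  case (ImpE \<Gamma> p q)
  from ImpE.IH(1)[of r] ImpE.IH(2)[of r] show ?case by (auto intro: derivable.ImpE)
qed (simp_all add: derivable.Assm derivable.EqI)

lemma finite_subset_insertE:
  assumes "finite F" "F \<subseteq> insert p G"
  obtains F' where "finite F'" "F' \<subseteq> G" "F \<subseteq> insert p F'"
  using that[of "F - {p}"] assms by blast

lemma derivable_compact: "\<Gamma> \<^bold>\<turnstile> p \<Longrightarrow> \<exists>F. finite F \<and> F \<subseteq> \<Gamma> \<and> F \<^bold>\<turnstile> p"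
proof (induction rule: derivable.induct)
  case (Assm p \<Gamma>)
  then show ?case by (intro exI[of _ "{p}"]) (auto intro: derivable.Assm)
next
  case (ImpI p \<Gamma> q)
  then obtain F where "finite F" "F \<subseteq> insert p \<Gamma>" "F \<^bold>\<turnstile> q" by blast
  then show ?case
    by (meson finite_subset_insertE derivable_mono derivable.ImpI)
next
  case (Raa p \<Gamma>)
  then obtain F where "finite F" "F \<subseteq> insert (\<^bold>\<not>p) \<Gamma>" "F \<^bold>\<turnstile> \<^bold>\<bottom>" by blast
  then show ?case
    by (meson finite_subset_insertE derivable_mono derivable.Raa)
next
  case (ImpE \<Gamma> p q)
  then obtain F F' where "finite F" "F \<subseteq> \<Gamma>" "F \<^bold>\<turnstile> p \<^bold>\<longrightarrow> q" "finite F'" "F' \<subseteq> \<Gamma>" "F' \<^bold>\<turnstile> p" by blast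
  then show ?case
    by (intro exI[of _ "F \<union> F'"]) (auto intro: derivable.ImpE derivable_mono)
next
  case (AllI \<Gamma> p)
  then obtain F where "finite F" "F \<subseteq> ren Suc ` \<Gamma>" "F \<^bold>\<turnstile> p" by blast
  then obtain F' where "F' \<subseteq> \<Gamma>" "finite F'" "F = ren Suc ` F'" by (meson finite_subset_image)
  with \<open>F \<^bold>\<turnstile> p\<close> show ?case by (blast intro: derivable.AllI)
next
  case (AllE \<Gamma> p k)
  then show ?case by (blast intro: derivable.AllE)
next
  case (EqI \<Gamma> k)
  show ?case by (intro exI[of _ "{}"]) (auto intro: derivable.EqI)
next
  case (EqE \<Gamma> i j p)
  then obtain F F' where "finite F" "F \<subseteq> \<Gamma>" "F \<^bold>\<turnstile> i \<^bold>= j" "finite F'" "F' \<subseteq> \<Gamma>" "F' \<^bold>\<turnstile> inst p i" by blast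
  then show ?case
    by (intro exI[of _ "F \<union> F'"]) (auto intro: derivable.EqE derivable_mono)
qed

text \<open>As \<open>x\<close> is free neither in \<Gamma> nor in the quantified formula, it can
  serve as eigenvariable: the renaming that sends \<open>x\<close> to 0 and every other
  \<open>n\<close> to \<open>Suc n\<close> shifts \<Gamma> as \<open>AllI\<close> demands and undoes
  the instantiation.\<close>

lemma derivable_gen:
  assumes "\<Gamma> \<^bold>\<turnstile> inst p x" "\<And>q. q \<in> \<Gamma> \<Longrightarrow> bnd q \<le> x" "bnd p \<le> Suc x"
  shows "\<Gamma> \<^bold>\<turnstile> \<^bold>\<forall>p"
proof (rule derivable.AllI)
  let ?r = "\<lambda>n. if n = x then 0 else Suc n"
  have "ren ?r q = ren Suc q" if "q \<in> \<Gamma>" for q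
    by (rule ren_cong) (use assms(2)[OF that] in auto)
  then have "ren ?r ` \<Gamma> = ren Suc ` \<Gamma>" by simp
  moreover have "ren ?r (inst p x) = ren (\<lambda>n. n) p"
    unfolding inst_def ren_ren
    by (rule ren_cong) (use assms(3) in \<open>auto split: nat.split\<close>)
  ultimately show "ren Suc ` \<Gamma> \<^bold>\<turnstile> p"
    using derivable_ren[OF assms(1), of ?r] by simp
qed

section \<open>Maximal consistent sets with Henkin witnesses\<close>

fun wit :: "fm \<Rightarrow> nat \<Rightarrow> fm" where
  "wit (\<^bold>\<forall>p \<^bold>\<longrightarrow> \<^bold>\<bottom>) x = \<^bold>\<not>(inst p x)"
| "wit p x = p"

lemma wit_Neg_Forall: "wit (\<^bold>\<not>(\<^bold>\<forall>p)) x = \<^bold>\<not>(inst p x)"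
  by (simp add: Neg_def)

lemma wit_cases:
  obtains r where "p = \<^bold>\<not>(\<^bold>\<forall>r)" | "\<And>x. wit p x = p"
  by (cases "(p, 0::nat)" rule: wit.cases) (auto simp: Neg_def)

text \<open>Variables play the part of Henkin constants. Each stage is a finite set, and \<Gamma>,
  kept outside the recursion, will be closed; so the maximum of the bounds is a variable that is
  free nowhere so far.\<close>

primrec henkin :: "fm set \<Rightarrow> nat \<Rightarrow> fm set" where
  "henkin \<Gamma> 0 = {}"
| "henkin \<Gamma> (Suc n) = (let p = from_nat n; F = henkin \<Gamma> n in
     if consistent (\<Gamma> \<union> insert p F) then insert p (insert (wit p (Max (bnd ` insert p F))) F) else F)"

lemma finite_henkin: "finite (henkin \<Gamma> n)"
  by (induction n) (simp_all add: Let_def)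

lemma henkin_mono: "m \<le> n \<Longrightarrow> henkin \<Gamma> m \<subseteq> henkin \<Gamma> n"
  by (rule lift_Suc_mono_le[of "henkin \<Gamma>"]) (auto simp: Let_def)

text \<open>If the witness made the set inconsistent, the set would prove the instance at a fresh
  variable, hence the universal formula whose negation was just added.\<close>

lemma consistent_henkin:
  assumes "consistent \<Gamma>" "\<And>q. q \<in> \<Gamma> \<Longrightarrow> bnd q = 0"
  shows "consistent (\<Gamma> \<union> henkin \<Gamma> n)"
proof (induction n)
  case 0
  show ?case using assms by simp
next
  case (Suc n)
  define p :: fm where "p = from_nat n"
  define F where "F = henkin \<Gamma> n"
  define x where "x = Max (bnd ` insert p F)"
  have fin: "finite F" by (simp add: F_def finite_henkin)
  show ?case
  proof (cases "consistent (\<Gamma> \<union> insert p F)")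
    case False
    then show ?thesis using Suc by (simp add: p_def F_def Let_def)
  next
    case True
    have "consistent (\<Gamma> \<union> insert p (insert (wit p x) F))"
    proof (cases rule: wit_cases[of p])
      case (1 r)
      have b: "bnd q \<le> x" if "q \<in> \<Gamma> \<union> insert p F" for q
        using that assms(2) fin by (auto simp: x_def)
      show ?thesis
        unfolding consistent_def
      proof
        let ?S = "\<Gamma> \<union> insert p F"
        assume "\<Gamma> \<union> insert p (insert (wit p x) F) \<^bold>\<turnstile> \<^bold>\<bottom>"
        then have "insert (\<^bold>\<not>(inst r x)) ?S \<^bold>\<turnstile> \<^bold>\<bottom>"
          by (rule derivable_mono) (auto simp: 1 wit_Neg_Forall)
        then have "?S \<^bold>\<turnstile> inst r x" by (rule derivable.Raa)
        moreover have "bnd r \<le> Suc x" using b[of p] 1 by (simp add: Neg_def)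
        ultimately have "?S \<^bold>\<turnstile> \<^bold>\<forall>r" using b by (auto intro: derivable_gen)
        moreover have "?S \<^bold>\<turnstile> \<^bold>\<forall>r \<^bold>\<longrightarrow> \<^bold>\<bottom>"
          by (rule derivable.Assm) (simp add: 1 Neg_def)
        ultimately have "?S \<^bold>\<turnstile> \<^bold>\<bottom>" by (blast intro: derivable.ImpE)
        with True show False by (simp add: consistent_def)
      qed
    next
      case 2
      then show ?thesis using True by simp
    qed
    then show ?thesis using True by (simp add: p_def F_def x_def Let_def)
  qed
qed

definition henkin_lim :: "fm set \<Rightarrow> fm set" where
  "henkin_lim \<Gamma> = \<Gamma> \<union> (\<Union>n. henkin \<Gamma> n)"

lemma consistent_henkin_lim:
  assumes "consistent \<Gamma>" "\<And>q. q \<in> \<Gamma> \<Longrightarrow> bnd q = 0"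
  shows "consistent (henkin_lim \<Gamma>)"
  unfolding consistent_def
proof
  assume "henkin_lim \<Gamma> \<^bold>\<turnstile> \<^bold>\<bottom>"
  then obtain F where F: "finite F" "F \<subseteq> henkin_lim \<Gamma>" "F \<^bold>\<turnstile> \<^bold>\<bottom>"
    using derivable_compact by blast
  from F(1,2) have "\<exists>n. F \<subseteq> \<Gamma> \<union> henkin \<Gamma> n"
  proof (induction F)
    case (insert p F)
    then obtain n where "F \<subseteq> \<Gamma> \<union> henkin \<Gamma> n" by auto
    moreover obtain m where "p \<in> \<Gamma> \<union> henkin \<Gamma> m" using insert by (auto simp: henkin_lim_def)
    moreover have "henkin \<Gamma> n \<subseteq> henkin \<Gamma> (max m n)" "henkin \<Gamma> m \<subseteq> henkin \<Gamma> (max m n)"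
      by (simp_all add: henkin_mono)
    ultimately have "insert p F \<subseteq> \<Gamma> \<union> henkin \<Gamma> (max m n)" by blast
    then show ?case by blast
  qed simp
  then obtain n where "F \<subseteq> \<Gamma> \<union> henkin \<Gamma> n" ..
  with F(3) have "\<Gamma> \<union> henkin \<Gamma> n \<^bold>\<turnstile> \<^bold>\<bottom>" by (rule derivable_mono)
  with consistent_henkin[OF assms] show False by (auto simp: consistent_def)
qed

text \<open>Equality is read as \<open>Q\<close>. Both the structure of variables built for
  completeness and the structure of names built by forcing satisfy formulas in this sense first, and
  become genuine models after division by \<open>Q\<close>.\<close>

primrec qsat :: "('a \<Rightarrow> 'a \<Rightarrow> bool) \<Rightarrow> ('a \<Rightarrow> 'a \<Rightarrow> bool) \<Rightarrow> (nat \<Rightarrow> 'a) \<Rightarrow> fm \<Rightarrow> bool" where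
  "qsat Q E e (i \<^bold>\<in> j) = E (e i) (e j)"
| "qsat Q E e (i \<^bold>= j) = Q (e i) (e j)"
| "qsat Q E e \<^bold>\<bottom> = False"
| "qsat Q E e (p \<^bold>\<longrightarrow> q) = (qsat Q E e p \<longrightarrow> qsat Q E e q)"
| "qsat Q E e (\<^bold>\<forall>p) = (\<forall>a. qsat Q E (a ## e) p)"

lemma qsat_connectives [simp]:
  "qsat Q E e (\<^bold>\<not>p) = (\<not> qsat Q E e p)"
  "qsat Q E e (p \<^bold>\<and> q) = (qsat Q E e p \<and> qsat Q E e q)"
  "qsat Q E e (p \<^bold>\<or> q) = (qsat Q E e p \<or> qsat Q E e q)"
  "qsat Q E e (p \<^bold>\<longleftrightarrow> q) = (qsat Q E e p \<longleftrightarrow> qsat Q E e q)"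
  "qsat Q E e (\<^bold>\<exists>p) = (\<exists>a. qsat Q E (a ## e) p)"
  "qsat Q E e (BAll x p) = (\<forall>a. E a (e x) \<longrightarrow> qsat Q E (a ## e) p)"
  "qsat Q E e (BEx x p) = (\<exists>a. E a (e x) \<and> qsat Q E (a ## e) p)"
  by (auto simp: Neg_def Con_def Dis_def Iff_def Exi_def BAll_def BEx_def)

lemma qsat_sat:
  assumes "surj h" "\<And>x y. Q x y \<longleftrightarrow> h x = h y" "\<And>x y. E x y \<longleftrightarrow> E' (h x) (h y)"
  shows "qsat Q E e p \<longleftrightarrow> sat E' (\<lambda>n. h (e n)) p"
proof (induction p arbitrary: e)
  case (Forall p)
  have "(\<lambda>n. h ((a ## e) n)) = h a ## (\<lambda>n. h (e n))" for a
    by (auto split: nat.split)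
  then have "qsat Q E e (\<^bold>\<forall>p) \<longleftrightarrow> (\<forall>a. sat E' (h a ## (\<lambda>n. h (e n))) p)"
    by (simp add: Forall.IH)
  also have "\<dots> \<longleftrightarrow> (\<forall>b. sat E' (b ## (\<lambda>n. h (e n))) p)"
    using assms(1) by (metis surj_def)
  finally show ?case by simp
qed (simp_all add: assms)

text \<open>The classes are coded by all of \<open>nat\<close>, so that ground model and extension
  have the same carrier type. A bijection of the classes with \<open>nat\<close> requires infinitely
  many of them, hence the last hypothesis.\<close>

lemma quotient_structure:
  fixes Q E :: "'a::countable \<Rightarrow> 'a \<Rightarrow> bool"
  assumes "equivp Q" "\<And>x x' y y'. Q x x' \<Longrightarrow> Q y y' \<Longrightarrow> E x y \<Longrightarrow> E x' y'"
    and inf: "\<And>Y. finite Y \<Longrightarrow> \<exists>x. \<forall>y\<in>Y. \<not> Q x y"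
  shows "\<exists>(h :: 'a \<Rightarrow> nat) E'. surj h \<and> (\<forall>x y. Q x y \<longleftrightarrow> h x = h y) \<and> (\<forall>x y. E x y \<longleftrightarrow> E' (h x) (h y))"
proof -
  let ?c = "\<lambda>x. {y. Q x y}"
  have c: "?c x = ?c y \<longleftrightarrow> Q x y" for x y
  proof -
    have "?c x = ?c y \<longleftrightarrow> Q x = Q y" by (auto simp: set_eq_iff fun_eq_iff)
    then show ?thesis using assms(1) unfolding equivp_def by blast
  qed
  have "infinite (range ?c)"
  proof
    assume "finite (range ?c)"
    then obtain Y where Y: "finite Y" "range ?c = ?c ` Y"
      by (metis finite_subset_image order_refl)
    from inf[OF Y(1)] obtain x where "\<forall>y\<in>Y. \<not> Q x y" by blast
    moreover have "?c x \<in> ?c ` Y" using Y(2) by blast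
    then obtain y where "y \<in> Y" "?c x = ?c y" by blast
    ultimately show False using c by blast
  qed
  moreover have "countable (range ?c)" by simp
  ultimately have bij: "bij_betw (to_nat_on (range ?c)) (range ?c) UNIV"
    by (rule to_nat_on_infinite[rotated])
  define h where "h x = to_nat_on (range ?c) (?c x)" for x
  have "surj h"
    using bij unfolding bij_betw_def h_def by (metis image_image)
  have h: "Q x y \<longleftrightarrow> h x = h y" for x y
  proof -
    have "inj_on (to_nat_on (range ?c)) (range ?c)" using bij by (simp add: bij_betw_def)
    then have "h x = h y \<longleftrightarrow> ?c x = ?c y"
      unfolding h_def by (rule inj_on_eq_iff) auto
    then show ?thesis using c by simp
  qed
  define E' where "E' m n = E (inv h m) (inv h n)" for m n
  have "Q (inv h (h x)) x" for x
    using h \<open>surj h\<close> by (simp add: surj_f_inv_f)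
  moreover have "Q x (inv h (h x))" for x
    using h \<open>surj h\<close> by (simp add: surj_f_inv_f)
  ultimately have "E x y \<longleftrightarrow> E' (h x) (h y)" for x y
    unfolding E'_def using assms(2) by metis
  with \<open>surj h\<close> h show ?thesis by blast
qed

lemma bnd_simps [simp]:
  "bnd (\<^bold>\<not>p) = bnd p" "bnd (p \<^bold>\<and> q) = max (bnd p) (bnd q)" "bnd (p \<^bold>\<or> q) = max (bnd p) (bnd q)"
  "bnd (p \<^bold>\<longleftrightarrow> q) = max (bnd p) (bnd q)" "bnd (\<^bold>\<exists>p) = bnd p - 1"
  "bnd (BAll x p) = max (Suc x) (bnd p - 1)" "bnd (BEx x p) = max (Suc x) (bnd p - 1)"
  by (auto simp: Neg_def Con_def Dis_def Iff_def Exi_def BAll_def BEx_def)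

lemma bnd_closure [simp]: "bnd (closure p) = 0"
proof -
  have "bnd ((Forall ^^ n) p) = bnd p - n" for n
    by (induction n) simp_all
  then show ?thesis by (simp add: closure_def)
qed

lemmas fm_defs = sub_fm_def empty_fm_def upair_fm_def opair_fm_def pair_in_fm_def rel_fm_def func_fm_def
  inj_fm_def succ_fm_def inductive_fm_def omega_fm_def countable_fm_def forcing_fm_def compat_fm_def
  antichain_fm_def maximal_antichain_fm_def predense_fm_def

lemma bnd_ZF: "p \<in> ZF \<Longrightarrow> bnd p = 0"
  by (auto simp: ZF_def Separation_def Replacement_def)
    (simp_all add: Extensionality_Ax_def Foundation_Ax_def Pairing_Ax_def Union_Ax_def Powerset_Ax_def
      Infinity_Ax_def fm_defs)

lemma bnd_ZFC: "p \<in> ZFC \<Longrightarrow> bnd p = 0"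
  by (auto simp: ZFC_def bnd_ZF) (simp add: AC_def fm_defs)

text \<open>Restricting to theories that contain ZF secures infinitely many classes of variables, as
  a model carried by \<open>nat\<close> requires.\<close>

theorem completeness_ZF:
  assumes cons: "consistent \<Gamma>" and closed: "\<And>q. q \<in> \<Gamma> \<Longrightarrow> bnd q = 0" and ZF: "ZF \<subseteq> \<Gamma>"
  shows "\<exists>E :: nat \<Rightarrow> nat \<Rightarrow> bool. \<forall>q\<in>\<Gamma>. \<forall>e. sat E e q"
proof -
  define \<Delta> where "\<Delta> = henkin_lim \<Gamma>"
  have con: "consistent \<Delta>"
    unfolding \<Delta>_def by (rule consistent_henkin_lim[OF cons closed])
  have \<Gamma>\<Delta>: "\<Gamma> \<subseteq> \<Delta>" by (auto simp: \<Delta>_def henkin_lim_def)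
  \<comment> \<open>The formula \<open>p\<close> is considered at stage \<open>to_nat p\<close>;
    consistency with the limit implies consistency with that stage.\<close>
  have maxi: "p \<in> \<Delta> \<and> (\<exists>x. wit p x \<in> \<Delta>)" if "consistent (insert p \<Delta>)" for p
  proof -
    let ?n = "to_nat p"
    have "consistent (\<Gamma> \<union> insert p (henkin \<Gamma> ?n))"
      using that unfolding consistent_def
      by (metis derivable_mono Un_insert_right insert_mono \<Delta>_def henkin_lim_def UN_upper Un_mono UNIV_I order_refl)
    then have "{p, wit p (Max (bnd ` insert p (henkin \<Gamma> ?n)))} \<subseteq> henkin \<Gamma> (Suc ?n)"
      by (simp add: Let_def)
    then show ?thesis unfolding \<Delta>_def henkin_lim_def by blast
  qed
  have ded: "p \<in> \<Delta>" if "\<Delta> \<^bold>\<turnstile> p" for p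
  proof -
    have "consistent (insert p \<Delta>)"
      unfolding consistent_def
    proof
      assume "insert p \<Delta> \<^bold>\<turnstile> \<^bold>\<bottom>"
      then have "\<Delta> \<^bold>\<turnstile> p \<^bold>\<longrightarrow> \<^bold>\<bottom>" by (rule derivable.ImpI)
      then have "\<Delta> \<^bold>\<turnstile> \<^bold>\<bottom>" using that by (rule derivable.ImpE)
      with con show False by (simp add: consistent_def)
    qed
    then show ?thesis using maxi by blast
  qed
  have neg: "\<^bold>\<not>p \<in> \<Delta>" if "p \<notin> \<Delta>" for p
  proof -
    have "insert p \<Delta> \<^bold>\<turnstile> \<^bold>\<bottom>" using that maxi by (auto simp: consistent_def)
    then show ?thesis unfolding Neg_def by (intro ded derivable.ImpI)
  qed
  have bot: "\<^bold>\<bottom> \<notin> \<Delta>" using con by (auto simp: consistent_def intro: derivable.Assm)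
  have mp: "q \<in> \<Delta>" if "p \<^bold>\<longrightarrow> q \<in> \<Delta>" "p \<in> \<Delta>" for p q
    using that by (blast intro: ded derivable.ImpE derivable.Assm)
  have imp: "p \<^bold>\<longrightarrow> q \<in> \<Delta> \<longleftrightarrow> (p \<in> \<Delta> \<longrightarrow> q \<in> \<Delta>)" for p q
  proof
    assume *: "p \<in> \<Delta> \<longrightarrow> q \<in> \<Delta>"
    show "p \<^bold>\<longrightarrow> q \<in> \<Delta>"
    proof (cases "p \<in> \<Delta>")
      case True
      with * have "q \<in> \<Delta>" by blast
      then show ?thesis by (blast intro: ded derivable.ImpI derivable.Assm)
    next
      case False
      from neg[OF False] have "insert p \<Delta> \<^bold>\<turnstile> p \<^bold>\<longrightarrow> \<^bold>\<bottom>"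
        by (auto simp: Neg_def intro: derivable.Assm)
      then have "insert p \<Delta> \<^bold>\<turnstile> \<^bold>\<bottom>" by (rule derivable.ImpE) (simp add: derivable.Assm)
      then have "insert p \<Delta> \<^bold>\<turnstile> q" by (blast intro: derivable.Raa derivable_mono)
      then show ?thesis by (intro ded derivable.ImpI)
    qed
  qed (use mp in blast)
  define Q where "Q i j \<longleftrightarrow> i \<^bold>= j \<in> \<Delta>" for i j
  define E where "E i j \<longleftrightarrow> i \<^bold>\<in> j \<in> \<Delta>" for i j
  have sat: "qsat Q E e p \<longleftrightarrow> ren e p \<in> \<Delta>" for e p
  proof (induction p arbitrary: e)
    case (Forall p)
    let ?p = "ren (0 ## (\<lambda>n. Suc (e n))) p"
    have "(\<forall>a. inst ?p a \<in> \<Delta>) \<longleftrightarrow> \<^bold>\<forall>?p \<in> \<Delta>"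
    proof
      assume *: "\<forall>a. inst ?p a \<in> \<Delta>"
      show "\<^bold>\<forall>?p \<in> \<Delta>"
      proof (rule ccontr)
        assume "\<^bold>\<forall>?p \<notin> \<Delta>"
        then have "\<^bold>\<not>(\<^bold>\<forall>?p) \<in> \<Delta>" by (rule neg)
        then have "consistent (insert (\<^bold>\<not>(\<^bold>\<forall>?p)) \<Delta>)" using con by (simp add: insert_absorb)
        then obtain x where "\<^bold>\<not>(inst ?p x) \<in> \<Delta>" using maxi wit_Neg_Forall by metis
        with * bot imp show False by (auto simp: Neg_def)
      qed
    qed (blast intro: ded derivable.AllE derivable.Assm)
    then show ?case by (simp add: Forall.IH inst_lift)
  qed (simp_all add: Q_def E_def bot imp)
  have sat': "qsat Q E e p" if "p \<in> \<Gamma>" for e p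
    using that closed \<Gamma>\<Delta> by (auto simp: sat ren_closed)
  \<comment> \<open>Leibniz's law. Symmetry, transitivity and congruence follow by choosing the
    formula.\<close>
  have Qsub: "inst p j \<in> \<Delta>" if "Q i j" "inst p i \<in> \<Delta>" for p i j
    using that unfolding Q_def by (blast intro: ded derivable.EqE derivable.Assm)
  have refl: "Q i i" for i by (auto simp: Q_def intro: ded derivable.EqI)
  have sym: "Q j i" if "Q i j" for i j
    using Qsub[OF that, of "0 \<^bold>= Suc i"] refl[of i] by (simp add: inst_def Q_def)
  have trans: "Q i k" if "Q i j" "Q j k" for i j k
    using Qsub[OF that(2), of "Suc i \<^bold>= 0"] that(1) by (simp add: inst_def Q_def)
  have eq: "equivp Q"
    by (rule equivpI) (auto simp: reflp_def symp_def transp_def intro: refl sym trans)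
  have cong: "E x' y'" if "Q x x'" "Q y y'" "E x y" for x x' y y'
  proof -
    have "E x' y" using Qsub[OF that(1), of "0 \<^bold>\<in> Suc y"] that(3) by (simp add: inst_def E_def)
    then show ?thesis using Qsub[OF that(2), of "Suc x' \<^bold>\<in> 0"] by (simp add: inst_def E_def)
  qed
  have pair: "\<exists>z. \<forall>u. E u z \<longleftrightarrow> Q u x \<or> Q u y" for x y
    using sat'[of Pairing_Ax "\<lambda>_. 0"] ZF by (simp add: ZF_def Pairing_Ax_def upair_fm_def subset_iff)
  have union: "\<exists>u. \<forall>z. E z u \<longleftrightarrow> (\<exists>y. E y x \<and> E z y)" for x
    using sat'[of Union_Ax "\<lambda>_. 0"] ZF by (simp add: ZF_def Union_Ax_def subset_iff)
  have found: "\<exists>y. E y x \<and> (\<forall>z. E z y \<longrightarrow> \<not> E z x)" if "E y x" for x y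
    using sat'[of Foundation_Ax "\<lambda>_. 0"] ZF that by (auto simp: ZF_def Foundation_Ax_def)
  have big: "\<exists>u. \<forall>y\<in>Y. E y u" if "finite Y" for Y
    using that
  proof (induction Y)
    case (insert y Y)
    then obtain u where u: "\<forall>y\<in>Y. E y u" by blast
    obtain s where s: "\<And>z. E z s \<longleftrightarrow> Q z y \<or> Q z y" using pair by blast
    obtain t where t: "\<And>z. E z t \<longleftrightarrow> Q z u \<or> Q z s" using pair by blast
    obtain v where v: "\<And>z. E z v \<longleftrightarrow> (\<exists>y. E y t \<and> E z y)" using union by blast
    show ?case
      by (rule exI[of _ v]) (use u s t v refl in blast)
  qed simp
  have irr: "\<not> E x x" for x
  proof
    assume x: "E x x"
    obtain s where s: "\<And>z. E z s \<longleftrightarrow> Q z x \<or> Q z x" using pair by blast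
    then obtain y where "E y s" "\<forall>z. E z y \<longrightarrow> \<not> E z s" using found refl by metis
    then show False using s x cong refl sym by metis
  qed
  \<comment> \<open>A set that contains all of \<open>Y\<close> cannot equal a member of
    \<open>Y\<close>, for it would then contain itself.\<close>
  have inf: "\<exists>x. \<forall>y\<in>Y. \<not> Q x y" if fin: "finite Y" for Y
  proof -
    obtain u where u: "\<forall>y\<in>Y. E y u" using big[OF fin] by blast
    have "\<not> Q u y" if "y \<in> Y" for y
      using u that irr[of u] cong[of y u u u] refl sym by blast
    then show ?thesis by blast
  qed
  have "\<exists>(h :: nat \<Rightarrow> nat) E'. surj h \<and> (\<forall>x y. Q x y \<longleftrightarrow> h x = h y) \<and> (\<forall>x y. E x y \<longleftrightarrow> E' (h x) (h y))"
    by (rule quotient_structure[OF eq]) (fact cong, fact inf)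
  then obtain h :: "nat \<Rightarrow> nat" and E'
    where h: "surj h" "\<And>x y. Q x y \<longleftrightarrow> h x = h y" "\<And>x y. E x y \<longleftrightarrow> E' (h x) (h y)"
    by blast
  have "sat E' e q" if "q \<in> \<Gamma>" for q e
  proof -
    have "qsat Q E (\<lambda>n. 0) q \<longleftrightarrow> sat E' (\<lambda>n. h 0) q"
      by (rule qsat_sat) (fact h)+
    then have "sat E' (\<lambda>n. h 0) q" using sat'[OF that] by blast
    moreover have "sat E' e q = sat E' (\<lambda>n. h 0) q"
      by (rule sat_bnd) (simp add: closed[OF that])
    ultimately show ?thesis by simp
  qed
  then show ?thesis by blast
qed

section \<open>Set theory inside a model of ZF\<close>

text \<open>These rules follow the syntax of a HOL expression; once they apply, Separation,
  Replacement and induction inside the model become available for HOL predicates.\<close>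

named_theorems dfI

locale zf_model =
  fixes E :: "'a \<Rightarrow> 'a \<Rightarrow> bool"  (infix "\<epsilon>" 50)
  assumes ZF: "q \<in> ZF \<Longrightarrow> sat E e q"
begin

text \<open>
  Definability with parameters: \<open>\<sigma>\<close> sends a variable of \<open>\<phi>\<close> to a position of the environment or to a
  parameter. A term \<open>t\<close> satisfies \<open>tm t\<close> iff its graph is definable.
\<close>

definition dfn :: "((nat \<Rightarrow> 'a) \<Rightarrow> bool) \<Rightarrow> bool" where
  "dfn Q \<longleftrightarrow> (\<exists>\<phi> \<sigma>. \<forall>e. Q e = sat E (\<lambda>n. case_sum e id (\<sigma> n)) \<phi>)"

definition tm :: "((nat \<Rightarrow> 'a) \<Rightarrow> 'a) \<Rightarrow> bool" where
  "tm t \<longleftrightarrow> dfn (\<lambda>e. e 0 = t (\<lambda>n. e (Suc n)))"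

lemma dfn_reindex:
  assumes "dfn Q"
  shows "dfn (\<lambda>e. Q (\<lambda>n. case_sum e id (\<rho> n)))"
proof -
  from assms obtain \<phi> \<sigma> where Q: "\<And>e. Q e = sat E (\<lambda>n. case_sum e id (\<sigma> n)) \<phi>"
    by (auto simp: dfn_def)
  have "(\<lambda>n. case_sum (\<lambda>n. case_sum e id (\<rho> n)) id (\<sigma> n)) =
        (\<lambda>n. case_sum e id (case_sum \<rho> Inr (\<sigma> n)))" for e
    by (auto split: sum.split)
  then have "\<forall>e. Q (\<lambda>n. case_sum e id (\<rho> n)) = sat E (\<lambda>n. case_sum e id (case_sum \<rho> Inr (\<sigma> n))) \<phi>"
    by (simp add: Q)
  then show ?thesis unfolding dfn_def by (intro exI) 
qed

lemma dfn_ren: "dfn Q \<Longrightarrow> dfn (\<lambda>e. Q (\<lambda>n. e (r n)))"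
  using dfn_reindex[of Q "\<lambda>n. Inl (r n)"] by simp

lemma dfn_False: "dfn (\<lambda>e. False)"
  unfolding dfn_def by (intro exI[of _ "\<^bold>\<bottom>"]) simp

lemma dfn_imp [dfI]:
  assumes "dfn P" "dfn Q"
  shows "dfn (\<lambda>e. P e \<longrightarrow> Q e)"
proof -
  from assms obtain \<phi> \<sigma> \<psi> \<tau> where
    P: "\<And>e. P e = sat E (\<lambda>n. case_sum e id (\<sigma> n)) \<phi>" and
    Q: "\<And>e. Q e = sat E (\<lambda>n. case_sum e id (\<tau> n)) \<psi>"
    by (auto simp: dfn_def)
  \<comment> \<open>The two formulas may assign their variables differently: even variables are
    given to the first, odd ones to the second.\<close>
  let ?u = "\<lambda>n. if even n then \<sigma> (n div 2) else \<tau> (n div 2)"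
  have "\<forall>e. (P e \<longrightarrow> Q e) =
      sat E (\<lambda>n. case_sum e id (?u n)) (ren (\<lambda>n. 2 * n) \<phi> \<^bold>\<longrightarrow> ren (\<lambda>n. Suc (2 * n)) \<psi>)"
    by (simp add: P Q)
  then show ?thesis unfolding dfn_def by (intro exI)
qed

lemma dfn_all [dfI]:
  assumes "dfn (\<lambda>e. Q (e 0) (\<lambda>n. e (Suc n)))"
  shows "dfn (\<lambda>e. \<forall>x. Q x e)"
proof -
  from assms obtain \<phi> \<sigma> where
    Q: "\<And>e. Q (e 0) (\<lambda>n. e (Suc n)) = sat E (\<lambda>n. case_sum e id (\<sigma> n)) \<phi>"
    by (auto simp: dfn_def)
  \<comment> \<open>Variables assigned to environment position 0 become the bound variable; the
    others are shifted past it, and \<open>?u\<close> lowers their positions by one.\<close>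
  let ?r = "\<lambda>n. if \<sigma> n = Inl 0 then 0 else Suc n"
  let ?u = "\<lambda>n. case \<sigma> n of Inl i \<Rightarrow> Inl (i - 1) | Inr v \<Rightarrow> Inr v"
  have "(\<lambda>n. (x ## (\<lambda>n. case_sum e id (?u n))) (?r n)) = (\<lambda>n. case_sum (x ## e) id (\<sigma> n))" for x e
    by (auto split: sum.split nat.split)
  then have "\<forall>e. (\<forall>x. Q x e) = sat E (\<lambda>n. case_sum e id (?u n)) (\<^bold>\<forall>(ren ?r \<phi>))"
    using Q[of "x ## e" for x e] by simp
  then show ?thesis unfolding dfn_def by (intro exI)
qed

lemma dfn_not [dfI]: "dfn P \<Longrightarrow> dfn (\<lambda>e. \<not> P e)"
  using dfn_imp[OF _ dfn_False] by simp

lemma dfn_const [dfI]: "dfn (\<lambda>e. b)"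
  using dfn_False dfn_not[OF dfn_False] by (cases b) simp_all

lemma dfn_and [dfI]: "dfn P \<Longrightarrow> dfn Q \<Longrightarrow> dfn (\<lambda>e. P e \<and> Q e)"
  using dfn_not[OF dfn_imp[OF _ dfn_not]] by simp

lemma dfn_or [dfI]: "dfn P \<Longrightarrow> dfn Q \<Longrightarrow> dfn (\<lambda>e. P e \<or> Q e)"
  using dfn_imp[OF dfn_not] by (simp add: disj_imp)

lemma dfn_iff [dfI]: "dfn P \<Longrightarrow> dfn Q \<Longrightarrow> dfn (\<lambda>e. P e \<longleftrightarrow> Q e)"
  using dfn_and[OF dfn_imp dfn_imp, of P Q Q P] by (simp add: iff_conv_conj_imp)

lemma dfn_ex [dfI]:
  assumes "dfn (\<lambda>e. Q (e 0) (\<lambda>n. e (Suc n)))"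
  shows "dfn (\<lambda>e. \<exists>x. Q x e)"
  using dfn_not[OF dfn_all[OF dfn_not[OF assms]]] by simp

lemma dfn_eq_var: "dfn (\<lambda>e. e i = e j)"
proof -
  have "\<forall>e. (e i = e j) = sat E (\<lambda>n. case_sum e id ((if n = 0 then Inl i else Inl j))) (0 \<^bold>= 1)"
    by simp
  then show ?thesis unfolding dfn_def by (intro exI)
qed

lemma dfn_mem_var: "dfn (\<lambda>e. e i \<epsilon> e j)"
proof -
  have "\<forall>e. (e i \<epsilon> e j) = sat E (\<lambda>n. case_sum e id ((if n = 0 then Inl i else Inl j))) (0 \<^bold>\<in> 1)"
    by simp
  then show ?thesis unfolding dfn_def by (intro exI)
qed

lemma tm_var [dfI]: "tm (\<lambda>e. e k)"
  unfolding tm_def by (rule dfn_eq_var)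

lemma tm_const [dfI]: "tm (\<lambda>e. c)"
  using dfn_reindex[OF dfn_eq_var[of 0 1], of "\<lambda>n. if n = 0 then Inl 0 else Inr c"]
  by (simp add: tm_def)

lemma tm_ren: "tm t \<Longrightarrow> tm (\<lambda>e. t (\<lambda>n. e (r n)))"
  using dfn_ren[of "\<lambda>e. e 0 = t (\<lambda>n. e (Suc n))" "0 ## (\<lambda>n. Suc (r n))"]
  by (simp add: tm_def)

lemma dfn_tm: "tm t \<Longrightarrow> dfn (\<lambda>e. e i = t (\<lambda>n. e (r n)))"
  using dfn_ren[of "\<lambda>e. e 0 = t (\<lambda>n. e (Suc n))" "i ## r"]
  by (simp add: tm_def)

lemma dfn_subst:
  assumes "tm s" "dfn (\<lambda>e. Q (e 0) (\<lambda>n. e (Suc n)))"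
  shows "dfn (\<lambda>e. Q (s e) e)"
proof -
  have "dfn (\<lambda>e. \<exists>x. x = s e \<and> Q x e)"
    by (intro dfn_ex dfn_and assms(2)) (use assms(1) in \<open>simp add: tm_def\<close>)
  then show ?thesis by simp
qed

lemma dfn_P1: "dfn (\<lambda>e. P (e 0)) \<Longrightarrow> tm s \<Longrightarrow> dfn (\<lambda>e. P (s e))"
  by (rule dfn_subst)

lemma dfn_P2:
  assumes "dfn (\<lambda>e. P (e 0) (e 1))" "tm s" "tm t"
  shows "dfn (\<lambda>e. P (s e) (t e))"
proof (rule dfn_subst[OF assms(2), where Q = "\<lambda>x e. P x (t e)"])
  show "dfn (\<lambda>e. P (e 0) (t (\<lambda>n. e (Suc n))))"
    by (rule dfn_subst[OF tm_ren[OF assms(3)], where Q = "\<lambda>y e. P (e 0) y"])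
      (use dfn_ren[OF assms(1), of "\<lambda>n. if n = 0 then 1 else 0"] in simp)
qed

lemma dfn_P3:
  assumes "dfn (\<lambda>e. P (e 0) (e 1) (e 2))" "tm s" "tm t" "tm u"
  shows "dfn (\<lambda>e. P (s e) (t e) (u e))"
proof (rule dfn_subst[OF assms(4), where Q = "\<lambda>x e. P (s e) (t e) x"])
  have "dfn (\<lambda>e. P (s (\<lambda>n. e (Suc (Suc n)))) (e 0) (e 1))"
    by (rule dfn_subst[OF tm_ren[OF assms(2)], where Q = "\<lambda>y e. P y (e 0) (e 1)"])
      (use assms(1) in \<open>simp add: numeral_2_eq_2\<close>)
  from dfn_subst[OF tm_ren[OF assms(3)], where Q = "\<lambda>y e. P (s (\<lambda>n. e (Suc n))) y (e 0)", OF this[simplified]]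
  show "dfn (\<lambda>e. P (s (\<lambda>n. e (Suc n))) (t (\<lambda>n. e (Suc n))) (e 0))" by simp
qed

lemma dfn_mem [dfI]: "tm s \<Longrightarrow> tm t \<Longrightarrow> dfn (\<lambda>e. s e \<epsilon> t e)"
  by (rule dfn_P2[where P = E, OF dfn_mem_var])

lemma dfn_eq [dfI]: "tm s \<Longrightarrow> tm t \<Longrightarrow> dfn (\<lambda>e. s e = t e)"
  by (rule dfn_P2[where P = "(=)", OF dfn_eq_var])

lemma tm_if [dfI]: "dfn P \<Longrightarrow> tm s \<Longrightarrow> tm t \<Longrightarrow> tm (\<lambda>e. if P e then s e else t e)"
proof -
  assume *: "dfn P" "tm s" "tm t"
  have "dfn (\<lambda>e. (P (\<lambda>n. e (Suc n)) \<and> e 0 = s (\<lambda>n. e (Suc n))) \<or>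
    (\<not> P (\<lambda>n. e (Suc n)) \<and> e 0 = t (\<lambda>n. e (Suc n))))"
    by (intro dfn_or dfn_and dfn_not dfn_ren[OF *(1)] *(2,3)[unfolded tm_def])
  then show ?thesis unfolding tm_def by (rule back_subst[of dfn]) auto
qed

lemma tm_f1:
  assumes "tm (\<lambda>e. f (e 0))" "tm s"
  shows "tm (\<lambda>e. f (s e))"
  unfolding tm_def
  by (rule dfn_P2[where P = "\<lambda>x y. x = f y"]) (use assms(1) in \<open>simp add: tm_def\<close>, rule tm_var, rule tm_ren[OF assms(2)])

lemma tm_f2:
  assumes "tm (\<lambda>e. f (e 0) (e 1))" "tm s" "tm t"
  shows "tm (\<lambda>e. f (s e) (t e))"
  unfolding tm_def
  by (rule dfn_P3[where P = "\<lambda>x y z. x = f y z"])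
    (use assms(1) in \<open>simp add: tm_def numeral_2_eq_2\<close>, rule tm_var, rule tm_ren[OF assms(2)], rule tm_ren[OF assms(3)])

section \<open>Extensionality, comprehension terms, Separation and Replacement\<close>

lemma ext: "(\<And>z. z \<epsilon> x \<longleftrightarrow> z \<epsilon> y) \<Longrightarrow> x = y"
  using ZF[of Extensionality_Ax] unfolding sat_Extensionality by (simp add: ZF_def)

text \<open>A total abstraction operator with one fixed unspecified value on proper classes.
  Operations built from it are total functions whose definability needs no existence proof;
  membership in them is settled afterwards through \<open>isset\<close>.\<close>

definition coll :: "('a \<Rightarrow> bool) \<Rightarrow> 'a" where
  "coll P = (THE b. \<forall>z. z \<epsilon> b \<longleftrightarrow> P z)"

definition isset :: "('a \<Rightarrow> bool) \<Rightarrow> bool" where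
  "isset P \<longleftrightarrow> (\<exists>b. \<forall>z. z \<epsilon> b \<longleftrightarrow> P z)"

lemma coll_eq: "(\<And>z. z \<epsilon> b \<longleftrightarrow> P z) \<Longrightarrow> coll P = b"
  unfolding coll_def by (rule the_equality) (auto intro: ext)

lemma coll_iff: "isset P \<Longrightarrow> z \<epsilon> coll P \<longleftrightarrow> P z"
  unfolding isset_def using coll_eq[of _ P] by metis

lemma tm_coll [dfI]:
  assumes "dfn (\<lambda>e. Q (e 0) (\<lambda>n. e (Suc n)))"
  shows "tm (\<lambda>e. coll (\<lambda>z. Q z e))"
proof -
  let ?u = "THE b::'a. False"
  have *: "y = coll P \<longleftrightarrow> (\<forall>z. z \<epsilon> y \<longleftrightarrow> P z) \<or> (\<not> (\<exists>b. \<forall>z. z \<epsilon> b \<longleftrightarrow> P z)) \<and> y = ?u" for P y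
  proof (cases "isset P")
    case True
    then show ?thesis using coll_iff[OF True] coll_eq[of y P] by (auto simp: isset_def)
  next
    case False
    then have "(\<lambda>b. \<forall>z. z \<epsilon> b \<longleftrightarrow> P z) = (\<lambda>b. False)" by (auto simp: isset_def fun_eq_iff)
    then have "coll P = ?u" by (simp add: coll_def)
    with False show ?thesis by (auto simp: isset_def)
  qed
  have "(\<lambda>e. e 0 = coll (\<lambda>z. Q z (\<lambda>n. e (Suc n)))) = (\<lambda>e. (\<forall>z. z \<epsilon> e 0 \<longleftrightarrow> Q z (\<lambda>n. e (Suc n))) \<or>
      \<not> (\<exists>b. \<forall>z. z \<epsilon> b \<longleftrightarrow> Q z (\<lambda>n. e (Suc n))) \<and> e 0 = ?u)"
    by (rule HOL.ext) (rule *)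
  moreover have "dfn (\<lambda>e. (\<forall>z. z \<epsilon> e 0 \<longleftrightarrow> Q z (\<lambda>n. e (Suc n))) \<or>
      \<not> (\<exists>b. \<forall>z. z \<epsilon> b \<longleftrightarrow> Q z (\<lambda>n. e (Suc n))) \<and> e 0 = ?u)"
    by (intro dfI)
      (use dfn_ren[OF assms, of "0 ## (\<lambda>n. Suc (Suc n))"] dfn_ren[OF assms, of "0 ## (\<lambda>n. Suc (Suc (Suc n)))"] in simp_all)
  ultimately show ?thesis by (simp add: tm_def)
qed

definition sep :: "'a \<Rightarrow> ('a \<Rightarrow> bool) \<Rightarrow> 'a" where
  "sep a Q = coll (\<lambda>x. x \<epsilon> a \<and> Q x)"

definition img :: "('a \<Rightarrow> 'a) \<Rightarrow> 'a \<Rightarrow> 'a" where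
  "img f a = coll (\<lambda>y. \<exists>x. x \<epsilon> a \<and> y = f x)"

lemma isset_sep:
  assumes "dfn (\<lambda>e. Q (e 0))"
  shows "isset (\<lambda>x. x \<epsilon> a \<and> Q x)"
proof -
  from assms obtain \<phi> and \<sigma> :: "nat \<Rightarrow> nat + 'a" where Q: "\<And>e. Q (e 0) = sat E (\<lambda>n. case_sum e id (\<sigma> n)) \<phi>"
    by (auto simp: dfn_def)
  \<comment> \<open>In the Separation scheme 0 is the element and 1 the ambient set, so parameters
    start at 2. \<open>Q\<close> looks at position 0 only, so a constant environment will do, and
    every variable that is not a parameter goes to 0.\<close>
  let ?r = "\<lambda>n. case \<sigma> n of Inl _ \<Rightarrow> 0 | Inr _ \<Rightarrow> n + 2"
  let ?e = "\<lambda>n. case \<sigma> n of Inl _ \<Rightarrow> a | Inr v \<Rightarrow> v"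
  have "(\<lambda>n. (x ## a ## ?e) (?r n)) = (\<lambda>n. case_sum (\<lambda>_. x) id (\<sigma> n))" for x
    by (auto split: sum.split)
  then have *: "sat E (x ## a ## ?e) (ren ?r \<phi>) = Q x" for x
    using Q[of "\<lambda>_. x"] by simp
  have "sat E ?e (Separation (ren ?r \<phi>))"
    by (rule ZF) (simp add: ZF_def)
  then have "\<exists>b. \<forall>x. x \<epsilon> b \<longleftrightarrow> x \<epsilon> a \<and> sat E (x ## a ## ?e) (ren ?r \<phi>)"
    unfolding sat_Separation by (elim allE)
  then show ?thesis unfolding isset_def * .
qed

lemma isset_sub:
  assumes "dfn (\<lambda>e. Q (e 0))" "\<And>x. Q x \<Longrightarrow> x \<epsilon> a"
  shows "isset Q"
proof -
  have "(\<lambda>x. x \<epsilon> a \<and> Q x) = Q" using assms(2) by auto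
  with isset_sep[OF assms(1), of a] show ?thesis by simp
qed

lemma sep_iff: "dfn (\<lambda>e. Q (e 0)) \<Longrightarrow> x \<epsilon> sep a Q \<longleftrightarrow> x \<epsilon> a \<and> Q x"
  unfolding sep_def by (rule coll_iff, rule isset_sep)

lemma isset_rpl:
  assumes "dfn (\<lambda>e. R (e 0) (e 1))" and fn: "\<And>x y y'. x \<epsilon> a \<Longrightarrow> R x y \<Longrightarrow> R x y' \<Longrightarrow> y = y'"
  shows "isset (\<lambda>y. \<exists>x. x \<epsilon> a \<and> R x y)"
proof -
  from assms obtain \<phi> and \<sigma> :: "nat \<Rightarrow> nat + 'a" where R: "\<And>e. R (e 0) (e 1) = sat E (\<lambda>n. case_sum e id (\<sigma> n)) \<phi>"
    by (auto simp: dfn_def)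
  let ?r = "\<lambda>n. case \<sigma> n of Inl i \<Rightarrow> (if i = 0 then 0 else 1) | Inr _ \<Rightarrow> n + 3"
  let ?e = "\<lambda>n. case \<sigma> n of Inl _ \<Rightarrow> a | Inr v \<Rightarrow> v"
  have "(\<lambda>n. (x ## y ## a ## ?e) (?r n)) = (\<lambda>n. case_sum (x ## (\<lambda>_. y)) id (\<sigma> n))" for x y
    by (auto split: sum.split nat.split simp: numeral_3_eq_3)
  then have *: "sat E (x ## y ## a ## ?e) (ren ?r \<phi>) = R x y" for x y
    using R[of "x ## (\<lambda>_. y)"] by simp
  have "sat E ?e (Replacement (ren ?r \<phi>))"
    by (rule ZF) (simp add: ZF_def)
  then have "(\<forall>x. x \<epsilon> a \<longrightarrow> (\<forall>y y'. sat E (x ## y ## a ## ?e) (ren ?r \<phi>) \<and>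
      sat E (x ## y' ## a ## ?e) (ren ?r \<phi>) \<longrightarrow> y = y')) \<longrightarrow>
      (\<exists>b. \<forall>y. y \<epsilon> b \<longleftrightarrow> (\<exists>x. x \<epsilon> a \<and> sat E (x ## y ## a ## ?e) (ren ?r \<phi>)))"
    unfolding sat_Replacement by (elim allE)
  then have "(\<forall>x. x \<epsilon> a \<longrightarrow> (\<forall>y y'. R x y \<and> R x y' \<longrightarrow> y = y')) \<longrightarrow>
      (\<exists>b. \<forall>y. y \<epsilon> b \<longleftrightarrow> (\<exists>x. x \<epsilon> a \<and> R x y))"
    unfolding * .
  then show ?thesis unfolding isset_def using fn by blast
qed

lemma img_iff:
  assumes "tm (\<lambda>e. f (e 0))"
  shows "y \<epsilon> img f a \<longleftrightarrow> (\<exists>x. x \<epsilon> a \<and> y = f x)"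
  unfolding img_def
proof (rule coll_iff, rule isset_rpl)
  show "dfn (\<lambda>e. e 1 = f (e 0))" using dfn_tm[OF assms, of 1 "\<lambda>n. n"] by simp
qed simp

lemma tm_sep [dfI]:
  assumes "tm t" "dfn (\<lambda>e. Q (e 0) (\<lambda>n. e (Suc n)))"
  shows "tm (\<lambda>e. sep (t e) (\<lambda>x. Q x e))"
  unfolding sep_def by (intro tm_coll dfn_and dfn_mem tm_var tm_ren[OF assms(1)] assms(2))

lemma tm_img [dfI]:
  assumes "tm t" "tm (\<lambda>e. f (e 0) (\<lambda>n. e (Suc n)))"
  shows "tm (\<lambda>e. img (\<lambda>x. f x e) (t e))"
  unfolding img_def
  by (intro tm_coll dfn_ex dfn_and dfn_mem dfn_eq tm_var tm_ren[OF assms(1)])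
    (use tm_ren[OF assms(2), of "0 ## (\<lambda>n. Suc (Suc n))"] in simp)

section \<open>Basic operations, ordered pairs and \<omega>\<close>

definition zero where "zero = coll (\<lambda>z. False)"
definition upr where "upr x y = coll (\<lambda>z. z = x \<or> z = y)"
definition uni where "uni x = coll (\<lambda>z. \<exists>y. y \<epsilon> x \<and> z \<epsilon> y)"
definition sub where "sub x y \<longleftrightarrow> (\<forall>z. z \<epsilon> x \<longrightarrow> z \<epsilon> y)"
definition pow where "pow x = coll (\<lambda>z. sub z x)"
definition cup where "cup x y = coll (\<lambda>z. z \<epsilon> x \<or> z \<epsilon> y)"
definition sc where "sc x = coll (\<lambda>z. z \<epsilon> x \<or> z = x)"
definition pr where "pr x y = upr (upr x x) (upr x y)"
definition prd where "prd a b = coll (\<lambda>z. \<exists>x y. x \<epsilon> a \<and> y \<epsilon> b \<and> z = pr x y)"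
text \<open>A uniquely determined set is denoted by collecting its elements, which makes the term an
  instance of \<open>coll\<close>. Iterates and choice functions below are written in the same
  way.\<close>

definition fs where "fs p = coll (\<lambda>z. \<exists>x y. p = pr x y \<and> z \<epsilon> x)"
definition sn where "sn p = coll (\<lambda>z. \<exists>x y. p = pr x y \<and> z \<epsilon> y)"
definition ind where "ind w \<longleftrightarrow> zero \<epsilon> w \<and> (\<forall>x. x \<epsilon> w \<longrightarrow> sc x \<epsilon> w)"
definition om where "om = coll (\<lambda>z. \<forall>w. ind w \<longrightarrow> z \<epsilon> w)"

lemma dfn_sub [dfI]: "tm s \<Longrightarrow> tm t \<Longrightarrow> dfn (\<lambda>e. sub (s e) (t e))"
  by (rule dfn_P2, unfold sub_def, intro dfI)
lemma tm_upr [dfI]: "tm s \<Longrightarrow> tm t \<Longrightarrow> tm (\<lambda>e. upr (s e) (t e))"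
  by (rule tm_f2, unfold upr_def, intro dfI)
lemma tm_uni [dfI]: "tm s \<Longrightarrow> tm (\<lambda>e. uni (s e))"
  by (rule tm_f1, unfold uni_def, intro dfI)
lemma tm_pow [dfI]: "tm s \<Longrightarrow> tm (\<lambda>e. pow (s e))"
  by (rule tm_f1, unfold pow_def, intro dfI)
lemma tm_cup [dfI]: "tm s \<Longrightarrow> tm t \<Longrightarrow> tm (\<lambda>e. cup (s e) (t e))"
  by (rule tm_f2, unfold cup_def, intro dfI)
lemma tm_sc [dfI]: "tm s \<Longrightarrow> tm (\<lambda>e. sc (s e))"
  by (rule tm_f1, unfold sc_def, intro dfI)
lemma tm_pr [dfI]: "tm s \<Longrightarrow> tm t \<Longrightarrow> tm (\<lambda>e. pr (s e) (t e))"
  by (rule tm_f2, unfold pr_def, intro dfI)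
lemma tm_prd [dfI]: "tm s \<Longrightarrow> tm t \<Longrightarrow> tm (\<lambda>e. prd (s e) (t e))"
  by (rule tm_f2, unfold prd_def, intro dfI)
lemma tm_fs [dfI]: "tm s \<Longrightarrow> tm (\<lambda>e. fs (s e))"
  by (rule tm_f1, unfold fs_def, intro dfI)
lemma tm_sn [dfI]: "tm s \<Longrightarrow> tm (\<lambda>e. sn (s e))"
  by (rule tm_f1, unfold sn_def, intro dfI)

lemma ZF_Pairing: "\<exists>z. \<forall>u. u \<epsilon> z \<longleftrightarrow> u = x \<or> u = y"
  using ZF[of Pairing_Ax] unfolding sat_Pairing is_upair_def by (simp add: ZF_def)

lemma ZF_Union: "\<exists>u. \<forall>z. z \<epsilon> u \<longleftrightarrow> (\<exists>y. y \<epsilon> x \<and> z \<epsilon> y)"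
  using ZF[of Union_Ax] unfolding sat_Union by (simp add: ZF_def)

lemma ZF_Pow: "\<exists>p. \<forall>z. z \<epsilon> p \<longleftrightarrow> sub z x"
  using ZF[of Powerset_Ax] unfolding sat_Powerset is_sub_def sub_def by (simp add: ZF_def)

lemma foundation: "y \<epsilon> x \<Longrightarrow> \<exists>y. y \<epsilon> x \<and> (\<forall>z. z \<epsilon> y \<longrightarrow> \<not> z \<epsilon> x)"
  using ZF[of Foundation_Ax] unfolding sat_Foundation by (auto simp: ZF_def)

lemma upr_iff [simp]: "z \<epsilon> upr x y \<longleftrightarrow> z = x \<or> z = y"
  unfolding upr_def by (rule coll_iff) (simp add: isset_def ZF_Pairing)
lemma uni_iff [simp]: "z \<epsilon> uni x \<longleftrightarrow> (\<exists>y. y \<epsilon> x \<and> z \<epsilon> y)"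
  unfolding uni_def by (rule coll_iff) (simp add: isset_def ZF_Union)
lemma pow_iff [simp]: "z \<epsilon> pow x \<longleftrightarrow> sub z x"
  unfolding pow_def by (rule coll_iff) (simp add: isset_def ZF_Pow)
lemma zero_iff [simp]: "\<not> z \<epsilon> zero"
proof -
  have "isset (\<lambda>z. False)" by (rule isset_sub[where a = "undefined"]) (intro dfI, simp)
  then show ?thesis unfolding zero_def by (simp add: coll_iff)
qed
lemma cup_iff [simp]: "z \<epsilon> cup x y \<longleftrightarrow> z \<epsilon> x \<or> z \<epsilon> y"
  unfolding cup_def
  by (rule coll_iff, rule isset_sub[where a = "uni (upr x y)"], intro dfI) auto
lemma sc_iff [simp]: "z \<epsilon> sc x \<longleftrightarrow> z \<epsilon> x \<or> z = x"
  unfolding sc_def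
  by (rule coll_iff, rule isset_sub[where a = "cup x (upr x x)"], intro dfI) auto

lemma upr_eq: "upr a b = upr c d \<longleftrightarrow> (a = c \<and> b = d) \<or> (a = d \<and> b = c)"
proof
  assume "upr a b = upr c d"
  then have "z = a \<or> z = b \<longleftrightarrow> z = c \<or> z = d" for z using upr_iff by metis
  then show "(a = c \<and> b = d) \<or> (a = d \<and> b = c)" by metis
qed (auto intro: ext)

lemma pr_eq [simp]: "pr x y = pr x' y' \<longleftrightarrow> x = x' \<and> y = y'"
  unfolding pr_def upr_eq by auto

lemma sub_refl [simp]: "sub x x" by (simp add: sub_def)

lemma subD: "sub x y \<Longrightarrow> z \<epsilon> x \<Longrightarrow> z \<epsilon> y" by (simp add: sub_def)

lemma prd_iff: "z \<epsilon> prd a b \<longleftrightarrow> (\<exists>x y. x \<epsilon> a \<and> y \<epsilon> b \<and> z = pr x y)"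
  unfolding prd_def
proof (rule coll_iff, rule isset_sub[where a = "pow (pow (cup a b))"])
  show "dfn (\<lambda>e. \<exists>x y. x \<epsilon> a \<and> y \<epsilon> b \<and> e 0 = pr x y)" by (intro dfI)
qed (auto simp: pr_def sub_def)

lemma pr_prd [simp]: "pr x y \<epsilon> prd a b \<longleftrightarrow> x \<epsilon> a \<and> y \<epsilon> b"
  by (auto simp: prd_iff)

lemma fs_pr [simp]: "fs (pr x y) = x"
  unfolding fs_def by (rule coll_eq) auto
lemma sn_pr [simp]: "sn (pr x y) = y"
  unfolding sn_def by (rule coll_eq) auto

lemma irrefl: "\<not> x \<epsilon> x"
  using foundation[of x "upr x x"] by auto

lemma asym: "x \<epsilon> y \<Longrightarrow> \<not> y \<epsilon> x"
  using foundation[of x "upr x y"] by auto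

lemma is_sub_iff: "is_sub E x y \<longleftrightarrow> sub x y"
  by (simp add: is_sub_def sub_def)
lemma is_empty_iff: "is_empty E x \<longleftrightarrow> x = zero"
  unfolding is_empty_def by (auto intro: ext)
lemma is_upair_iff: "is_upair E x y z \<longleftrightarrow> z = upr x y"
  unfolding is_upair_def by (auto intro: ext)
lemma is_opair_iff: "is_opair E x y z \<longleftrightarrow> z = pr x y"
  by (simp add: is_opair_def is_upair_iff pr_def)
lemma pair_in_iff: "pair_in E x y r \<longleftrightarrow> pr x y \<epsilon> r"
  by (simp add: pair_in_def is_opair_iff)
lemma is_succ_iff: "is_succ E x y \<longleftrightarrow> y = sc x"
  unfolding is_succ_def by (auto intro: ext)
lemma is_inductive_iff: "is_inductive E w \<longleftrightarrow> ind w"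
  by (auto simp: is_inductive_def is_empty_iff is_succ_iff ind_def)

lemma dfn_ind [dfI]: "tm s \<Longrightarrow> dfn (\<lambda>e. ind (s e))"
  by (rule dfn_P1, unfold ind_def, intro dfI)

lemma om_iff: "z \<epsilon> om \<longleftrightarrow> (\<forall>w. ind w \<longrightarrow> z \<epsilon> w)"
proof -
  obtain w where "ind w"
    using ZF[of Infinity_Ax] unfolding sat_Infinity is_inductive_iff by (auto simp: ZF_def)
  then show ?thesis
    unfolding om_def by (intro coll_iff isset_sub[where a = w] dfI) auto
qed

lemma ind_om: "ind om" by (auto simp: om_iff ind_def)

lemma zero_om [simp]: "zero \<epsilon> om" using ind_om by (simp add: ind_def)
lemma sc_om [simp]: "n \<epsilon> om \<Longrightarrow> sc n \<epsilon> om" using ind_om by (simp add: ind_def)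

lemma is_omega_iff: "is_omega E w \<longleftrightarrow> w = om"
proof
  assume *: "is_omega E w"
  then have "sub om w" "sub w om"
    using ind_om by (auto simp: is_omega_def is_inductive_iff sub_def om_iff is_sub_iff)
  then show "w = om" by (auto intro: ext simp: sub_def)
qed (auto simp: is_omega_def is_inductive_iff is_sub_iff sub_def om_iff ind_om)

lemma om_induct:
  assumes "dfn (\<lambda>e. Q (e 0))" "Q zero" "\<And>n. n \<epsilon> om \<Longrightarrow> Q n \<Longrightarrow> Q (sc n)" "n \<epsilon> om"
  shows "Q n"
proof -
  have "ind (sep om Q)" using assms(2,3) ind_om by (simp add: ind_def sep_iff[OF assms(1)])
  then have "n \<epsilon> sep om Q" using assms(4) om_iff by blast
  then show ?thesis by (simp add: sep_iff[OF assms(1)])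
qed

lemma sc_not_zero [simp]: "sc n \<noteq> zero" "zero \<noteq> sc n"
  by (metis sc_iff zero_iff)+

lemma sc_eq [simp]: "sc n = sc m \<longleftrightarrow> n = m"
  by (metis sc_iff asym)

lemma om_cases: "n \<epsilon> om \<Longrightarrow> n = zero \<or> (\<exists>m. m \<epsilon> om \<and> n = sc m)"
  by (rule om_induct[where Q = "\<lambda>n. n = zero \<or> (\<exists>m. m \<epsilon> om \<and> n = sc m)"], intro dfI) auto

lemma om_trans: "n \<epsilon> om \<Longrightarrow> \<forall>m. m \<epsilon> n \<longrightarrow> m \<epsilon> om"
  by (rule om_induct[where Q = "\<lambda>n. \<forall>m. m \<epsilon> n \<longrightarrow> m \<epsilon> om"], intro dfI) auto

lemma om_elem_trans: "n \<epsilon> om \<Longrightarrow> \<forall>m k. k \<epsilon> m \<longrightarrow> m \<epsilon> n \<longrightarrow> k \<epsilon> n"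
  by (rule om_induct[where Q = "\<lambda>n. \<forall>m k. k \<epsilon> m \<longrightarrow> m \<epsilon> n \<longrightarrow> k \<epsilon> n"], intro dfI) auto

lemma om_zero_least: "n \<epsilon> om \<Longrightarrow> n = zero \<or> zero \<epsilon> n"
  by (rule om_induct[where Q = "\<lambda>n. n = zero \<or> zero \<epsilon> n"], intro dfI) auto

lemma om_sc_le: "m \<epsilon> om \<Longrightarrow> k \<epsilon> m \<longrightarrow> sc k = m \<or> sc k \<epsilon> m"
  by (rule om_induct[where Q = "\<lambda>m. k \<epsilon> m \<longrightarrow> sc k = m \<or> sc k \<epsilon> m"], intro dfI) auto

lemma om_linear: "k \<epsilon> om \<Longrightarrow> \<forall>m. m \<epsilon> om \<longrightarrow> m \<epsilon> k \<or> m = k \<or> k \<epsilon> m"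
proof (rule om_induct[where Q = "\<lambda>k. \<forall>m. m \<epsilon> om \<longrightarrow> m \<epsilon> k \<or> m = k \<or> k \<epsilon> m"], intro dfI)
  show "\<forall>m. m \<epsilon> om \<longrightarrow> m \<epsilon> zero \<or> m = zero \<or> zero \<epsilon> m" using om_zero_least by blast
  show "\<forall>m. m \<epsilon> om \<longrightarrow> m \<epsilon> sc n \<or> m = sc n \<or> sc n \<epsilon> m"
    if "\<forall>m. m \<epsilon> om \<longrightarrow> m \<epsilon> n \<or> m = n \<or> n \<epsilon> m" for n
    using that om_sc_le by fastforce
qed

lemma om_least:
  assumes "dfn (\<lambda>e. Q (e 0))" "Q k" "k \<epsilon> om"
  shows "\<exists>n. n \<epsilon> om \<and> Q n \<and> (\<forall>m. m \<epsilon> om \<longrightarrow> Q m \<longrightarrow> n = m \<or> n \<epsilon> m)"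
proof -
  have "k \<epsilon> sep om Q" using assms by (simp add: sep_iff[OF assms(1)])
  from foundation[OF this] show ?thesis
    unfolding sep_iff[OF assms(1)] using om_linear by metis
qed

text \<open>A certificate for the \<open>n\<close>-th iterate is a set of pairs closed under predecessors.\<close>

definition itv :: "('a \<Rightarrow> 'a) \<Rightarrow> 'a \<Rightarrow> 'a \<Rightarrow> 'a \<Rightarrow> bool" where
  "itv G a n x \<longleftrightarrow> (\<exists>h. pr n x \<epsilon> h \<and> (\<forall>k y. pr k y \<epsilon> h \<longrightarrow>
     (k = zero \<and> y = a) \<or> (\<exists>m z. k = sc m \<and> pr m z \<epsilon> h \<and> y = G z)))"

definition it :: "('a \<Rightarrow> 'a) \<Rightarrow> 'a \<Rightarrow> 'a \<Rightarrow> 'a" where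
  "it G a n = coll (\<lambda>z. \<exists>x. itv G a n x \<and> z \<epsilon> x)"

lemma itv_zero: "itv G a zero x \<longleftrightarrow> x = a"
proof
  assume "x = a"
  then show "itv G a zero x"
    unfolding itv_def by (intro exI[of _ "upr (pr zero a) (pr zero a)"]) auto
next
  assume "itv G a zero x"
  then show "x = a" unfolding itv_def using sc_not_zero by metis
qed

lemma itv_sc: "itv G a (sc n) x \<longleftrightarrow> (\<exists>z. itv G a n z \<and> x = G z)"
proof
  assume "itv G a (sc n) x"
  then show "\<exists>z. itv G a n z \<and> x = G z" unfolding itv_def by (metis sc_eq sc_not_zero(1))
next
  assume "\<exists>z. itv G a n z \<and> x = G z"
  then obtain z h where *: "x = G z" "pr n z \<epsilon> h" "\<forall>k y. pr k y \<epsilon> h \<longrightarrow>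
     (k = zero \<and> y = a) \<or> (\<exists>m z. k = sc m \<and> pr m z \<epsilon> h \<and> y = G z)" by (auto simp: itv_def)
  let ?h = "cup h (upr (pr (sc n) x) (pr (sc n) x))"
  have "pr k y \<epsilon> ?h \<Longrightarrow> (k = zero \<and> y = a) \<or> (\<exists>m z. k = sc m \<and> pr m z \<epsilon> ?h \<and> y = G z)" for k y
    using * by (simp only: cup_iff upr_iff pr_eq) blast
  then show "itv G a (sc n) x"
    unfolding itv_def by (intro exI[of _ ?h]) auto
qed

lemma dfn_itv:
  assumes G: "tm (\<lambda>e. G (e 0))" and st: "tm r" "tm s" "tm t"
  shows "dfn (\<lambda>e. itv G (r e) (s e) (t e))"
  by (rule dfn_P3[where P = "itv G", OF _ st], unfold itv_def, intro dfI tm_f1[OF G])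

lemma tm_it:
  assumes G: "tm (\<lambda>e. G (e 0))" and st: "tm s" "tm t"
  shows "tm (\<lambda>e. it G (s e) (t e))"
  by (rule tm_f2[where f = "it G", OF _ st], unfold it_def, intro dfI dfn_itv[OF G])

lemma itv_ex1:
  assumes G: "tm (\<lambda>e. G (e 0))" and n: "n \<epsilon> om"
  shows "\<exists>x. \<forall>y. itv G a n y \<longleftrightarrow> y = x"
proof (rule om_induct[where Q = "\<lambda>n. \<exists>x. \<forall>y. itv G a n y \<longleftrightarrow> y = x", OF _ _ _ n])
  show "dfn (\<lambda>e. \<exists>x. \<forall>y. itv G a (e 0) y \<longleftrightarrow> y = x)" by (intro dfI dfn_itv[OF G])
qed (auto simp: itv_zero itv_sc)

lemma it_eq: "(\<And>y. itv G a n y \<longleftrightarrow> y = x) \<Longrightarrow> it G a n = x"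
  unfolding it_def by (rule coll_eq) auto

lemma it_zero [simp]: "it G a zero = a"
  by (rule it_eq) (rule itv_zero)

lemma it_sc:
  assumes G: "tm (\<lambda>e. G (e 0))" and n: "n \<epsilon> om"
  shows "it G a (sc n) = G (it G a n)"
proof -
  obtain x where x: "\<And>y. itv G a n y \<longleftrightarrow> y = x" using itv_ex1[OF assms] by blast
  then have "it G a n = x" by (rule it_eq)
  then show ?thesis by (intro it_eq) (simp add: itv_sc x)
qed

lemma closed_superset:
  assumes G: "tm (\<lambda>e. G (e 0))"
  shows "\<exists>w. a \<epsilon> w \<and> (\<forall>x. x \<epsilon> w \<longrightarrow> G x \<epsilon> w)"
proof (intro exI conjI allI impI)
  have i: "tm (\<lambda>e. it G a (e 0))" by (intro tm_it[OF G] dfI)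
  show "a \<epsilon> img (it G a) om" using it_zero[of G a] by (simp only: img_iff[OF i]) (metis zero_om)
  show "G x \<epsilon> img (it G a) om" if "x \<epsilon> img (it G a) om" for x
    using that it_sc[OF G] sc_om by (simp only: img_iff[OF i]) metis
qed

section \<open>Transitive sets, induction on membership, ranks and Collection\<close>

definition trans where "trans t \<longleftrightarrow> (\<forall>y z. z \<epsilon> y \<longrightarrow> y \<epsilon> t \<longrightarrow> z \<epsilon> t)"

lemma dfn_trans [dfI]: "tm s \<Longrightarrow> dfn (\<lambda>e. trans (s e))"
  by (rule dfn_P1, unfold trans_def, intro dfI)

lemma transD: "trans t \<Longrightarrow> z \<epsilon> y \<Longrightarrow> y \<epsilon> t \<Longrightarrow> z \<epsilon> t" by (auto simp: trans_def)

lemma trans_pr: assumes "trans t" "pr x y \<epsilon> t" shows "x \<epsilon> t" "y \<epsilon> t"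
proof -
  have "upr x y \<epsilon> t" using transD[OF assms(1) _ assms(2)] by (simp add: pr_def)
  then show "x \<epsilon> t" "y \<epsilon> t" using transD[OF assms(1), of _ "upr x y"] by auto
qed

text \<open>The set \<open>w\<close> contains \<open>{x}\<close> and is closed under unions, so its
  union is transitive: if z is in y, y in v and v in \<open>w\<close>, then z is in
  \<open>uni v\<close>, itself a member of \<open>w\<close>.\<close>

lemma transitive_superset: "\<exists>t. trans t \<and> x \<epsilon> t"
proof -
  have "tm (\<lambda>e. uni (e 0))" by (intro dfI)
  from closed_superset[OF this, of "upr x x"]
  obtain w where w: "upr x x \<epsilon> w" "\<And>x. x \<epsilon> w \<Longrightarrow> uni x \<epsilon> w" by blast
  have "trans (uni w)" unfolding trans_def uni_iff using w(2) uni_iff by blast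
  moreover have "x \<epsilon> uni w" using w(1) by auto
  ultimately show ?thesis by blast
qed

lemma eps_induct:
  assumes "dfn (\<lambda>e. Q (e 0))" "\<And>x. (\<And>y. y \<epsilon> x \<Longrightarrow> Q y) \<Longrightarrow> Q x"
  shows "Q x"
proof (rule ccontr)
  assume "\<not> Q x"
  obtain t where t: "trans t" "x \<epsilon> t" using transitive_superset by blast
  have C: "z \<epsilon> sep t (\<lambda>x. \<not> Q x) \<longleftrightarrow> z \<epsilon> t \<and> \<not> Q z" for z
    by (rule sep_iff) (intro dfI assms(1))
  with \<open>\<not> Q x\<close> t have "x \<epsilon> sep t (\<lambda>x. \<not> Q x)" by blast
  from foundation[OF this] obtain y where "y \<epsilon> t" "\<not> Q y" "\<And>z. z \<epsilon> y \<Longrightarrow> z \<epsilon> t \<Longrightarrow> Q z"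
    unfolding C by blast
  then show False using assms(2) transD[OF t(1)] by blast
qed

text \<open>Membership in the transitive closure of \<open>{x}\<close>, expressed through all
  transitive sets containing \<open>x\<close> so that no closure has to be formed.\<close>

definition tcl where "tcl y x \<longleftrightarrow> (\<forall>t. trans t \<longrightarrow> x \<epsilon> t \<longrightarrow> y \<epsilon> t)"

lemma dfn_tcl [dfI]: "tm s \<Longrightarrow> tm t \<Longrightarrow> dfn (\<lambda>e. tcl (s e) (t e))"
  by (rule dfn_P2, unfold tcl_def, intro dfI)

lemma tcl_refl: "tcl x x" by (simp add: tcl_def)
lemma tcl_step: "z \<epsilon> y \<Longrightarrow> tcl y x \<Longrightarrow> tcl z x" unfolding tcl_def trans_def by blast
lemma tcl_pr: "tcl (pr y z) x \<Longrightarrow> tcl y x" "tcl (pr y z) x \<Longrightarrow> tcl z x"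
  unfolding tcl_def using trans_pr by blast+

lemma tcl_cases:
  assumes "tcl y x"
  shows "y = x \<or> (\<exists>z. z \<epsilon> x \<and> tcl y z)"
proof -
  obtain t where t: "trans t" "x \<epsilon> t" using transitive_superset by blast
  let ?t = "sep t (\<lambda>y. y = x \<or> (\<exists>z. z \<epsilon> x \<and> tcl y z))"
  have T: "y \<epsilon> ?t \<longleftrightarrow> y \<epsilon> t \<and> (y = x \<or> (\<exists>z. z \<epsilon> x \<and> tcl y z))" for y
    by (rule sep_iff) (intro dfI)
  have "trans ?t" unfolding trans_def T
    using transD[OF t(1)] tcl_refl tcl_step by blast
  moreover have "x \<epsilon> ?t" using t T by blast
  ultimately have "y \<epsilon> ?t" using assms by (simp add: tcl_def)
  then show ?thesis by (simp add: T)
qed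

text \<open>A component of a Kuratowski pair lies several membership steps down, so the hypothesis
  covers everything below \<open>x\<close> and not merely its elements. Induction on names needs
  this form.\<close>

lemma tcl_induct:
  assumes "dfn (\<lambda>e. Q (e 0))" "\<And>x. (\<And>y z. z \<epsilon> x \<Longrightarrow> tcl y z \<Longrightarrow> Q y) \<Longrightarrow> Q x"
  shows "Q x"
proof -
  have "\<forall>y. tcl y x \<longrightarrow> Q y"
  proof (rule eps_induct[where Q = "\<lambda>x. \<forall>y. tcl y x \<longrightarrow> Q y"])
    show "dfn (\<lambda>e. \<forall>y. tcl y (e 0) \<longrightarrow> Q y)" by (intro dfI dfn_P1[OF assms(1)])
    show "\<forall>y. tcl y x \<longrightarrow> Q y" if "\<And>z. z \<epsilon> x \<Longrightarrow> \<forall>y. tcl y z \<longrightarrow> Q y" for x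
      using that tcl_cases assms(2) by metis
  qed
  then show ?thesis using tcl_refl by blast
qed

text \<open>\<open>sim x y\<close> says that the rank of \<open>x\<close> is at most the rank of \<open>y\<close>.\<close>

definition sim where
  "sim x y \<longleftrightarrow> (\<exists>R. pr x y \<epsilon> R \<and> (\<forall>a b a'. pr a b \<epsilon> R \<longrightarrow> a' \<epsilon> a \<longrightarrow> (\<exists>b'. b' \<epsilon> b \<and> pr a' b' \<epsilon> R)))"

lemma dfn_sim [dfI]: "tm s \<Longrightarrow> tm t \<Longrightarrow> dfn (\<lambda>e. sim (s e) (t e))"
  by (rule dfn_P2, unfold sim_def, intro dfI)

lemma sim_coinduct:
  assumes d: "dfn (\<lambda>e. K (e 0) (e 1))" and K: "K x y"
    and step: "\<And>a b a'. K a b \<Longrightarrow> a' \<epsilon> a \<Longrightarrow> \<exists>b'. b' \<epsilon> b \<and> K a' b'"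
  shows "sim x y"
proof -
  obtain s t where t: "trans s" "x \<epsilon> s" "trans t" "y \<epsilon> t" using transitive_superset by metis
  let ?R = "sep (prd s t) (\<lambda>z. \<exists>a b. z = pr a b \<and> K a b)"
  have R: "z \<epsilon> ?R \<longleftrightarrow> z \<epsilon> prd s t \<and> (\<exists>a b. z = pr a b \<and> K a b)" for z
    by (rule sep_iff) (intro dfI dfn_P2[OF d])
  have "\<exists>b'. b' \<epsilon> b \<and> pr a' b' \<epsilon> ?R" if "pr a b \<epsilon> ?R" "a' \<epsilon> a" for a b a'
    using that step[of a b a'] t transD[OF t(1)] transD[OF t(3)] by (auto simp: R)
  moreover have "pr x y \<epsilon> ?R" using K t by (auto simp: R)
  ultimately show ?thesis unfolding sim_def by blast
qed

lemma sim_iff: "sim x y \<longleftrightarrow> (\<forall>a. a \<epsilon> x \<longrightarrow> (\<exists>b. b \<epsilon> y \<and> sim a b))"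
proof
  show "sim x y \<Longrightarrow> \<forall>a. a \<epsilon> x \<longrightarrow> (\<exists>b. b \<epsilon> y \<and> sim a b)"
    unfolding sim_def by meson
  then have *: "sim a b \<Longrightarrow> a' \<epsilon> a \<Longrightarrow> \<exists>b'. b' \<epsilon> b \<and> sim a' b'" for a b a'
    unfolding sim_def by meson
  assume "\<forall>a. a \<epsilon> x \<longrightarrow> (\<exists>b. b \<epsilon> y \<and> sim a b)"
  moreover have "dfn (\<lambda>e. \<forall>a. a \<epsilon> e 0 \<longrightarrow> (\<exists>b. b \<epsilon> e 1 \<and> sim a b))" by (intro dfI)
  ultimately show "sim x y"
    using sim_coinduct[of "\<lambda>x y. \<forall>a. a \<epsilon> x \<longrightarrow> (\<exists>b. b \<epsilon> y \<and> sim a b)" x y] * by blast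
qed

text \<open>If the rank of \<open>x\<close> is not at most that of \<open>y\<close>, then the rank
  of \<open>y\<close> is at most that of some element of \<open>x\<close>. Ranks are thus compared
  linearly without being defined as ordinals.\<close>

lemma sim_total: "\<forall>y. sim x y \<or> (\<exists>a. a \<epsilon> x \<and> sim y a)"
proof (rule eps_induct[where Q = "\<lambda>x. \<forall>y. sim x y \<or> (\<exists>a. a \<epsilon> x \<and> sim y a)"])
  show "dfn (\<lambda>e. \<forall>y. sim (e 0) y \<or> (\<exists>a. a \<epsilon> e 0 \<and> sim y a))" by (intro dfI)
qed (metis sim_iff)

text \<open>These are levels of the cumulative hierarchy: a set of rank at most that of
  \<open>y\<close> is a subset of the union of the levels belonging to the elements of
  \<open>y\<close>.\<close>

lemma sim_isset: "isset (\<lambda>x. sim x y)"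
proof (rule eps_induct[where Q = "\<lambda>y. isset (\<lambda>x. sim x y)"])
  show "dfn (\<lambda>e. isset (\<lambda>x. sim x (e 0)))" unfolding isset_def by (intro dfI)
  fix y assume IH: "\<And>z. z \<epsilon> y \<Longrightarrow> isset (\<lambda>x. sim x z)"
  let ?D = "\<lambda>y. coll (\<lambda>x. sim x y)"
  have D: "d \<epsilon> img ?D y \<longleftrightarrow> (\<exists>z. z \<epsilon> y \<and> d = ?D z)" for d
    by (rule img_iff) (intro dfI)
  show "isset (\<lambda>x. sim x y)"
  proof (rule isset_sub[where a = "pow (uni (img ?D y))"])
    show "dfn (\<lambda>e. sim (e 0) y)" by (intro dfI)
    fix x assume "sim x y"
    then show "x \<epsilon> pow (uni (img ?D y))"
      using IH coll_iff unfolding sim_iff[of x y] pow_iff sub_def uni_iff D by metis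
  qed
qed

text \<open>Induction on a bound \<open>y\<close>. Either some element of \<open>y\<close> already
  bounds a member of the class, or no member has rank below that of \<open>y\<close>, and then any
  member bounded by \<open>y\<close> is least.\<close>

lemma sim_minimal:
  assumes d: "dfn (\<lambda>e. C (e 0))" and "C c"
  shows "\<exists>m. C m \<and> (\<forall>z. C z \<longrightarrow> sim m z)"
proof -
  have "(\<exists>z. C z \<and> sim z y) \<longrightarrow> (\<exists>m. C m \<and> (\<forall>z. C z \<longrightarrow> sim m z))" for y
  proof (rule eps_induct[where Q = "\<lambda>y. (\<exists>z. C z \<and> sim z y) \<longrightarrow> (\<exists>m. C m \<and> (\<forall>z. C z \<longrightarrow> sim m z))"])
    show "dfn (\<lambda>e. (\<exists>z. C z \<and> sim z (e 0)) \<longrightarrow> (\<exists>m. C m \<and> (\<forall>z. C z \<longrightarrow> sim m z)))"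
      by (intro dfI dfn_P1[OF d])
    fix y assume IH: "\<And>b. b \<epsilon> y \<Longrightarrow> (\<exists>z. C z \<and> sim z b) \<longrightarrow> (\<exists>m. C m \<and> (\<forall>z. C z \<longrightarrow> sim m z))"
    show "(\<exists>z. C z \<and> sim z y) \<longrightarrow> (\<exists>m. C m \<and> (\<forall>z. C z \<longrightarrow> sim m z))"
    proof (cases "\<exists>b z. b \<epsilon> y \<and> C z \<and> sim z b")
      case True
      then show ?thesis using IH by blast
    next
      case False
      have "sim m z" if "C z" "sim m y" for m z
      proof -
        from False that(1) have "sim y z" using sim_total by blast
        moreover have "sim a c" if "sim a b" "sim b c" for a b c
        proof (rule sim_coinduct[where K = "\<lambda>x z. \<exists>y. sim x y \<and> sim y z"])
          show "dfn (\<lambda>e. \<exists>y. sim (e 0) y \<and> sim y (e 1))" by (intro dfI)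
        qed (use that sim_iff in blast)+
        ultimately show ?thesis using that(2) by blast
      qed
      then show ?thesis by blast
    qed
  qed
  moreover have "sim c c"
    by (rule sim_coinduct[where K = "(=)"]) (intro dfI, auto)
  ultimately show ?thesis using \<open>C c\<close> by blast
qed

text \<open>Scott's trick: the witnesses of least rank form a set, to which Replacement
  applies.\<close>

lemma collection:
  assumes d: "dfn (\<lambda>e. K (e 0) (e 1))"
  shows "\<exists>b. \<forall>x. x \<epsilon> a \<longrightarrow> (\<exists>y. K x y) \<longrightarrow> (\<exists>y. y \<epsilon> b \<and> K x y)"
proof -
  let ?C = "\<lambda>x. coll (\<lambda>y. K x y \<and> (\<forall>z. K x z \<longrightarrow> sim y z))"
  have C: "d \<epsilon> img ?C a \<longleftrightarrow> (\<exists>x. x \<epsilon> a \<and> d = ?C x)" for d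
    by (rule img_iff) (intro dfI dfn_P2[OF d])
  have "\<exists>y. y \<epsilon> uni (img ?C a) \<and> K x y" if "x \<epsilon> a" "K x z" for x z
  proof -
    have dx: "dfn (\<lambda>e. K x (e 0))" by (intro dfn_P2[OF d] dfI)
    from sim_minimal[OF this that(2)] obtain m where m: "K x m" "\<forall>z. K x z \<longrightarrow> sim m z" by blast
    have "isset (\<lambda>y. K x y \<and> (\<forall>z. K x z \<longrightarrow> sim y z))"
    proof (rule isset_sub[where a = "coll (\<lambda>y. sim y m)"])
      show "dfn (\<lambda>e. K x (e 0) \<and> (\<forall>z. K x z \<longrightarrow> sim (e 0) z))" by (intro dfI dfn_P2[OF d])
    qed (use m in \<open>simp add: coll_iff[OF sim_isset]\<close>)
    then have "m \<epsilon> ?C x" using m by (simp add: coll_iff)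
    then show ?thesis using m that(1) by (auto simp: C)
  qed
  then show ?thesis by blast
qed

section \<open>Countable sets\<close>

text \<open>Countability by a partial enumeration from \<omega> instead of an injection into
  \<omega>: closure under subsets and images is then immediate, and choosing least indices is left
  to the comparison with \<open>is_countable\<close>.\<close>

definition cnt where
  "cnt x \<longleftrightarrow> (\<exists>g. (\<forall>y. y \<epsilon> x \<longrightarrow> (\<exists>n. n \<epsilon> om \<and> pr n y \<epsilon> g)) \<and>
     (\<forall>n y y'. pr n y \<epsilon> g \<longrightarrow> pr n y' \<epsilon> g \<longrightarrow> y = y'))"

lemma dfn_cnt [dfI]: "tm s \<Longrightarrow> dfn (\<lambda>e. cnt (s e))"
  by (rule dfn_P1, unfold cnt_def, intro dfI)

lemma cnt_sub: "cnt y \<Longrightarrow> sub x y \<Longrightarrow> cnt x"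
  unfolding cnt_def sub_def by blast

lemma cntI:
  assumes d: "dfn (\<lambda>e. K (e 0) (e 1))"
    and "\<And>y. y \<epsilon> x \<Longrightarrow> \<exists>n. n \<epsilon> om \<and> K n y"
    and "\<And>n y y'. y \<epsilon> x \<Longrightarrow> y' \<epsilon> x \<Longrightarrow> K n y \<Longrightarrow> K n y' \<Longrightarrow> y = y'"
  shows "cnt x"
proof -
  let ?g = "sep (prd om x) (\<lambda>z. \<exists>n y. z = pr n y \<and> K n y)"
  have g: "z \<epsilon> ?g \<longleftrightarrow> z \<epsilon> prd om x \<and> (\<exists>n y. z = pr n y \<and> K n y)" for z
    by (rule sep_iff) (intro dfI dfn_P2[OF d])
  show ?thesis unfolding cnt_def
    by (rule exI[of _ ?g]) (use assms(2,3) in \<open>auto simp: g\<close>)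
qed

lemma is_countable_iff: "is_countable E x \<longleftrightarrow> cnt x"
proof
  assume "is_countable E x"
  then obtain f where f: "is_inj E f x om" by (auto simp: is_countable_def is_omega_iff)
  have 1: "\<exists>n. n \<epsilon> om \<and> pr y n \<epsilon> f" if "y \<epsilon> x" for y
    using f that unfolding is_inj_def is_func_def pair_in_iff by blast
  have 2: "y = y'" if "n \<epsilon> om" "y \<epsilon> x" "y' \<epsilon> x" "pr y n \<epsilon> f" "pr y' n \<epsilon> f" for n y y'
    using f that unfolding is_inj_def pair_in_iff by blast
  show "cnt x"
  proof (rule cntI[where K = "\<lambda>n y. n \<epsilon> om \<and> pr y n \<epsilon> f"])
    show "dfn (\<lambda>e. e 0 \<epsilon> om \<and> pr (e 1) (e 0) \<epsilon> f)" by (intro dfI)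
  qed (use 1 2 in auto)
next
  assume "cnt x"
  then obtain g where g: "\<And>y. y \<epsilon> x \<Longrightarrow> \<exists>n. n \<epsilon> om \<and> pr n y \<epsilon> g"
    "\<And>n y y'. pr n y \<epsilon> g \<Longrightarrow> pr n y' \<epsilon> g \<Longrightarrow> y = y'" unfolding cnt_def by blast
  let ?P = "\<lambda>y n. pr n y \<epsilon> g \<and> (\<forall>m. m \<epsilon> om \<longrightarrow> pr m y \<epsilon> g \<longrightarrow> n = m \<or> n \<epsilon> m)"
  let ?f = "sep (prd x om) (\<lambda>z. \<exists>y n. z = pr y n \<and> ?P y n)"
  have f: "z \<epsilon> ?f \<longleftrightarrow> z \<epsilon> prd x om \<and> (\<exists>y n. z = pr y n \<and> ?P y n)" for z
    by (rule sep_iff) (intro dfI)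
  have least: "\<exists>n. n \<epsilon> om \<and> ?P y n" if "y \<epsilon> x" for y
  proof -
    have "dfn (\<lambda>e. pr (e 0) y \<epsilon> g)" by (intro dfI)
    from om_least[OF this] g(1)[OF that] show ?thesis by blast
  qed
  have uniq: "n = m" if "n \<epsilon> om" "m \<epsilon> om" "?P y n" "?P y m" for y n m
    using that asym by blast
  have "\<exists>!n. n \<epsilon> om \<and> pr y n \<epsilon> ?f" if "y \<epsilon> x" for y
    using least[OF that] uniq that by (auto simp: f)
  then have "is_func E ?f x om"
    unfolding is_func_def is_rel_def is_opair_iff pair_in_iff by (auto simp: f prd_iff)
  then have "is_inj E ?f x om"
    unfolding is_inj_def pair_in_iff using g(2) by (auto simp: f)
  then show "is_countable E x" unfolding is_countable_def is_omega_iff by blast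
qed

lemma not_cnt_pow_om: "\<not> cnt (pow om)"
proof
  assume "cnt (pow om)"
  then obtain g where g: "\<And>y. y \<epsilon> pow om \<Longrightarrow> \<exists>n. n \<epsilon> om \<and> pr n y \<epsilon> g"
    "\<And>n y y'. pr n y \<epsilon> g \<Longrightarrow> pr n y' \<epsilon> g \<Longrightarrow> y = y'" unfolding cnt_def by blast
  \<comment> \<open>Cantor's diagonal set against the enumeration \<open>g\<close>.\<close>
  let ?d = "sep om (\<lambda>n. \<exists>y. pr n y \<epsilon> g \<and> \<not> n \<epsilon> y)"
  have d: "n \<epsilon> ?d \<longleftrightarrow> n \<epsilon> om \<and> (\<exists>y. pr n y \<epsilon> g \<and> \<not> n \<epsilon> y)" for n
    by (rule sep_iff) (intro dfI)
  have "sub ?d om" by (simp add: sub_def d)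
  then obtain n where "n \<epsilon> om" "pr n ?d \<epsilon> g" using g(1)[of ?d] by auto
  then show False using d[of n] g(2) by blast
qed

end

context zf_model
begin

lemma cnt_upr: "cnt (upr x x)"
proof (rule cntI[where K = "\<lambda>n y. n = zero \<and> y = x"])
  show "dfn (\<lambda>e. e 0 = zero \<and> e 1 = x)" by (intro dfI)
qed auto

lemma cnt_zero: "cnt zero"
  by (rule cnt_sub[OF cnt_upr]) (simp add: sub_def)

lemma cnt_img:
  assumes f: "tm (\<lambda>e. f (e 0))" and x: "cnt x"
  shows "cnt (img f x)"
proof -
  obtain g where g: "\<And>y. y \<epsilon> x \<Longrightarrow> \<exists>n. n \<epsilon> om \<and> pr n y \<epsilon> g"
    "\<And>n y y'. pr n y \<epsilon> g \<Longrightarrow> pr n y' \<epsilon> g \<Longrightarrow> y = y'" using x unfolding cnt_def by blast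
  show ?thesis
  proof (rule cntI[where K = "\<lambda>n y. \<exists>z. pr n z \<epsilon> g \<and> y = f z"])
    show "dfn (\<lambda>e. \<exists>z. pr (e 0) z \<epsilon> g \<and> e 1 = f z)" by (intro dfI tm_f1[OF f])
  next
    fix y assume "y \<epsilon> img f x"
    then show "\<exists>n. n \<epsilon> om \<and> (\<exists>z. pr n z \<epsilon> g \<and> y = f z)" using g(1) unfolding img_iff[OF f] by blast
  next
    fix n y y' assume "\<exists>z. pr n z \<epsilon> g \<and> y = f z" "\<exists>z. pr n z \<epsilon> g \<and> y' = f z"
    then show "y = y'" using g(2) by blast
  qed
qed

text \<open>
  The enumeration of \<open>\<omega> \<times> \<omega>\<close> by squares: after \<open>(0,k), \<dots>, (k,k)\<close> come \<open>(k,0), \<dots>, (k,k-1)\<close>, then \<open>(0,k+1)\<close>.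
\<close>

definition sqstep :: "'a \<Rightarrow> 'a" where
  "sqstep p = (if fs p \<epsilon> sn p then pr (sc (fs p)) (sn p)
     else if fs p = sn p then (if fs p = zero then pr zero (sc zero) else pr (fs p) zero)
     else if sc (sn p) \<epsilon> fs p then pr (fs p) (sc (sn p)) else pr zero (sc (fs p)))"

definition sqenum :: "'a \<Rightarrow> 'a" where
  "sqenum n = it sqstep (pr zero zero) n"

lemma tm_sqstep: "tm (\<lambda>e. sqstep (e 0))"
  unfolding sqstep_def by (intro dfI)

lemma tm_sqenum [dfI]: "tm s \<Longrightarrow> tm (\<lambda>e. sqenum (s e))"
  by (rule tm_f1, unfold sqenum_def, intro tm_it[OF tm_sqstep] dfI)

lemma sqenum_surj:
  assumes "m \<epsilon> om" "n \<epsilon> om"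
  shows "\<exists>k. k \<epsilon> om \<and> sqenum k = pr m n"
proof -
  define H where "H m n \<longleftrightarrow> (\<exists>k. k \<epsilon> om \<and> sqenum k = pr m n)" for m n
  have dH: "dfn (\<lambda>e. H (s e) (t e))" if "tm s" "tm t" for s t
    by (rule dfn_P2[OF _ that], unfold H_def, intro dfI)
  have step: "H (fs (sqstep (pr m n))) (sn (sqstep (pr m n)))" if "H m n" for m n
  proof -
    from that obtain k where k: "k \<epsilon> om" "sqenum k = pr m n" by (auto simp: H_def)
    have "sqenum (sc k) = sqstep (pr m n)"
      using it_sc[OF tm_sqstep k(1)] k(2) by (simp add: sqenum_def)
    then show ?thesis using k(1) unfolding H_def
      by (intro exI[of _ "sc k"]) (auto simp: sqstep_def)
  qed
  have s1: "H (sc m) n" if "H m n" "m \<epsilon> n" for m n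
    using step[OF that(1)] that(2) by (simp add: sqstep_def)
  have s2: "H m zero" if "H m m" "m \<noteq> zero" for m
    using step[OF that(1)] that(2) irrefl by (simp add: sqstep_def)
  have s3: "H m (sc n)" if "H m n" "sc n \<epsilon> m" "m \<epsilon> om" for m n
  proof -
    have "n \<epsilon> m" using that(2,3) om_elem_trans by (meson sc_iff)
    then show ?thesis using step[OF that(1)] that(2) irrefl asym by (auto simp: sqstep_def split: if_splits)
  qed
  have s4: "H zero (sc (sc n))" if "H (sc n) n" for n
  proof -
    have "\<not> sc n \<epsilon> n" using asym[of n "sc n"] by simp
    moreover have "sc n \<noteq> n" using irrefl sc_iff by metis
    ultimately show ?thesis using step[OF that] irrefl[of "sc n"] by (simp add: sqstep_def)
  qed
  have s5: "H zero (sc zero)" if "H zero zero"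
    using step[OF that] irrefl by (simp add: sqstep_def)
  have up: "H m k" if "H zero k" "m \<epsilon> k \<or> m = k" "k \<epsilon> om" for m k
  proof -
    have m: "m \<epsilon> om" using that(2,3) om_trans by blast
    have "m \<epsilon> k \<or> m = k \<longrightarrow> H m k"
    proof (rule om_induct[where Q = "\<lambda>m. m \<epsilon> k \<or> m = k \<longrightarrow> H m k", OF _ _ _ m])
      show "dfn (\<lambda>e. e 0 \<epsilon> k \<or> e 0 = k \<longrightarrow> H (e 0) k)" by (intro dfI dH)
      fix n assume n: "n \<epsilon> om" "n \<epsilon> k \<or> n = k \<longrightarrow> H n k"
      show "sc n \<epsilon> k \<or> sc n = k \<longrightarrow> H (sc n) k"
      proof
        assume "sc n \<epsilon> k \<or> sc n = k"
        then have "n \<epsilon> k" using om_elem_trans[OF that(3)] by (metis sc_iff)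
        then show "H (sc n) k" using n s1 by blast
      qed
    qed (use that(1) in simp)
    then show ?thesis using that(2) by blast
  qed
  have right: "H k n" if "H zero k" "n \<epsilon> k" "k \<epsilon> om" for n k
  proof -
    have n: "n \<epsilon> om" using that(2,3) om_trans by blast
    have "n \<epsilon> k \<longrightarrow> H k n"
    proof (rule om_induct[where Q = "\<lambda>n. n \<epsilon> k \<longrightarrow> H k n", OF _ _ _ n])
      show "dfn (\<lambda>e. e 0 \<epsilon> k \<longrightarrow> H k (e 0))" by (intro dfI dH)
      show "zero \<epsilon> k \<longrightarrow> H k zero" using up[OF that(1) _ that(3), of k] s2 by auto
      fix n assume n: "n \<epsilon> om" "n \<epsilon> k \<longrightarrow> H k n"
      show "sc n \<epsilon> k \<longrightarrow> H k (sc n)"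
      proof
        assume *: "sc n \<epsilon> k"
        then have "n \<epsilon> k" using om_elem_trans[OF that(3)] by (metis sc_iff)
        then show "H k (sc n)" using n s3 * that(3) by blast
      qed
    qed
    then show ?thesis using that(2) by blast
  qed
  have H0: "H zero zero" unfolding H_def sqenum_def by (intro exI[of _ zero]) simp
  \<comment> \<open>The pair \<open>(0,k+1)\<close> is reached only after the block of
    \<open>k\<close> has been walked to its end \<open>(k,k-1)\<close>. For \<open>k = 0\<close> the
    block is the single pair \<open>(0,0)\<close>, hence the case distinction.\<close>
  have left: "H zero k" if "k \<epsilon> om" for k
  proof (rule om_induct[where Q = "H zero", OF _ H0 _ that])
    show "dfn (\<lambda>e. H zero (e 0))" by (intro dfI dH)
    fix k assume k: "k \<epsilon> om" "H zero k"
    show "H zero (sc k)"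
      using om_cases[OF k(1)]
    proof
      assume "k = zero"
      then show ?thesis using s5 k by simp
    next
      assume "\<exists>m. m \<epsilon> om \<and> k = sc m"
      then obtain m where m: "m \<epsilon> om" "k = sc m" by blast
      then have "H k m" using right k by simp
      then show ?thesis using s4 m by simp
    qed
  qed
  have "m \<epsilon> n \<or> m = n \<or> n \<epsilon> m" using om_linear assms by blast
  then have "H m n" using up right left assms by metis
  then show ?thesis by (simp add: H_def)
qed

end

locale zfc_model = zf_model +
  assumes AC: "sat E e AC"
begin

text \<open>Collection first bounds the witnesses by a set \<open>b\<close>. The choice function, a
  set of pairs, is then turned into a definable HOL function, the form in which \<open>it\<close>
  and \<open>img\<close> accept it.\<close>

lemma choice:
  assumes d: "dfn (\<lambda>e. R (e 0) (e 1))" and ex: "\<And>x. x \<epsilon> a \<Longrightarrow> \<exists>y. R x y"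
  shows "\<exists>h. tm (\<lambda>e. h (e 0)) \<and> (\<forall>x. x \<epsilon> a \<longrightarrow> R x (h x))"
proof -
  obtain b where b: "\<And>x. x \<epsilon> a \<Longrightarrow> \<exists>y. y \<epsilon> b \<and> R x y"
    using collection[OF d, of a] ex by metis
  define B where "B x = sep (prd (upr x x) b) (\<lambda>z. \<exists>y. z = pr x y \<and> R x y)" for x
  have B: "z \<epsilon> B x \<longleftrightarrow> z \<epsilon> prd (upr x x) b \<and> (\<exists>y. z = pr x y \<and> R x y)" for x z
    unfolding B_def by (rule sep_iff) (intro dfI dfn_P2[OF d])
  have tmB: "tm (\<lambda>e. B (e 0))"
    unfolding B_def by (intro dfI dfn_P2[OF d])
  define F where "F = img B a"
  have F: "X \<epsilon> F \<longleftrightarrow> (\<exists>x. x \<epsilon> a \<and> X = B x)" for X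
    unfolding F_def by (rule img_iff[OF tmB])
  have ne: "\<forall>X. X \<epsilon> F \<longrightarrow> (\<exists>y. y \<epsilon> X)"
  proof (intro allI impI)
    fix X assume "X \<epsilon> F"
    then obtain x where x: "x \<epsilon> a" "X = B x" unfolding F by blast
    from b[OF x(1)] obtain y where "y \<epsilon> b" "R x y" by blast
    then have "pr x y \<epsilon> X" unfolding x B by simp
    then show "\<exists>y. y \<epsilon> X" ..
  qed
  have "(\<forall>X. X \<epsilon> F \<longrightarrow> (\<exists>y. y \<epsilon> X)) \<longrightarrow>
      (\<exists>f U. is_func E f F U \<and> (\<forall>X. X \<epsilon> F \<longrightarrow> (\<forall>y. y \<epsilon> U \<longrightarrow> pr X y \<epsilon> f \<longrightarrow> y \<epsilon> X)))"
    using AC[unfolded sat_AC pair_in_iff] by (elim allE)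
  with ne obtain f U where f: "is_func E f F U" "\<And>X y. X \<epsilon> F \<Longrightarrow> y \<epsilon> U \<Longrightarrow> pr X y \<epsilon> f \<Longrightarrow> y \<epsilon> X"
    by blast
  have fn: "\<exists>w. w \<epsilon> U \<and> pr X w \<epsilon> f \<and> (\<forall>w'. w' \<epsilon> U \<longrightarrow> pr X w' \<epsilon> f \<longrightarrow> w' = w)" if "X \<epsilon> F" for X
    using f(1) that unfolding is_func_def pair_in_iff Ex1_def by blast
  have U: "w' \<epsilon> U" if "pr X w' \<epsilon> f" for X w'
  proof -
    from f(1) that have "\<exists>x. x \<epsilon> F \<and> (\<exists>y. y \<epsilon> U \<and> pr X w' = pr x y)"
      unfolding is_func_def is_rel_def is_opair_iff by blast
    then show ?thesis by auto
  qed
  let ?h = "\<lambda>x. coll (\<lambda>z. \<exists>y. pr (B x) (pr x y) \<epsilon> f \<and> z \<epsilon> y)"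
  have "R x (?h x)" if "x \<epsilon> a" for x
  proof -
    have X: "B x \<epsilon> F" using that F by blast
    from fn[OF this] obtain w where w: "w \<epsilon> U" "pr (B x) w \<epsilon> f"
      and uniq: "\<And>w'. w' \<epsilon> U \<Longrightarrow> pr (B x) w' \<epsilon> f \<Longrightarrow> w' = w" by blast
    have "w \<epsilon> B x" using f(2) X w by blast
    then obtain y where y: "w = pr x y" "R x y" unfolding B by blast
    have "y' = y" if "pr (B x) (pr x y') \<epsilon> f" for y'
      using uniq[OF U[OF that] that] y(1) by simp
    then have "?h x = y"
      by (intro coll_eq) (use w y in blast)
    then show ?thesis using y by simp
  qed
  moreover have "tm (\<lambda>e. ?h (e 0))" by (intro dfI tm_f1[OF tmB])
  ultimately show ?thesis by (intro exI[of _ ?h]) simp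
qed

lemma dependent_choice:
  assumes d: "dfn (\<lambda>e. R (e 0) (e 1))" and w: "w \<epsilon> W"
    and ex: "\<And>x. x \<epsilon> W \<Longrightarrow> \<exists>y. y \<epsilon> W \<and> R x y"
  shows "\<exists>s. tm (\<lambda>e. s (e 0)) \<and> s zero = w \<and> (\<forall>n. n \<epsilon> om \<longrightarrow> s n \<epsilon> W \<and> R (s n) (s (sc n)))"
proof -
  have "dfn (\<lambda>e. e 1 \<epsilon> W \<and> R (e 0) (e 1))" by (intro dfI d)
  from choice[OF this, of W] ex obtain h
    where h: "tm (\<lambda>e. h (e 0))" "\<And>x. x \<epsilon> W \<Longrightarrow> h x \<epsilon> W \<and> R x (h x)"
    by auto
  let ?s = "it h w"
  have s: "tm (\<lambda>e. ?s (t e))" if "tm t" for t by (intro tm_it[OF h(1)] dfI that)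
  have W: "?s n \<epsilon> W" if "n \<epsilon> om" for n
  proof (rule om_induct[where Q = "\<lambda>n. ?s n \<epsilon> W", OF _ _ _ that])
    show "dfn (\<lambda>e. ?s (e 0) \<epsilon> W)" by (intro dfI s)
  qed (use w h(2) it_sc[OF h(1)] in auto)
  show ?thesis
    by (rule exI[of _ ?s]) (use W h(2) it_sc[OF h(1)] s[OF tm_var] in auto)
qed

text \<open>Choice fixes enumerations of all the \<open>F n\<close> simultaneously; without it a
  countable union of countable sets need not be countable. Later it keeps both domains of conditions
  and supports countable.\<close>

lemma cnt_UN:
  assumes F: "tm (\<lambda>e. F (e 0))" and c: "\<And>n. n \<epsilon> om \<Longrightarrow> cnt (F n)"
  shows "cnt (uni (img F om))"
proof -
  let ?R = "\<lambda>n g. (\<forall>y. y \<epsilon> F n \<longrightarrow> (\<exists>n. n \<epsilon> om \<and> pr n y \<epsilon> g)) \<and>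
     (\<forall>n y y'. pr n y \<epsilon> g \<longrightarrow> pr n y' \<epsilon> g \<longrightarrow> y = y')"
  have "dfn (\<lambda>e. ?R (e 0) (e 1))" by (intro dfI tm_f1[OF F])
  moreover have "\<exists>g. ?R n g" if "n \<epsilon> om" for n using c[OF that] by (simp only: cnt_def)
  ultimately have "\<exists>h. tm (\<lambda>e. h (e 0)) \<and> (\<forall>n. n \<epsilon> om \<longrightarrow> ?R n (h n))" by (rule choice)
  then obtain h where h: "tm (\<lambda>e. h (e 0))" "\<And>n. n \<epsilon> om \<Longrightarrow> ?R n (h n)" by blast
  show ?thesis
  proof (rule cntI[where K = "\<lambda>k y. \<exists>m n. m \<epsilon> om \<and> sqenum k = pr m n \<and> pr n y \<epsilon> h m"])
    show "dfn (\<lambda>e. \<exists>m n. m \<epsilon> om \<and> sqenum (e 0) = pr m n \<and> pr n (e 1) \<epsilon> h m)"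
      by (intro dfI tm_f1[OF h(1)])
  next
    fix y assume "y \<epsilon> uni (img F om)"
    then obtain m where m: "m \<epsilon> om" "y \<epsilon> F m" by (auto simp: img_iff[OF F])
    then obtain n where n: "n \<epsilon> om" "pr n y \<epsilon> h m" using h(2) by blast
    then show "\<exists>k. k \<epsilon> om \<and> (\<exists>m n. m \<epsilon> om \<and> sqenum k = pr m n \<and> pr n y \<epsilon> h m)"
      using sqenum_surj[OF m(1) n(1)] m by blast
  next
    fix k y y'
    assume "\<exists>m n. m \<epsilon> om \<and> sqenum k = pr m n \<and> pr n y \<epsilon> h m"
      "\<exists>m n. m \<epsilon> om \<and> sqenum k = pr m n \<and> pr n y' \<epsilon> h m"
    then show "y = y'" using h(2) by (metis pr_eq)
  qed
qed

lemma cnt_cup: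
  assumes "cnt x" "cnt y"
  shows "cnt (cup x y)"
proof -
  let ?F = "\<lambda>n. if n = zero then x else y"
  have F: "tm (\<lambda>e. ?F (e 0))" by (intro dfI)
  have "cnt (uni (img ?F om))" by (rule cnt_UN[OF F]) (use assms in simp)
  moreover have "sub (cup x y) (uni (img ?F om))"
    unfolding sub_def uni_iff img_iff[OF F]
    by (metis cup_iff zero_om sc_om sc_not_zero(1))
  ultimately show ?thesis by (rule cnt_sub)
qed

end

section \<open>Forcing\<close>

text \<open>
  \<open>T u v p\<close> says that \<open>v\<close> is put into the name \<open>u\<close> with the condition \<open>p\<close>. Every element of the
  model is a name. Since the poset and the names live in an arbitrary, possibly ill-founded, model,
  forced equality is defined by bisimulations, which needs no recursion inside the model.
\<close>

locale forcing = zf_model E for E :: "'a::countable \<Rightarrow> 'a \<Rightarrow> bool" (infix "\<epsilon>" 50) +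
  fixes PP :: 'a and le :: "'a \<Rightarrow> 'a \<Rightarrow> bool" and T :: "'a \<Rightarrow> 'a \<Rightarrow> 'a \<Rightarrow> bool"
  assumes dfn_le: "dfn (\<lambda>e. le (e 0) (e 1))"
    and dfn_T: "dfn (\<lambda>e. T (e 0) (e 1) (e 2))"
    and le_PP: "le q p \<Longrightarrow> q \<epsilon> PP \<and> p \<epsilon> PP"
    and le_refl: "p \<epsilon> PP \<Longrightarrow> le p p"
    and le_trans: "le p q \<Longrightarrow> le q r \<Longrightarrow> le p r"
    and PP_nonempty: "\<exists>p. p \<epsilon> PP"
    and T_PP: "T u v p \<Longrightarrow> p \<epsilon> PP"
    and T_set: "\<exists>W. u \<epsilon> W \<and> (\<forall>u v p. u \<epsilon> W \<longrightarrow> T u v p \<longrightarrow> v \<epsilon> W)"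
begin

lemma dfn_le' [dfI]: "tm s \<Longrightarrow> tm t \<Longrightarrow> dfn (\<lambda>e. le (s e) (t e))"
  by (rule dfn_P2[OF dfn_le])
lemma dfn_T' [dfI]: "tm s \<Longrightarrow> tm t \<Longrightarrow> tm u \<Longrightarrow> dfn (\<lambda>e. T (s e) (t e) (u e))"
  by (rule dfn_P3[OF dfn_T])

section \<open>Forced equality\<close>

definition hits :: "('a \<Rightarrow> 'a \<Rightarrow> 'a \<Rightarrow> bool) \<Rightarrow> 'a \<Rightarrow> 'a \<Rightarrow> 'a \<Rightarrow> bool" where
  "hits K r a v \<longleftrightarrow> (\<exists>b s. T v b s \<and> le r s \<and> K r a b)"

definition half :: "('a \<Rightarrow> 'a \<Rightarrow> 'a \<Rightarrow> bool) \<Rightarrow> 'a \<Rightarrow> 'a \<Rightarrow> 'a \<Rightarrow> bool" where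
  "half K p u v \<longleftrightarrow> (\<forall>a s r. T u a s \<longrightarrow> le r p \<longrightarrow> le r s \<longrightarrow> (\<exists>r'. le r' r \<and> hits K r' a v))"

text \<open>Forced equality is the greatest fixed point of this operator, each half being the
  density form of an inclusion. The second half swaps the arguments of \<open>K\<close>, so that the
  first name given to \<open>K\<close> always comes from the side of \<open>u\<close>.\<close>

definition step :: "('a \<Rightarrow> 'a \<Rightarrow> 'a \<Rightarrow> bool) \<Rightarrow> 'a \<Rightarrow> 'a \<Rightarrow> 'a \<Rightarrow> bool" where
  "step K p u v \<longleftrightarrow> half K p u v \<and> half (\<lambda>r a b. K r b a) p v u"

text \<open>The union of all bisimulations that are sets of the model; quantifying over sets only
  keeps the relation first-order definable.\<close>

definition Eq :: "'a \<Rightarrow> 'a \<Rightarrow> 'a \<Rightarrow> bool" where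
  "Eq p u v \<longleftrightarrow> p \<epsilon> PP \<and> (\<exists>R. pr p (pr u v) \<epsilon> R \<and>
     (\<forall>p u v. pr p (pr u v) \<epsilon> R \<longrightarrow> step (\<lambda>p u v. pr p (pr u v) \<epsilon> R) p u v))"

lemma dfn_Eq [dfI]: "tm s \<Longrightarrow> tm t \<Longrightarrow> tm u \<Longrightarrow> dfn (\<lambda>e. Eq (s e) (t e) (u e))"
  by (rule dfn_P3[where P = Eq], unfold Eq_def step_def half_def hits_def, intro dfI)

lemma step_mono:
  assumes "\<And>r a b. K r a b \<Longrightarrow> K' r a b" "step K p u v" shows "step K' p u v"
  using assms unfolding step_def half_def hits_def by meson

lemma Eq_PP: "Eq p u v \<Longrightarrow> p \<epsilon> PP" by (simp add: Eq_def)

lemma Eq_step: "Eq p u v \<Longrightarrow> step Eq p u v"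
proof -
  assume "Eq p u v"
  then obtain R where R: "pr p (pr u v) \<epsilon> R"
    "\<And>p u v. pr p (pr u v) \<epsilon> R \<Longrightarrow> step (\<lambda>p u v. pr p (pr u v) \<epsilon> R) p u v" by (auto simp: Eq_def)
  from R(2)[OF R(1)] have "step (\<lambda>p u v. p \<epsilon> PP \<and> pr p (pr u v) \<epsilon> R) p u v"
    unfolding step_def half_def hits_def using le_PP by meson
  then show ?thesis
    by (rule step_mono[rotated]) (use R(2) in \<open>auto simp: Eq_def\<close>)
qed

text \<open>A definable class suffices as bisimulation: it is cut down to
  \<open>prd PP (prd W V)\<close>, where \<open>W\<close> and \<open>V\<close> are sets of names
  closed under passing to entries.\<close>

lemma Eq_coinduct:
  assumes d: "dfn (\<lambda>e. K (e 0) (e 1) (e 2))" and K: "K p u v" "p \<epsilon> PP"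
    and st: "\<And>p u v. K p u v \<Longrightarrow> step K p u v"
  shows "Eq p u v"
proof -
  obtain W V where W: "u \<epsilon> W" "\<And>u v p. u \<epsilon> W \<Longrightarrow> T u v p \<Longrightarrow> v \<epsilon> W"
    and V: "v \<epsilon> V" "\<And>u v p. u \<epsilon> V \<Longrightarrow> T u v p \<Longrightarrow> v \<epsilon> V"
    using T_set by metis
  let ?R = "sep (prd PP (prd W V)) (\<lambda>z. \<exists>p u v. z = pr p (pr u v) \<and> K p u v)"
  have R: "z \<epsilon> ?R \<longleftrightarrow> z \<epsilon> prd PP (prd W V) \<and> (\<exists>p u v. z = pr p (pr u v) \<and> K p u v)" for z
    by (rule sep_iff) (intro dfI dfn_P3[OF d])
  have R': "pr p (pr u v) \<epsilon> ?R \<longleftrightarrow> p \<epsilon> PP \<and> u \<epsilon> W \<and> v \<epsilon> V \<and> K p u v" for p u v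
    by (auto simp: R)
  have "step (\<lambda>p u v. pr p (pr u v) \<epsilon> ?R) p u v" if "u \<epsilon> W" "v \<epsilon> V" "K p u v" for p u v
    using st[OF that(3)] that(1,2) W(2) V(2) unfolding step_def half_def hits_def R' by (metis le_PP)
  then show ?thesis unfolding Eq_def using K W(1) V(1)
    by (intro conjI exI[of _ ?R]) (simp_all add: R')
qed

lemma Eq_refl: "p \<epsilon> PP \<Longrightarrow> Eq p u u"
proof (rule Eq_coinduct[where K = "\<lambda>p u v. u = v"])
  show "dfn (\<lambda>e. e 1 = e 2)" by (intro dfI)
  show "step (\<lambda>p u v. u = v) p u v" if "u = v" for p u v
    using that le_refl le_PP unfolding step_def half_def hits_def by metis
qed simp_all

lemma Eq_sym: "Eq p u v \<Longrightarrow> Eq p v u"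
proof (rule Eq_coinduct[where K = "\<lambda>p u v. Eq p v u"])
  show "dfn (\<lambda>e. Eq (e 0) (e 2) (e 1))" by (intro dfI)
  show "step (\<lambda>p u v. Eq p v u) p u v" if "Eq p v u" for p u v
    using Eq_step[OF that] unfolding step_def by blast
qed (simp_all add: Eq_PP)

lemma Eq_mono: assumes "Eq p u v" "le q p" shows "Eq q u v"
proof (rule Eq_coinduct[where K = "\<lambda>q u v. \<exists>p. le q p \<and> Eq p u v"])
  show "dfn (\<lambda>e. \<exists>p. le (e 0) p \<and> Eq p (e 1) (e 2))" by (intro dfI)
  show "step (\<lambda>q u v. \<exists>p. le q p \<and> Eq p u v) q u v" if "\<exists>p. le q p \<and> Eq p u v" for q u v
  proof -
    from that obtain p where p: "le q p" "Eq p u v" by blast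
    have "step Eq q u v" using Eq_step[OF p(2)] p(1) le_trans unfolding step_def half_def by blast
    then show ?thesis by (rule step_mono[rotated]) (use le_refl Eq_PP in blast)
  qed
qed (use assms le_PP in blast)+

lemma half_trans:
  assumes uv: "half K p u v" and vw: "half L p v w"
    and mono: "\<And>p q u v. K p u v \<Longrightarrow> le q p \<Longrightarrow> K q u v"
  shows "half (\<lambda>p a c. \<exists>b. K p a b \<and> L p b c) p u w"
  unfolding half_def
proof (intro allI impI)
  fix a s r assume *: "T u a s" "le r p" "le r s"
  with uv obtain r1 b s1 where 1: "le r1 r" "T v b s1" "le r1 s1" "K r1 a b" unfolding half_def hits_def by meson
  with vw *(2) obtain r2 c s2 where 2: "le r2 r1" "T w c s2" "le r2 s2" "L r2 b c"
    unfolding half_def hits_def by (meson le_trans)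
  then have "K r2 a b" "le r2 r" using 1 mono le_trans by blast+
  with 2 show "\<exists>r'. le r' r \<and> hits (\<lambda>p a c. \<exists>b. K p a b \<and> L p b c) r' a w"
    unfolding hits_def by blast
qed

lemma Eq_trans: assumes "Eq p u v" "Eq p v w" shows "Eq p u w"
proof (rule Eq_coinduct[where K = "\<lambda>p u w. \<exists>v. Eq p u v \<and> Eq p v w"])
  show "dfn (\<lambda>e. \<exists>v. Eq (e 0) (e 1) v \<and> Eq (e 0) v (e 2))" by (intro dfI)
  fix p u w assume "\<exists>v. Eq p u v \<and> Eq p v w"
  then obtain v where v: "Eq p u v" "Eq p v w" by blast
  have "half (\<lambda>p a c. \<exists>b. Eq p a b \<and> Eq p b c) p u w"
    by (rule half_trans[of _ _ _ v]) (use Eq_step[OF v(1)] Eq_step[OF v(2)] Eq_mono in \<open>auto simp: step_def\<close>)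
  moreover have "half (\<lambda>p a c. \<exists>b. Eq p b a \<and> Eq p c b) p w u"
    by (rule half_trans[of "\<lambda>p a b. Eq p b a" _ _ v "\<lambda>p b c. Eq p c b"])
      (use Eq_step[OF v(1)] Eq_step[OF v(2)] Eq_mono in \<open>auto simp: step_def\<close>)
  ultimately show "step (\<lambda>p u w. \<exists>v. Eq p u v \<and> Eq p v w) p u w"
    unfolding step_def by (simp add: conj_commute)
qed (use assms Eq_PP in blast)+

lemma Eq_iff: "Eq p u v \<longleftrightarrow> p \<epsilon> PP \<and> step Eq p u v"
proof
  assume *: "p \<epsilon> PP \<and> step Eq p u v"
  show "Eq p u v"
  proof (rule Eq_coinduct[where K = "step Eq"])
    show "dfn (\<lambda>e. step Eq (e 0) (e 1) (e 2))" unfolding step_def half_def hits_def by (intro dfI)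
    show "step (step Eq) p u v" if "step Eq p u v" for p u v
      using that by (rule step_mono[rotated]) (rule Eq_step)
  qed (use * in simp_all)
qed (use Eq_PP Eq_step in blast)

lemma Eq_stable:
  assumes "p \<epsilon> PP" "\<And>q. le q p \<Longrightarrow> \<exists>r. le r q \<and> Eq r u v"
  shows "Eq p u v"
proof -
  have "half L p u v" if *: "\<And>q. le q p \<Longrightarrow> \<exists>r. le r q \<and> half L r u v" for L u v
    unfolding half_def
  proof (intro allI impI)
    fix a s r assume a: "T u a s" "le r p" "le r s"
    from *[OF a(2)] obtain r1 where r1: "le r1 r" "half L r1 u v" by blast
    moreover have "le r1 r1" "le r1 s" using r1 a le_refl le_PP le_trans by blast+
    ultimately obtain r2 where "le r2 r1" "hits L r2 a v" using a unfolding half_def by blast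
    then show "\<exists>r'. le r' r \<and> hits L r' a v" using r1 le_trans by blast
  qed
  note half = this
  have "half Eq p u v" by (rule half) (use assms(2) Eq_step step_def in blast)
  moreover have "half (\<lambda>r a b. Eq r b a) p v u" by (rule half) (use assms(2) Eq_step step_def in blast)
  ultimately have "step Eq p u v" by (simp add: step_def)
  with assms(1) show ?thesis using Eq_iff by blast
qed

lemma Eq_same:
  assumes "\<And>a s. T u a s \<longleftrightarrow> T v a s" "p \<epsilon> PP"
  shows "Eq p u v"
proof -
  have "step Eq p u v" unfolding step_def half_def hits_def using assms le_refl le_PP Eq_refl by metis
  with assms(2) show ?thesis using Eq_iff by blast
qed

section \<open>The forcing relation\<close>

definition fmem where
  "fmem p x y \<longleftrightarrow> p \<epsilon> PP \<and> (\<forall>q. le q p \<longrightarrow> (\<exists>r. le r q \<and> hits Eq r x y))"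

lemma dfn_fmem [dfI]: "tm s \<Longrightarrow> tm t \<Longrightarrow> tm u \<Longrightarrow> dfn (\<lambda>e. fmem (s e) (t e) (u e))"
  by (rule dfn_P3[where P = fmem], unfold fmem_def hits_def, intro dfI)

text \<open>Implication and the universal quantifier are read as in Kripke models. Since the atomic
  clauses hold as soon as they hold densely, all formulas do (\<open>frc_stable\<close>), and the
  relation obeys classical logic.\<close>

primrec frc :: "'a \<Rightarrow> (nat \<Rightarrow> 'a) \<Rightarrow> fm \<Rightarrow> bool" where
  "frc p e (i \<^bold>\<in> j) = fmem p (e i) (e j)"
| "frc p e (i \<^bold>= j) = Eq p (e i) (e j)"
| "frc p e \<^bold>\<bottom> = False"
| "frc p e (\<phi> \<^bold>\<longrightarrow> \<psi>) = (\<forall>q. le q p \<longrightarrow> frc q e \<phi> \<longrightarrow> frc q e \<psi>)"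
| "frc p e (\<^bold>\<forall>\<phi>) = (\<forall>a. frc p (a ## e) \<phi>)"

lemma frc_mono: "frc p e \<phi> \<Longrightarrow> le q p \<Longrightarrow> frc q e \<phi>"
proof (induction \<phi> arbitrary: e)
  case (Mem i j)
  then show ?case using le_trans le_PP by (auto simp: fmem_def)
next
  case (Imp \<phi> \<psi>)
  then show ?case using le_trans by (metis frc.simps(4))
qed (auto intro: Eq_mono)

lemma frc_stable:
  assumes "p \<epsilon> PP" "\<And>q. le q p \<Longrightarrow> \<exists>r. le r q \<and> frc r e \<phi>"
  shows "frc p e \<phi>"
  using assms
proof (induction \<phi> arbitrary: e p)
  case (Mem i j)
  have "\<exists>r. le r q \<and> hits Eq r (e i) (e j)" if q: "le q p" for q
  proof -
    obtain r where r: "le r q" "fmem r (e i) (e j)" using Mem(2)[OF q] by auto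
    moreover have "le r r" using r le_refl le_PP by blast
    ultimately show ?thesis unfolding fmem_def using le_trans by blast
  qed
  then show ?case using Mem(1) by (simp add: fmem_def)
next
  case (Eq i j)
  then show ?case using Eq_stable by simp
next
  case Fls
  then show ?case using le_refl by auto
next
  case (Imp \<phi> \<psi>)
  have "frc q e \<psi>" if q: "le q p" "frc q e \<phi>" for q
  proof (rule Imp.IH(2))
    show "q \<epsilon> PP" using q le_PP by blast
    fix q' assume q': "le q' q"
    from Imp.prems(2)[OF le_trans[OF q' q(1)]]
    obtain r where r: "le r q'" "frc r e (\<phi> \<^bold>\<longrightarrow> \<psi>)" by blast
    have "le r r" using r(1) le_PP le_refl by blast
    moreover have "frc r e \<phi>" using frc_mono[OF q(2)] le_trans[OF r(1) q'] by blast
    ultimately show "\<exists>r. le r q' \<and> frc r e \<psi>" using r by auto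
  qed
  then show ?case by simp
next
  case (Forall \<phi>)
  show ?case unfolding frc.simps
  proof
    fix a
    show "frc p (a ## e) \<phi>"
      by (rule Forall.IH) (use Forall.prems in force)+
  qed
qed

text \<open>The definability theorem, one formula at a time: the recursion on formulas takes place
  outside the model.\<close>

lemma dfn_frc: "dfn (\<lambda>e. frc (e 0) (\<lambda>n. e (Suc n)) \<phi>)"
proof (induction \<phi>)
  case (Mem i j)
  show ?case unfolding frc.simps by (intro dfI)
next
  case (Eq i j)
  show ?case unfolding frc.simps by (intro dfI)
next
  case Fls
  show ?case unfolding frc.simps by (intro dfI)
next
  case (Imp \<phi> \<psi>)
  have "dfn (\<lambda>e. frc (e 0) (\<lambda>n. e (Suc (Suc n))) \<phi>)" "dfn (\<lambda>e. frc (e 0) (\<lambda>n. e (Suc (Suc n))) \<psi>)"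
    using Imp.IH[THEN dfn_ren, of "0 ## (\<lambda>n. Suc (Suc n))"] by simp_all
  then show ?case unfolding frc.simps by (intro dfI)
next
  case (Forall \<phi>)
  \<comment> \<open>Quantification puts the bound value at position 0, where the induction
    hypothesis has the condition; hence the exchange of positions 0 and 1.\<close>
  let ?r = "\<lambda>n. if n = 0 then 1 else if n = 1 then 0 else n"
  have "(\<lambda>n. e (?r (Suc n))) = (e 0 ## (\<lambda>n. e (Suc (Suc n))))" for e :: "nat \<Rightarrow> 'a"
    by (auto split: nat.split)
  with Forall.IH[THEN dfn_ren, of ?r]
  have "dfn (\<lambda>e. frc (e 1) (e 0 ## (\<lambda>n. e (Suc (Suc n)))) \<phi>)" by simp
  then show ?case unfolding frc.simps by (intro dfI) simp
qed

lemma dfn_frc0 [dfI]: "tm s \<Longrightarrow> dfn (\<lambda>e. frc (s e) e0 \<phi>)"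
proof (rule dfn_P1)
  show "dfn (\<lambda>e. frc (e 0) e0 \<phi>)"
    using dfn_reindex[OF dfn_frc[of \<phi>], of "Inl 0 ## (\<lambda>n. Inr (e0 n))"] by simp
qed

lemma dfn_frc1 [dfI]: "tm s \<Longrightarrow> tm t \<Longrightarrow> dfn (\<lambda>e. frc (s e) (t e ## e0) \<phi>)"
proof (rule dfn_P2[where P = "\<lambda>p x. frc p (x ## e0) \<phi>"])
  let ?r = "Inl 0 ## Inl 1 ## (\<lambda>n. Inr (e0 n))"
  have *: "(\<lambda>n. case_sum e id (?r (Suc n))) = (e 1 ## e0)" for e
    by (auto split: nat.split)
  have "dfn (\<lambda>e. frc (e 0) (\<lambda>n. case_sum e id (?r (Suc n))) \<phi>)"
    using dfn_reindex[OF dfn_frc[of \<phi>], of ?r] by simp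
  then show "dfn (\<lambda>e. frc (e 0) (e 1 ## e0) \<phi>)" unfolding * .
qed

lemma dfn_frc2 [dfI]: "tm s \<Longrightarrow> tm t \<Longrightarrow> tm u \<Longrightarrow> dfn (\<lambda>e. frc (s e) (t e ## u e ## e0) \<phi>)"
proof (rule dfn_P3[where P = "\<lambda>p x y. frc p (x ## y ## e0) \<phi>"])
  let ?r = "Inl 0 ## Inl 1 ## Inl (2::nat) ## (\<lambda>n. Inr (e0 n))"
  have *: "(\<lambda>n. case_sum e id (?r (Suc n))) = (e 1 ## e 2 ## e0)" for e
    by (auto split: nat.split)
  have "dfn (\<lambda>e. frc (e 0) (\<lambda>n. case_sum e id (?r (Suc n))) \<phi>)"
    using dfn_reindex[OF dfn_frc[of \<phi>], of ?r] by simp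
  then show "dfn (\<lambda>e. frc (e 0) (e 1 ## e 2 ## e0) \<phi>)" unfolding * .
qed

lemma hits_cong: "Eq r x x' \<Longrightarrow> hits Eq r x y \<Longrightarrow> hits Eq r x' y"
  unfolding hits_def using Eq_sym Eq_trans by blast

lemma fmem_cong:
  assumes "fmem p x y" "Eq p x x'" "Eq p y y'"
  shows "fmem p x' y'"
  unfolding fmem_def
proof (intro conjI allI impI)
  show "p \<epsilon> PP" using assms(2) Eq_PP by blast
  fix q assume q: "le q p"
  then obtain r b s where r: "le r q" "T y b s" "le r s" "Eq r x b"
    using assms(1) by (auto simp: fmem_def hits_def)
  have "half Eq p y y'" using assms(3) Eq_step by (auto simp: step_def)
  then obtain r' where r': "le r' r" "hits Eq r' b y'" using r q le_trans unfolding half_def by meson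
  moreover have "Eq r' x' b" using r' r q assms(2) Eq_mono Eq_sym Eq_trans le_trans by meson
  ultimately show "\<exists>r. le r q \<and> hits Eq r x' y'" using r le_trans hits_cong Eq_sym by meson
qed

lemma frc_cong: "frc p e \<phi> \<Longrightarrow> (\<And>i. Eq p (e i) (e' i)) \<Longrightarrow> frc p e' \<phi>"
proof (induction \<phi> arbitrary: p e e')
  case (Mem i j)
  then show ?case using fmem_cong by simp
next
  case (Eq i j)
  then show ?case using Eq_trans Eq_sym by (metis frc.simps(2))
next
  case (Imp \<phi> \<psi>)
  show ?case unfolding frc.simps
  proof (intro allI impI)
    fix q assume q: "le q p" "frc q e' \<phi>"
    have eq: "Eq q (e i) (e' i)" for i using Imp.prems(2) q(1) Eq_mono by blast
    have "frc q e \<phi>" by (rule Imp.IH(1)[OF q(2)]) (rule Eq_sym[OF eq])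
    then have "frc q e \<psi>" using Imp.prems(1) q(1) by simp
    then show "frc q e' \<psi>" by (rule Imp.IH(2)) (rule eq)
  qed
next
  case (Forall \<phi>)
  show ?case unfolding frc.simps
  proof
    fix a
    have "p \<epsilon> PP" using Forall.prems(2) Eq_PP by blast
    then have "Eq p ((a ## e) i) ((a ## e') i)" for i
      using Forall.prems(2) by (cases i) (simp_all add: Eq_refl)
    moreover have "frc p (a ## e) \<phi>" using Forall.prems(1) by simp
    ultimately show "frc p (a ## e') \<phi>" using Forall.IH by blast
  qed
qed simp

section \<open>Generic filters\<close>

definition generic :: "'a set \<Rightarrow> bool" where
  "generic G \<longleftrightarrow> G \<noteq> {} \<and> (\<forall>p\<in>G. p \<epsilon> PP) \<and> (\<forall>p q. p \<in> G \<longrightarrow> le p q \<longrightarrow> q \<in> G) \<and>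
     (\<forall>p\<in>G. \<forall>q\<in>G. \<exists>r\<in>G. le r p \<and> le r q) \<and>
     (\<forall>d. (\<forall>p. p \<epsilon> PP \<longrightarrow> (\<exists>q. q \<epsilon> d \<and> le q p)) \<longrightarrow> (\<exists>q\<in>G. q \<epsilon> d))"

text \<open>The carrier is countable, so \<open>from_nat\<close> lists every element of the model
  and a descending sequence can enter each dense set in turn; the filter is its upward
  closure.\<close>

lemma ex_generic: "\<exists>G. generic G"
proof -
  define dense where "dense d \<longleftrightarrow> (\<forall>p. p \<epsilon> PP \<longrightarrow> (\<exists>q. q \<epsilon> d \<and> le q p))" for d
  define nx where "nx n p = (SOME q. le q p \<and> (dense (from_nat n) \<longrightarrow> q \<epsilon> from_nat n))" for n p
  obtain p0 where p0: "p0 \<epsilon> PP" using PP_nonempty by blast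
  define c where "c = rec_nat p0 nx"
  have nx: "le (nx n p) p \<and> (dense (from_nat n) \<longrightarrow> nx n p \<epsilon> from_nat n)" if "p \<epsilon> PP" for n p
    unfolding nx_def by (rule someI_ex) (use that le_refl in \<open>auto simp: dense_def\<close>)
  have PP: "c n \<epsilon> PP" for n
    by (induction n) (use p0 nx le_PP in \<open>auto simp: c_def\<close>)
  have le: "le (c n) (c m)" if "m \<le> n" for m n
    using that
  proof (induction n)
    case 0
    then show ?case using le_refl PP by simp
  next
    case (Suc n)
    have "le (c (Suc n)) (c n)" using nx[OF PP, of n n] by (simp add: c_def)
    then show ?case using Suc le_trans le_refl[OF PP] by (metis le_SucE)
  qed
  define G where "G = {p. \<exists>n. le (c n) p}"
  have cG: "c n \<in> G" for n using le_refl[OF PP] by (auto simp: G_def)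
  have dir: "\<exists>r\<in>G. le r p \<and> le r q" if "p \<in> G" "q \<in> G" for p q
  proof -
    obtain m n where "le (c m) p" "le (c n) q" using \<open>p \<in> G\<close> \<open>q \<in> G\<close> by (auto simp: G_def)
    then have "le (c (max m n)) p" "le (c (max m n)) q"
      using le[of m "max m n"] le[of n "max m n"] le_trans max.cobounded1 max.cobounded2 by blast+
    then show ?thesis using cG by blast
  qed
  have gen: "\<exists>q\<in>G. q \<epsilon> d" if "\<forall>p. p \<epsilon> PP \<longrightarrow> (\<exists>q. q \<epsilon> d \<and> le q p)" for d
  proof -
    have "c (Suc (to_nat d)) \<epsilon> d" using nx[OF PP, of "to_nat d" "to_nat d"] that by (simp add: c_def dense_def)
    then show ?thesis using cG by blast
  qed
  have up: "q \<in> G" if "p \<in> G" "le p q" for p q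
    using that le_trans unfolding G_def by blast
  have GPP: "p \<epsilon> PP" if "p \<in> G" for p
    using that le_PP unfolding G_def by blast
  have "generic G"
    unfolding generic_def using cG up GPP dir gen by blast
  then show ?thesis ..
qed

end

section \<open>The structure of names over a generic filter, and the truth theorem\<close>

locale generic_forcing = forcing +
  fixes G :: "'a set"
  assumes generic: "generic G"
begin

lemma G_PP: "p \<in> G \<Longrightarrow> p \<epsilon> PP" using generic by (simp add: generic_def)
lemma G_up: "p \<in> G \<Longrightarrow> le p q \<Longrightarrow> q \<in> G" using generic unfolding generic_def by blast
lemma G_dir: "p \<in> G \<Longrightarrow> q \<in> G \<Longrightarrow> \<exists>r\<in>G. le r p \<and> le r q" using generic unfolding generic_def by blast
lemma G_ex: "\<exists>p. p \<in> G" using generic unfolding generic_def by blast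

lemma G_dense:
  assumes d: "dfn (\<lambda>e. D (e 0))" and D: "\<And>p. p \<epsilon> PP \<Longrightarrow> \<exists>q. le q p \<and> D q"
  shows "\<exists>q\<in>G. D q"
proof -
  have s: "q \<epsilon> sep PP D \<longleftrightarrow> q \<epsilon> PP \<and> D q" for q by (rule sep_iff[OF d])
  then have "\<forall>p. p \<epsilon> PP \<longrightarrow> (\<exists>q. q \<epsilon> sep PP D \<and> le q p)" using D le_PP by blast
  then have "\<exists>q\<in>G. q \<epsilon> sep PP D" using generic unfolding generic_def by blast
  then show ?thesis using s by blast
qed

lemma G_dense_below:
  assumes d: "dfn (\<lambda>e. D (e 0))" and p: "p \<in> G" and D: "\<And>q. le q p \<Longrightarrow> \<exists>r. le r q \<and> D r"
  shows "\<exists>q\<in>G. le q p \<and> D q"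
proof -
  \<comment> \<open>Conditions incompatible with \<open>p\<close> are added to make the set dense
    everywhere; the filter contains \<open>p\<close> and so avoids them.\<close>
  have "\<exists>q\<in>G. (le q p \<and> D q) \<or> \<not> (\<exists>r. le r q \<and> le r p)"
  proof (rule G_dense)
    show "dfn (\<lambda>e. (le (e 0) p \<and> D (e 0)) \<or> \<not> (\<exists>r. le r (e 0) \<and> le r p))" by (intro dfI d)
  qed (use D le_refl le_trans in meson)
  then show ?thesis using G_dir p by blast
qed

definition Q where "Q u v \<longleftrightarrow> (\<exists>p\<in>G. Eq p u v)"
definition EN where "EN u v \<longleftrightarrow> (\<exists>b. \<exists>s\<in>G. T v b s \<and> Q u b)"

lemma Q_refl: "Q u u" using G_ex G_PP Eq_refl by (auto simp: Q_def)
lemma Q_sym: "Q u v \<Longrightarrow> Q v u" using Eq_sym by (auto simp: Q_def)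
lemma Q_trans: "Q u v \<Longrightarrow> Q v w \<Longrightarrow> Q u w"
  unfolding Q_def using G_dir Eq_mono Eq_trans by meson

lemma hits_EN: "r \<in> G \<Longrightarrow> hits Eq r x y \<Longrightarrow> EN x y"
  unfolding hits_def EN_def Q_def using G_up by blast

lemma EN_hits: assumes "EN x y" shows "\<exists>r\<in>G. hits Eq r x y"
proof -
  from assms obtain b s p where *: "s \<in> G" "T y b s" "p \<in> G" "Eq p x b" by (auto simp: EN_def Q_def)
  then obtain r where "r \<in> G" "le r s" "le r p" using G_dir by blast
  then show ?thesis using * Eq_mono unfolding hits_def by blast
qed

lemma dfn_hits_Eq [dfI]: "tm s \<Longrightarrow> tm t \<Longrightarrow> tm u \<Longrightarrow> dfn (\<lambda>e. hits Eq (s e) (t e) (u e))"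
  by (rule dfn_P3[where P = "hits Eq"], unfold hits_def, intro dfI)

lemma EN_fmem: "EN x y \<longleftrightarrow> (\<exists>p\<in>G. fmem p x y)"
proof
  assume "EN x y"
  then obtain r where r: "r \<in> G" "hits Eq r x y" using EN_hits by blast
  have "hits Eq q x y" if "le q r" for q
    using r(2) that Eq_mono le_trans unfolding hits_def by meson
  then have "fmem r x y" unfolding fmem_def using G_PP[OF r(1)] le_refl le_PP by blast
  then show "\<exists>p\<in>G. fmem p x y" using r(1) by blast
next
  assume "\<exists>p\<in>G. fmem p x y"
  then obtain p where p: "p \<in> G" "fmem p x y" by blast
  have "\<exists>q\<in>G. le q p \<and> hits Eq q x y"
    by (rule G_dense_below[OF _ p(1)]) (intro dfI, use p(2) in \<open>auto simp: fmem_def\<close>)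
  then show "EN x y" using hits_EN by blast
qed

lemma EN_cong: "Q x x' \<Longrightarrow> Q y y' \<Longrightarrow> EN x y \<Longrightarrow> EN x' y'"
proof -
  assume *: "Q x x'" "Q y y'" "EN x y"
  then obtain p1 p2 p3 where p: "p1 \<in> G" "Eq p1 x x'" "p2 \<in> G" "Eq p2 y y'" "p3 \<in> G" "fmem p3 x y"
    unfolding Q_def EN_fmem by blast
  then obtain r where "r \<in> G" "le r p1" "le r p2" "le r p3" using G_dir le_trans by meson
  then have "r \<in> G" "Eq r x x'" "Eq r y y'" "fmem r x y"
    using p Eq_mono frc_mono[of p3 "\<lambda>n. if n = 0 then x else y" "0 \<^bold>\<in> 1" r] by auto
  then show "EN x' y'" using fmem_cong unfolding EN_fmem by blast
qed

lemma EN_ext: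
  assumes "\<And>z. EN z u \<longleftrightarrow> EN z v"
  shows "Q u v"
proof -
  \<comment> \<open>Here \<open>p\<close> puts some \<open>a\<close> into \<open>u\<close> although
    no extension of \<open>p\<close> puts it into \<open>v\<close>. Where no such condition lies
    below \<open>p\<close>, the inclusion \<open>half Eq p u v\<close> holds.\<close>
  let ?B = "\<lambda>p u v. \<exists>a s. T u a s \<and> le p s \<and> (\<forall>r. le r p \<longrightarrow> \<not> hits Eq r a v)"
  have B: False if "\<And>z. EN z u \<longleftrightarrow> EN z v" "p \<in> G" "?B p u v" for p u v
  proof -
    from that(3) obtain a s where a: "T u a s" "le p s" "\<And>r. le r p \<Longrightarrow> \<not> hits Eq r a v" by blast
    then have "EN a u" unfolding EN_def using that(2) G_up Q_refl by blast
    then have "EN a v" using that(1) by blast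
    then obtain r where r: "r \<in> G" "hits Eq r a v" using EN_hits by blast
    from G_dir[OF r(1) that(2)] obtain r' where "r' \<in> G" "le r' r" "le r' p" by blast
    with r have "hits Eq r' a v" using Eq_mono le_trans unfolding hits_def by meson
    then show False using a(3) \<open>le r' p\<close> by blast
  qed
  have H: "half Eq p u v" if "p \<epsilon> PP" "\<not> (\<exists>q. le q p \<and> ?B q u v)" for p u v
    using that le_trans unfolding half_def by meson
  have sy: "(\<lambda>r a b. Eq r b a) = Eq" using Eq_sym by (intro HOL.ext) blast
  have "\<exists>p\<in>G. Eq p u v \<or> ?B p u v \<or> ?B p v u"
  proof (rule G_dense)
    show "dfn (\<lambda>e. Eq (e 0) u v \<or> ?B (e 0) u v \<or> ?B (e 0) v u)" by (intro dfI)
    fix p assume p: "p \<epsilon> PP"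
    show "\<exists>q. le q p \<and> (Eq q u v \<or> ?B q u v \<or> ?B q v u)"
    proof (rule ccontr)
      assume n: "\<not> ?thesis"
      have "half Eq p u v" "half Eq p v u" using H[OF p] n by blast+
      then have "step Eq p u v" unfolding step_def sy by simp
      then have "Eq p u v" using p Eq_iff by blast
      then show False using n le_refl p by blast
    qed
  qed
  then show ?thesis using B assms unfolding Q_def by metis
qed

text \<open>In the steps for implication and quantifier, the conditions that force the formula or
  force a counterexample are dense, and the filter contains one of them.\<close>

theorem truth: "qsat Q EN e \<phi> \<longleftrightarrow> (\<exists>p\<in>G. frc p e \<phi>)"
proof (induction \<phi> arbitrary: e)
  case (Mem i j)
  show ?case by (simp add: EN_fmem)
next
  case (Eq i j)
  show ?case by (simp add: Q_def)
next
  case Fls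
  show ?case by simp
next
  case (Imp \<phi> \<psi>)
  show ?case
  proof
    assume *: "qsat Q EN e (\<phi> \<^bold>\<longrightarrow> \<psi>)"
    have "\<exists>p\<in>G. frc p e (\<phi> \<^bold>\<longrightarrow> \<psi>) \<or> (frc p e \<phi> \<and> (\<forall>q. le q p \<longrightarrow> \<not> frc q e \<psi>))"
    proof (rule G_dense)
      show "dfn (\<lambda>x. frc (x 0) e (\<phi> \<^bold>\<longrightarrow> \<psi>) \<or> (frc (x 0) e \<phi> \<and> (\<forall>q. le q (x 0) \<longrightarrow> \<not> frc q e \<psi>)))"
        by (intro dfI)
      fix p assume p: "p \<epsilon> PP"
      show "\<exists>q. le q p \<and> (frc q e (\<phi> \<^bold>\<longrightarrow> \<psi>) \<or> (frc q e \<phi> \<and> (\<forall>r. le r q \<longrightarrow> \<not> frc r e \<psi>)))"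
      proof (cases "frc p e (\<phi> \<^bold>\<longrightarrow> \<psi>)")
        case False
        then obtain q where q: "le q p" "frc q e \<phi>" "\<not> frc q e \<psi>" by auto
        then obtain r where "le r q" "\<forall>s. le s r \<longrightarrow> \<not> frc s e \<psi>"
          using frc_stable[of q e \<psi>] le_PP by blast
        then show ?thesis using q frc_mono le_trans by meson
      qed (use p le_refl in blast)
    qed
    then obtain p where p: "p \<in> G" "frc p e (\<phi> \<^bold>\<longrightarrow> \<psi>) \<or> (frc p e \<phi> \<and> (\<forall>q. le q p \<longrightarrow> \<not> frc q e \<psi>))" by blast
    have False if "frc p e \<phi>" "\<forall>q. le q p \<longrightarrow> \<not> frc q e \<psi>"
    proof -
      have "qsat Q EN e \<psi>" using * Imp.IH(1) that(1) p(1) by auto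
      then obtain q where "q \<in> G" "frc q e \<psi>" using Imp.IH(2) by blast
      moreover then obtain r where "le r p" "le r q" using G_dir p(1) by blast
      ultimately show False using that(2) frc_mono by blast
    qed
    then show "\<exists>p\<in>G. frc p e (\<phi> \<^bold>\<longrightarrow> \<psi>)" using p by blast
  next
    assume "\<exists>p\<in>G. frc p e (\<phi> \<^bold>\<longrightarrow> \<psi>)"
    then obtain p where p: "p \<in> G" "\<And>q. le q p \<Longrightarrow> frc q e \<phi> \<Longrightarrow> frc q e \<psi>" by auto
    have "\<exists>r\<in>G. frc r e \<psi>" if q: "q \<in> G" "frc q e \<phi>" for q
    proof -
      obtain r where "r \<in> G" "le r p" "le r q" using G_dir p(1) q(1) by blast
      then show ?thesis using p(2) q(2) frc_mono by blast
    qed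
    then show "qsat Q EN e (\<phi> \<^bold>\<longrightarrow> \<psi>)" using Imp.IH by auto
  qed
next
  case (Forall \<phi>)
  show ?case
  proof
    assume *: "qsat Q EN e (\<^bold>\<forall>\<phi>)"
    have "\<exists>p\<in>G. (\<forall>a. frc p (a ## e) \<phi>) \<or> (\<exists>a. \<forall>q. le q p \<longrightarrow> \<not> frc q (a ## e) \<phi>)"
    proof (rule G_dense)
      show "dfn (\<lambda>x. (\<forall>a. frc (x 0) (a ## e) \<phi>) \<or> (\<exists>a. \<forall>q. le q (x 0) \<longrightarrow> \<not> frc q (a ## e) \<phi>))"
        by (intro dfI)
      fix p assume p: "p \<epsilon> PP"
      show "\<exists>q. le q p \<and> ((\<forall>a. frc q (a ## e) \<phi>) \<or> (\<exists>a. \<forall>r. le r q \<longrightarrow> \<not> frc r (a ## e) \<phi>))"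
        using frc_stable[OF p] p le_refl by meson
    qed
    then obtain p where p: "p \<in> G" "(\<forall>a. frc p (a ## e) \<phi>) \<or> (\<exists>a. \<forall>q. le q p \<longrightarrow> \<not> frc q (a ## e) \<phi>)" by blast
    have False if "\<forall>q. le q p \<longrightarrow> \<not> frc q (a ## e) \<phi>" for a
    proof -
      obtain q where "q \<in> G" "frc q (a ## e) \<phi>" using * Forall.IH by auto
      moreover then obtain r where "le r p" "le r q" using G_dir p(1) by blast
      ultimately show False using that frc_mono by blast
    qed
    then show "\<exists>p\<in>G. frc p e (\<^bold>\<forall>\<phi>)" using p by auto
  qed (auto simp: Forall.IH)
qed

end

section \<open>The forcing and its symmetric names\<close>

text \<open>
  A condition is a pair \<open>(D,A)\<close> with \<open>D\<close> countable; it decides membership in the generic subset of \<open>Z\<close>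
  on \<open>D\<close>, where it agrees with \<open>A\<close>. The group is \<open>pow Z\<close> with symmetric difference. A name is a triple
  \<open>(F,S,X)\<close>: apply \<open>F\<close> to the orbit of \<open>X\<close> under the subgroup of all \<open>K\<close> disjoint from the rows with
  index in \<open>S\<close>. So every name is symmetric with support \<open>S\<close>, and since the group is abelian acting on a
  name only changes \<open>F\<close>. The tag \<open>gr\<close> marks the canonical names of sets of the ground model.
\<close>

locale flip = zfc_model E for E :: "nat \<Rightarrow> nat \<Rightarrow> bool" (infix "\<epsilon>" 50)
begin

definition II where "II = pow om"
definition Z where "Z = prd II II"
definition gr where "gr = pow Z"
definition sd where "sd F K = coll (\<lambda>x. (x \<epsilon> F) \<noteq> (x \<epsilon> K))"
definition PP where "PP = sep (prd gr gr) (\<lambda>p. cnt (fs p))"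
text \<open>Only values on the domain are compared, so flipping a bit outside the domain of
  \<open>p\<close> gives a condition that \<open>p\<close> still extends. This is how a name can be
  moved without leaving the filter.\<close>

definition le where "le q p \<longleftrightarrow> q \<epsilon> PP \<and> p \<epsilon> PP \<and> sub (fs p) (fs q) \<and> (\<forall>z. z \<epsilon> fs p \<longrightarrow> (z \<epsilon> sn q \<longleftrightarrow> z \<epsilon> sn p))"
definition ap where "ap H p = pr (fs p) (sd H (sn p))"
definition small where "small S \<longleftrightarrow> sub S II \<and> cnt S"
definition isn where "isn u \<longleftrightarrow> (\<exists>F S X. F \<epsilon> gr \<and> small S \<and> u = pr F (pr S X))"
definition act where "act H u = (if isn u then pr (sd H (fs u)) (sn u) else u)"
definition sup where "sup u = (if isn u then fs (sn u) else zero)"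
definition off where "off H S \<longleftrightarrow> (\<forall>i j. i \<epsilon> S \<longrightarrow> \<not> pr i j \<epsilon> H)"
definition chk where "chk x = pr gr x"
text \<open>With F the first component of \<open>u\<close>, \<open>sd F K\<close> runs through a
  whole coset of the subgroup that avoids the rows in the support. Listing entries by cosets makes
  symmetry automatic, without a recursive definition of hereditarily symmetric names.\<close>

definition Tn where "Tn u v p \<longleftrightarrow> isn u \<and> (\<exists>K w q. K \<epsilon> gr \<and> off K (sup u) \<and> pr w q \<epsilon> sn (sn u) \<and> q \<epsilon> PP \<and>
   v = act (sd (fs u) K) w \<and> p = ap (sd (fs u) K) q)"
definition Tc where "Tc u v p \<longleftrightarrow> p \<epsilon> PP \<and> (\<exists>x y. u = chk x \<and> v = chk y \<and> y \<epsilon> x)"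
definition T where "T u v p \<longleftrightarrow> Tn u v p \<or> Tc u v p"

lemma tm_sd [dfI]: "tm s \<Longrightarrow> tm t \<Longrightarrow> tm (\<lambda>e. sd (s e) (t e))"
  by (rule tm_f2, unfold sd_def, intro dfI)
lemma dfn_le [dfI]: "tm s \<Longrightarrow> tm t \<Longrightarrow> dfn (\<lambda>e. le (s e) (t e))"
  by (rule dfn_P2, unfold le_def, intro dfI)
lemma tm_ap [dfI]: "tm s \<Longrightarrow> tm t \<Longrightarrow> tm (\<lambda>e. ap (s e) (t e))"
  by (rule tm_f2, unfold ap_def, intro dfI)
lemma dfn_small [dfI]: "tm s \<Longrightarrow> dfn (\<lambda>e. small (s e))"
  by (rule dfn_P1, unfold small_def, intro dfI)
lemma dfn_isn [dfI]: "tm s \<Longrightarrow> dfn (\<lambda>e. isn (s e))"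
  by (rule dfn_P1, unfold isn_def, intro dfI)
lemma tm_act [dfI]: "tm s \<Longrightarrow> tm t \<Longrightarrow> tm (\<lambda>e. act (s e) (t e))"
  by (rule tm_f2, unfold act_def, intro dfI)
lemma tm_sup [dfI]: "tm s \<Longrightarrow> tm (\<lambda>e. sup (s e))"
  by (rule tm_f1, unfold sup_def, intro dfI)
lemma dfn_off [dfI]: "tm s \<Longrightarrow> tm t \<Longrightarrow> dfn (\<lambda>e. off (s e) (t e))"
  by (rule dfn_P2, unfold off_def, intro dfI)
lemma tm_chk [dfI]: "tm s \<Longrightarrow> tm (\<lambda>e. chk (s e))"
  by (rule tm_f1, unfold chk_def, intro dfI)
lemma dfn_T [dfI]: "tm s \<Longrightarrow> tm t \<Longrightarrow> tm u \<Longrightarrow> dfn (\<lambda>e. T (s e) (t e) (u e))"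
  by (rule dfn_P3, unfold T_def Tn_def Tc_def, intro dfI)

section \<open>The group, the conditions and the names\<close>

lemma sd_iff [simp]: "x \<epsilon> sd F K \<longleftrightarrow> (x \<epsilon> F) \<noteq> (x \<epsilon> K)"
  unfolding sd_def
  by (rule coll_iff, rule isset_sub[where a = "cup F K"], intro dfI) auto

lemma sd_assoc: "sd (sd F K) L = sd F (sd K L)" by (rule ext) auto
lemma sd_self [simp]: "sd F F = zero" by (rule ext) auto
lemma sd_zero [simp]: "sd F zero = F" "sd zero F = F" by (rule ext, auto)+
lemma sd_cancel [simp]: "sd F (sd F K) = K" by (rule ext) auto

lemma gr_iff: "F \<epsilon> gr \<longleftrightarrow> sub F Z" by (simp add: gr_def)
lemma zero_gr [simp]: "zero \<epsilon> gr" by (simp add: gr_def sub_def)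
lemma sd_gr [simp]: "F \<epsilon> gr \<Longrightarrow> K \<epsilon> gr \<Longrightarrow> sd F K \<epsilon> gr" by (auto simp: gr_def sub_def)
text \<open>This keeps the two kinds of names apart: a canonical name has \<open>gr\<close> itself
  as first component, a symmetric name has an element of \<open>gr\<close>.\<close>

lemma gr_not_gr [simp]: "\<not> gr \<epsilon> gr"
  using irrefl[of Z] by (metis gr_iff sub_def sub_refl)

lemma PP_iff: "p \<epsilon> PP \<longleftrightarrow> (\<exists>D A. p = pr D A \<and> D \<epsilon> gr \<and> A \<epsilon> gr \<and> cnt D)"
proof -
  have "p \<epsilon> PP \<longleftrightarrow> p \<epsilon> prd gr gr \<and> cnt (fs p)"
    unfolding PP_def by (rule sep_iff) (intro dfI)
  then show ?thesis by (auto simp: prd_iff)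
qed

lemma le_PP: "le q p \<Longrightarrow> q \<epsilon> PP \<and> p \<epsilon> PP" by (simp add: le_def)
lemma le_refl: "p \<epsilon> PP \<Longrightarrow> le p p" by (simp add: le_def)
lemma le_trans: "le p q \<Longrightarrow> le q r \<Longrightarrow> le p r" by (auto simp: le_def sub_def)

lemma fs_ap [simp]: "fs (ap H p) = fs p" by (simp add: ap_def)
lemma sn_ap [simp]: "sn (ap H p) = sd H (sn p)" by (simp add: ap_def)
lemma ap_ap [simp]: "ap H (ap K p) = ap (sd H K) p" by (simp add: ap_def sd_assoc)
lemma ap_zero [simp]: "p \<epsilon> PP \<Longrightarrow> ap zero p = p" by (auto simp: ap_def PP_iff)
lemma ap_PP [simp]: "H \<epsilon> gr \<Longrightarrow> p \<epsilon> PP \<Longrightarrow> ap H p \<epsilon> PP" by (auto simp: ap_def PP_iff)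
lemma le_ap: "H \<epsilon> gr \<Longrightarrow> le q p \<Longrightarrow> le (ap H q) (ap H p)" by (auto simp: le_def sub_def)

lemma small_zero [simp]: "small zero" by (simp add: small_def sub_def cnt_zero)
lemma small_cup [simp]: "small S \<Longrightarrow> small R \<Longrightarrow> small (cup S R)"
  by (auto simp: small_def sub_def cnt_cup)
lemma small_sup [simp]: "small (sup u)"
  by (auto simp: sup_def isn_def)

lemma isn_pr [simp]: "isn (pr F (pr S X)) \<longleftrightarrow> F \<epsilon> gr \<and> small S"
  by (auto simp: isn_def)
lemma sup_pr [simp]: "F \<epsilon> gr \<Longrightarrow> small S \<Longrightarrow> sup (pr F (pr S X)) = S"
  by (simp add: sup_def)
lemma isn_chk [simp]: "\<not> isn (chk x)"
  by (auto simp: isn_def chk_def)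
lemma sup_chk [simp]: "sup (chk x) = zero" by (simp add: sup_def)
lemma chk_eq [simp]: "chk x = chk y \<longleftrightarrow> x = y" by (simp add: chk_def)
lemma act_chk [simp]: "act H (chk x) = chk x" by (simp add: act_def)
lemma act_pr: "F \<epsilon> gr \<Longrightarrow> small S \<Longrightarrow> act H (pr F (pr S X)) = pr (sd H F) (pr S X)"
  by (simp add: act_def)
lemma isn_act [simp]: "H \<epsilon> gr \<Longrightarrow> isn (act H u) \<longleftrightarrow> isn u"
  by (auto simp: act_def isn_def)
lemma act_act [simp]: "K \<epsilon> gr \<Longrightarrow> act H (act K u) = act (sd H K) u"
  by (auto simp: act_def isn_def sd_assoc)
lemma act_zero [simp]: "act zero u = u"
  by (auto simp: act_def isn_def)
lemma sup_act [simp]: "H \<epsilon> gr \<Longrightarrow> sup (act H u) = sup u"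
  unfolding sup_def isn_act by (auto simp: act_def)

lemma off_sd: "off H S \<Longrightarrow> off K S \<Longrightarrow> off (sd H K) S" by (auto simp: off_def)
lemma off_zero [simp]: "off zero S" "off H zero" by (auto simp: off_def)
lemma off_sub: "off H S \<Longrightarrow> sub R S \<Longrightarrow> off H R" by (auto simp: off_def sub_def)

lemma Tn_pr: "F \<epsilon> gr \<Longrightarrow> small S \<Longrightarrow> Tn (pr F (pr S X)) v p \<longleftrightarrow> (\<exists>K w q. K \<epsilon> gr \<and> off K S \<and> pr w q \<epsilon> X \<and>
    q \<epsilon> PP \<and> v = act (sd F K) w \<and> p = ap (sd F K) q)"
  by (simp add: Tn_def)

lemma T_pr: "F \<epsilon> gr \<Longrightarrow> small S \<Longrightarrow> T (pr F (pr S X)) v p \<longleftrightarrow> (\<exists>K w q. K \<epsilon> gr \<and> off K S \<and> pr w q \<epsilon> X \<and>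
    q \<epsilon> PP \<and> v = act (sd F K) w \<and> p = ap (sd F K) q)"
  unfolding T_def Tn_pr by (auto simp: Tc_def chk_def)

lemma T_chk: "T (chk x) v p \<longleftrightarrow> p \<epsilon> PP \<and> (\<exists>y. y \<epsilon> x \<and> v = chk y)"
  by (auto simp: T_def Tn_def Tc_def)

lemma T_cases:
  assumes "T u v p"
  obtains F S X K w q where "F \<epsilon> gr" "small S" "u = pr F (pr S X)" "K \<epsilon> gr" "off K S" "pr w q \<epsilon> X"
      "q \<epsilon> PP" "v = act (sd F K) w" "p = ap (sd F K) q"
    | x y where "u = chk x" "v = chk y" "y \<epsilon> x" "p \<epsilon> PP"
proof (cases "Tn u v p")
  case True
  then obtain F S X where u: "F \<epsilon> gr" "small S" "u = pr F (pr S X)" by (auto simp: Tn_def isn_def)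
  with True show ?thesis using that(1)[OF u] by (auto simp: Tn_pr)
next
  case False
  with assms show ?thesis using that(2) by (auto simp: T_def Tc_def)
qed

lemma T_PP: "T u v p \<Longrightarrow> p \<epsilon> PP"
  by (erule T_cases) auto

lemma T_act:
  assumes H: "H \<epsilon> gr" and "T u v p"
  shows "T (act H u) (act H v) (ap H p)"
  using assms(2)
proof (cases rule: T_cases)
  case (1 F S X K w q)
  have "T (pr (sd H F) (pr S X)) (act H v) (ap H p)"
    unfolding T_pr[OF sd_gr[OF H 1(1)] 1(2)]
    by (rule exI[of _ K], rule exI[of _ w], rule exI[of _ q]) (use 1 H in \<open>simp add: sd_assoc\<close>)
  then show ?thesis using 1 by (simp add: act_pr)
next
  case (2 x y)
  then show ?thesis using H by (auto simp: T_chk)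
qed

text \<open>Acting by \<open>H\<close> turns F into \<open>sd H F\<close>; the entry listed at
  \<open>K\<close> reappears at \<open>sd H K\<close>, where the two occurrences of \<open>H\<close>
  cancel, and \<open>sd H K\<close> still avoids the support.\<close>

lemma T_off1:
  assumes H: "H \<epsilon> gr" "off H (sup u)" and "T u v p"
  shows "T (act H u) v p"
  using assms(3)
proof (cases rule: T_cases)
  case (1 F S X K w q)
  have "sd (sd H F) (sd H K) = sd F K" by (rule ext) auto
  moreover have "off H S" using H 1 by simp
  ultimately have "T (pr (sd H F) (pr S X)) v p"
    unfolding T_pr[OF sd_gr[OF H(1) 1(1)] 1(2)]
    by (intro exI[of _ "sd H K"] exI[of _ w] exI[of _ q]) (use 1 H in \<open>simp add: off_sd\<close>)
  then show ?thesis using 1 by (simp add: act_pr)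
next
  case (2 x y)
  then show ?thesis by (auto simp: T_chk)
qed

lemma T_off: "H \<epsilon> gr \<Longrightarrow> off H (sup u) \<Longrightarrow> T (act H u) v p \<longleftrightarrow> T u v p"
  using T_off1[of H u v p] T_off1[of H "act H u" v p] by auto

text \<open>Adding all translates and all canonical names of elements of a transitive set gives a
  set of names closed both under entries and under the action.\<close>

definition Wt where "Wt t = cup (img (\<lambda>z. act (fs z) (sn z)) (prd gr t)) (img chk t)"

lemma Wt_iff: "w \<epsilon> Wt t \<longleftrightarrow> (\<exists>H v. H \<epsilon> gr \<and> v \<epsilon> t \<and> w = act H v) \<or> (\<exists>y. y \<epsilon> t \<and> w = chk y)"
proof -
  have 1: "y \<epsilon> img (\<lambda>z. act (fs z) (sn z)) (prd gr t) \<longleftrightarrow> (\<exists>z. z \<epsilon> prd gr t \<and> y = act (fs z) (sn z))" for y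
    by (rule img_iff) (intro dfI)
  have 2: "y \<epsilon> img chk t \<longleftrightarrow> (\<exists>z. z \<epsilon> t \<and> y = chk z)" for y
    by (rule img_iff) (intro dfI)
  show ?thesis unfolding Wt_def cup_iff 1 2 prd_iff by (metis fs_pr sn_pr)
qed

lemma Wt_base: "x \<epsilon> t \<Longrightarrow> x \<epsilon> Wt t"
  unfolding Wt_iff by (metis act_zero zero_gr)

lemma Wt_act: "H \<epsilon> gr \<Longrightarrow> u \<epsilon> Wt t \<Longrightarrow> act H u \<epsilon> Wt t"
  unfolding Wt_iff by (metis act_act act_chk sd_gr)

lemma Wt_T:
  assumes t: "trans t" and u: "u \<epsilon> Wt t" and T: "T u v p"
  shows "v \<epsilon> Wt t"
  using T
proof (cases rule: T_cases)
  case (1 F S X K w q)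
  from u 1 obtain H v' where v': "H \<epsilon> gr" "v' \<epsilon> t" "u = act H v'" unfolding Wt_iff by (auto simp: chk_def)
  then have "isn v'" using 1 isn_act by (metis isn_pr)
  then obtain F' S' X' where "v' = pr F' (pr S' X')" by (auto simp: isn_def)
  moreover have "sn (act H v') = sn v'" by (simp add: act_def)
  ultimately have "pr S X \<epsilon> t" using v' 1 t trans_pr by (metis sn_pr)
  then have "w \<epsilon> t" using 1(6) t trans_pr transD by blast
  then show ?thesis using 1 unfolding Wt_iff by (metis sd_gr)
next
  case (2 x y)
  have "x \<epsilon> t"
  proof -
    from u consider H v' where "H \<epsilon> gr" "v' \<epsilon> t" "u = act H v'" | y where "y \<epsilon> t" "u = chk y"
      unfolding Wt_iff by blast
    then show ?thesis
    proof cases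
      case 1
      then have "\<not> isn v'" using 2 isn_act by (metis isn_chk)
      then have "chk x \<epsilon> t" using 1 2 by (simp add: act_def)
      then show ?thesis using t trans_pr unfolding chk_def by blast
    qed (use 2 in simp)
  qed
  then have "y \<epsilon> t" using 2 t transD by blast
  then show ?thesis using 2 unfolding Wt_iff by blast
qed

lemma T_set: "\<exists>W. u \<epsilon> W \<and> (\<forall>u v p. u \<epsilon> W \<longrightarrow> T u v p \<longrightarrow> v \<epsilon> W)"
proof -
  obtain t where "trans t" "u \<epsilon> t" using transitive_superset by blast
  then show ?thesis using Wt_base Wt_T by blast
qed

definition one where "one = pr zero zero"

lemma one_PP [simp]: "one \<epsilon> PP" unfolding one_def PP_iff using cnt_zero zero_gr by blast
lemma le_one: "p \<epsilon> PP \<Longrightarrow> le p one" by (simp add: le_def) (simp add: one_def sub_def)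

sublocale forcing E PP le T
proof
  show "dfn (\<lambda>e. le (e 0) (e 1))" by (intro dfI)
  show "dfn (\<lambda>e. T (e 0) (e 1) (e 2))" by (intro dfI)
  show "\<exists>p. p \<epsilon> PP" using one_PP by blast
qed (fact le_PP le_refl le_trans T_PP T_set)+

section \<open>Symmetry of the forcing relation, well-foundedness of names, countable
  closure\<close>

lemma hits_act:
  assumes H: "H \<epsilon> gr" and K: "\<And>r a b. K r a b \<Longrightarrow> K' (ap H r) (act H a) (act H b)" and h: "hits K r a v"
  shows "hits K' (ap H r) (act H a) (act H v)"
  using h unfolding hits_def using T_act[OF H] le_ap[OF H] K by meson

lemma half_act:
  assumes H: "H \<epsilon> gr" and K: "\<And>r a b. K r a b \<Longrightarrow> K' (ap H r) (act H a) (act H b)" and p: "p \<epsilon> PP"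
    and h: "half K p u v"
  shows "half K' (ap H p) (act H u) (act H v)"
  unfolding half_def
proof (intro allI impI)
  fix a s r assume *: "T (act H u) a s" "le r (ap H p)" "le r s"
  have PP: "r \<epsilon> PP" "s \<epsilon> PP" using *(3) le_PP by blast+
  have "T u (act H a) (ap H s)" "le (ap H r) p" "le (ap H r) (ap H s)"
    using T_act[OF H *(1)] le_ap[OF H *(2)] le_ap[OF H *(3)] H p by auto
  then obtain r' where r': "le r' (ap H r)" "hits K r' (act H a) v" using h unfolding half_def by blast
  have "le (ap H r') r" using le_ap[OF H r'(1)] H PP by simp
  moreover have "hits K' (ap H r') a (act H v)" using hits_act[where K = K and K' = K', OF H K r'(2)] H by simp
  ultimately show "\<exists>r'. le r' r \<and> hits K' r' a (act H v)" by blast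
qed

lemma Eq_act:
  assumes H: "H \<epsilon> gr" and e: "Eq p u v"
  shows "Eq (ap H p) (act H u) (act H v)"
proof (rule Eq_coinduct[where K = "\<lambda>p u v. p \<epsilon> PP \<and> Eq (ap H p) (act H u) (act H v)"])
  show "dfn (\<lambda>e. e 0 \<epsilon> PP \<and> Eq (ap H (e 0)) (act H (e 1)) (act H (e 2)))" by (intro dfI)
  have "p \<epsilon> PP" using e Eq_PP by blast
  then show "ap H p \<epsilon> PP \<and> Eq (ap H (ap H p)) (act H (act H u)) (act H (act H v))" "ap H p \<epsilon> PP"
    using H e by simp_all
  fix p u v assume *: "p \<epsilon> PP \<and> Eq (ap H p) (act H u) (act H v)"
  have K: "ap H r \<epsilon> PP \<and> Eq (ap H (ap H r)) (act H (act H a)) (act H (act H b))" if "Eq r a b" for r a b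
    using that H Eq_PP[OF that] by simp
  from * have st: "half Eq (ap H p) (act H u) (act H v)" "half (\<lambda>r a b. Eq r b a) (ap H p) (act H v) (act H u)"
    using Eq_step by (auto simp: step_def)
  have "half (\<lambda>p u v. p \<epsilon> PP \<and> Eq (ap H p) (act H u) (act H v)) (ap H (ap H p)) (act H (act H u)) (act H (act H v))"
    by (rule half_act[OF H _ _ st(1)]) (rule K, use H * in simp_all)
  moreover have "half (\<lambda>p u v. p \<epsilon> PP \<and> Eq (ap H p) (act H v) (act H u)) (ap H (ap H p)) (act H (act H v)) (act H (act H u))"
    by (rule half_act[OF H _ _ st(2)]) (rule K, use H * in simp_all)
  ultimately show "step (\<lambda>p u v. p \<epsilon> PP \<and> Eq (ap H p) (act H u) (act H v)) p u v"
    using H * by (simp add: step_def)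
qed

lemma fmem_act:
  assumes H: "H \<epsilon> gr" and f: "fmem p x y"
  shows "fmem (ap H p) (act H x) (act H y)"
  unfolding fmem_def
proof (intro conjI allI impI)
  have p: "p \<epsilon> PP" using f by (simp add: fmem_def)
  then show "ap H p \<epsilon> PP" using H by simp
  fix q assume q: "le q (ap H p)"
  then have "le (ap H q) p" using le_ap[OF H q] p H by simp
  then obtain r where r: "le r (ap H q)" "hits Eq r x y" using f by (auto simp: fmem_def)
  have "q \<epsilon> PP" using q le_PP by blast
  then have "le (ap H r) q" using le_ap[OF H r(1)] H by simp
  moreover have "hits Eq (ap H r) (act H x) (act H y)" by (rule hits_act[where K = Eq, OF H _ r(2)]) (rule Eq_act[OF H])
  ultimately show "\<exists>r. le r q \<and> hits Eq r (act H x) (act H y)" by blast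
qed

text \<open>The symmetry lemma. Every flip is its own inverse, so a condition below
  \<open>ap H p\<close> or a value for the bound variable is pulled back by the same
  \<open>H\<close>.\<close>

lemma frc_act:
  assumes H: "H \<epsilon> gr"
  shows "p \<epsilon> PP \<Longrightarrow> frc p e \<phi> \<Longrightarrow> frc (ap H p) (\<lambda>n. act H (e n)) \<phi>"
proof (induction \<phi> arbitrary: p e)
  case (Mem i j)
  then show ?case using fmem_act[OF H] by simp
next
  case (Eq i j)
  then show ?case using Eq_act[OF H] by simp
next
  case (Imp \<phi> \<psi>)
  show ?case unfolding frc.simps
  proof (intro allI impI)
    fix q assume q: "le q (ap H p)" "frc q (\<lambda>n. act H (e n)) \<phi>"
    have PP: "q \<epsilon> PP" using q le_PP by blast
    have l: "le (ap H q) p" using le_ap[OF H q(1)] Imp.prems H by simp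
    have "frc (ap H q) e \<phi>" using Imp.IH(1)[OF PP q(2)] H by simp
    then have "frc (ap H q) e \<psi>" using Imp.prems l by simp
    then have "frc (ap H (ap H q)) (\<lambda>n. act H (e n)) \<psi>" by (intro Imp.IH(2)) (use H PP in simp_all)
    then show "frc q (\<lambda>n. act H (e n)) \<psi>" using H PP by simp
  qed
next
  case (Forall \<phi>)
  show ?case unfolding frc.simps
  proof
    fix a
    have "frc (ap H p) (\<lambda>n. act H ((act H a ## e) n)) \<phi>"
      using Forall.prems by (intro Forall.IH) simp_all
    moreover have "(\<lambda>n. act H ((act H a ## e) n)) = (a ## (\<lambda>n. act H (e n)))"
      using H by (auto split: nat.split)
    ultimately show "frc (ap H p) (a ## (\<lambda>n. act H (e n))) \<phi>" by simp
  qed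
qed simp

lemma Eq_off: "H \<epsilon> gr \<Longrightarrow> off H (sup u) \<Longrightarrow> p \<epsilon> PP \<Longrightarrow> Eq p (act H u) u"
  by (rule Eq_same) (rule T_off)

lemma Eq_chk: "Eq p (chk x) (chk y) \<Longrightarrow> x = y"
proof -
  have "\<forall>p y. Eq p (chk x) (chk y) \<longrightarrow> x = y"
  proof (rule eps_induct[where Q = "\<lambda>x. \<forall>p y. Eq p (chk x) (chk y) \<longrightarrow> x = y"])
    show "dfn (\<lambda>e. \<forall>p y. Eq p (chk (e 0)) (chk y) \<longrightarrow> e 0 = y)" by (intro dfI)
    fix x assume IH: "\<And>z. z \<epsilon> x \<Longrightarrow> \<forall>p y. Eq p (chk z) (chk y) \<longrightarrow> z = y"
    show "\<forall>p y. Eq p (chk x) (chk y) \<longrightarrow> x = y"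
    proof (intro allI impI)
      fix p y assume *: "Eq p (chk x) (chk y)"
      then have p: "p \<epsilon> PP" by (rule Eq_PP)
      have half: "half Eq p (chk x) (chk y)" "half (\<lambda>r a b. Eq r b a) p (chk y) (chk x)"
        using Eq_step[OF *] by (simp_all add: step_def)
      show "x = y"
      proof (rule ext, rule iffI)
        fix z assume z: "z \<epsilon> x"
        have "T (chk x) (chk z) p" using z p by (simp add: T_chk)
        then obtain r where "hits Eq r (chk z) (chk y)" using half(1) le_refl[OF p] unfolding half_def by blast
        then obtain w where "w \<epsilon> y" "Eq r (chk z) (chk w)" by (auto simp: hits_def T_chk)
        then show "z \<epsilon> y" using IH z by blast
      next
        fix z assume z: "z \<epsilon> y"
        have "T (chk y) (chk z) p" using z p by (simp add: T_chk)
        then obtain r where "hits (\<lambda>r a b. Eq r b a) r (chk z) (chk x)" using half(2) le_refl[OF p] unfolding half_def by blast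
        then obtain w where "w \<epsilon> x" "Eq r (chk w) (chk z)" by (auto simp: hits_def T_chk)
        then show "z \<epsilon> x" using IH by blast
      qed
    qed
  qed
  then show "Eq p (chk x) (chk y) \<Longrightarrow> x = y" by blast
qed

text \<open>The entry relation is well-founded for definable classes. Entries are translates of sets
  lying inside the name, or canonical names of such sets, so the induction excludes every translate
  of \<open>v\<close> and \<open>chk v\<close> together.\<close>

lemma name_minimal:
  assumes d: "dfn (\<lambda>e. C (e 0))" and "C b"
  shows "\<exists>b. C b \<and> (\<forall>c s. T b c s \<longrightarrow> \<not> C c)"
proof (rule ccontr)
  assume "\<not> ?thesis"
  then have ex: "\<And>b. C b \<Longrightarrow> \<exists>c s. T b c s \<and> C c" by blast
  have "(\<forall>H. H \<epsilon> gr \<longrightarrow> \<not> C (act H v)) \<and> \<not> C (chk v)" for v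
  proof (rule tcl_induct[where Q = "\<lambda>v. (\<forall>H. H \<epsilon> gr \<longrightarrow> \<not> C (act H v)) \<and> \<not> C (chk v)"])
    show "dfn (\<lambda>e. (\<forall>H. H \<epsilon> gr \<longrightarrow> \<not> C (act H (e 0))) \<and> \<not> C (chk (e 0)))" by (intro dfI dfn_P1[OF d])
    fix v assume IH: "\<And>y z. z \<epsilon> v \<Longrightarrow> tcl y z \<Longrightarrow> (\<forall>H. H \<epsilon> gr \<longrightarrow> \<not> C (act H y)) \<and> \<not> C (chk y)"
    \<comment> \<open>The induction hypothesis for everything below the second component of
      \<open>v\<close>: there sit the entries of a symmetric name as well as the set that a
      canonical name stands for.\<close>
    have IHpr: "(\<forall>H. H \<epsilon> gr \<longrightarrow> \<not> C (act H y)) \<and> \<not> C (chk y)" if "v = pr a b" "tcl y b" for a b y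
    proof -
      have "upr a b \<epsilon> v" using that(1) by (simp add: pr_def)
      moreover have "tcl y (upr a b)"
        using that(2) transD unfolding tcl_def by (metis upr_iff)
      ultimately show ?thesis using IH by blast
    qed
    have chk: "\<not> C (chk v)"
    proof
      assume "C (chk v)"
      from ex[OF this] obtain c s where "T (chk v) c s" "C c" by blast
      then show False using IH tcl_refl by (auto simp: T_chk)
    qed
    have "\<not> C (act H v)" if H: "H \<epsilon> gr" for H
    proof
      assume "C (act H v)"
      from ex[OF this] obtain c s where c: "T (act H v) c s" "C c" by blast
      from c(1) show False
      proof (cases rule: T_cases)
        case (1 F S X K w q)
        then have "isn v" using H by (metis isn_act isn_pr)
        then obtain F' S' X' where v: "v = pr F' (pr S' X')" by (auto simp: isn_def)
        moreover have "sn (act H v) = sn v" by (simp add: act_def)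
        ultimately have "v = pr F' (pr S X)" using 1 by simp
        moreover have "tcl w (pr S X)"
          using 1(6) tcl_pr tcl_step tcl_refl by blast
        ultimately have "\<not> C (act (sd F K) w)" using IHpr 1 by simp
        then show False using c 1 by simp
      next
        case (2 x y)
        then have "\<not> isn v" using H by (metis isn_act isn_chk)
        then have v: "v = pr gr x" using 2 by (simp add: act_def chk_def)
        have "tcl y x" using 2 tcl_step tcl_refl by blast
        then show False using IHpr[OF v] c 2 by simp
      qed
    qed
    with chk show "(\<forall>H. H \<epsilon> gr \<longrightarrow> \<not> C (act H v)) \<and> \<not> C (chk v)" by blast
  qed
  then have "\<not> C (act zero b)" using zero_gr by blast
  then show False using \<open>C b\<close> by simp
qed

text \<open>Conditions in a descending sequence agree on common domain, so they have a union.
  Definability of the sequence makes that union a set of the model, and \<open>cnt_UN\<close> makes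
  its domain countable.\<close>

lemma lower_bound:
  assumes s: "tm (\<lambda>e. s (e 0))" and le: "\<And>n. n \<epsilon> om \<Longrightarrow> le (s (sc n)) (s n)"
  shows "\<exists>q. \<forall>n. n \<epsilon> om \<longrightarrow> le q (s n)"
proof -
  have PP: "s n \<epsilon> PP" if "n \<epsilon> om" for n using le[OF that] le_PP by blast
  have chain: "\<forall>m. m \<epsilon> n \<longrightarrow> le (s n) (s m)" if "n \<epsilon> om" for n
  proof (rule om_induct[where Q = "\<lambda>n. \<forall>m. m \<epsilon> n \<longrightarrow> le (s n) (s m)", OF _ _ _ that])
    show "dfn (\<lambda>e. \<forall>m. m \<epsilon> e 0 \<longrightarrow> le (s (e 0)) (s m))" by (intro dfI tm_f1[OF s])
    show "\<forall>m. m \<epsilon> sc n \<longrightarrow> le (s (sc n)) (s m)" if "n \<epsilon> om" "\<forall>m. m \<epsilon> n \<longrightarrow> le (s n) (s m)" for n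
      using le[OF that(1)] that(2) le_trans by (metis sc_iff)
  qed simp
  have agree: "z \<epsilon> sn (s m) \<longleftrightarrow> z \<epsilon> sn (s n)"
    if "m \<epsilon> om" "n \<epsilon> om" "z \<epsilon> fs (s m)" "z \<epsilon> fs (s n)" for m n z
  proof -
    have "m \<epsilon> n \<or> m = n \<or> n \<epsilon> m" using that om_linear by blast
    then show ?thesis using chain that unfolding le_def by blast
  qed
  let ?f = "\<lambda>n. fs (s n)"
  have f: "tm (\<lambda>e. ?f (e 0))" by (intro dfI tm_f1[OF s])
  define D where "D = uni (img ?f om)"
  have D: "z \<epsilon> D \<longleftrightarrow> (\<exists>n. n \<epsilon> om \<and> z \<epsilon> fs (s n))" for z
    unfolding D_def uni_iff img_iff[OF f] by blast
  have PPD: "fs p \<epsilon> gr" "cnt (fs p)" if "p \<epsilon> PP" for p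
    using that by (auto simp: PP_iff)
  have cD: "cnt D" unfolding D_def by (rule cnt_UN[OF f]) (use PP PPD in blast)
  have gD: "D \<epsilon> gr" using PP PPD unfolding gr_iff sub_def D by blast
  define A where "A = sep D (\<lambda>z. \<exists>n. n \<epsilon> om \<and> z \<epsilon> fs (s n) \<and> z \<epsilon> sn (s n))"
  have A: "z \<epsilon> A \<longleftrightarrow> z \<epsilon> D \<and> (\<exists>n. n \<epsilon> om \<and> z \<epsilon> fs (s n) \<and> z \<epsilon> sn (s n))" for z
    unfolding A_def by (rule sep_iff) (intro dfI tm_f1[OF s])
  have gA: "A \<epsilon> gr" using gD by (simp add: gr_iff sub_def A)
  have "pr D A \<epsilon> PP" unfolding PP_iff using cD gD gA by blast
  moreover have "z \<epsilon> A \<longleftrightarrow> z \<epsilon> sn (s n)" if "n \<epsilon> om" "z \<epsilon> fs (s n)" for n z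
    using that agree unfolding A D by blast
  ultimately have "le (pr D A) (s n)" if "n \<epsilon> om" for n
    using that PP D by (auto simp: le_def sub_def)
  then show ?thesis by blast
qed

end

context forcing
begin

lemma frc_ExiD: "frc p e (\<^bold>\<exists>\<phi>) \<Longrightarrow> p \<epsilon> PP \<Longrightarrow> \<exists>q a. le q p \<and> frc q (a ## e) \<phi>"
  using le_refl[of p] unfolding Exi_def Neg_def frc.simps by blast

lemma frc_ConD:
  assumes "frc p e (\<phi> \<^bold>\<and> \<psi>)" "p \<epsilon> PP"
  shows "frc p e \<phi>" "frc p e \<psi>"
proof -
  have "\<exists>r. le r q \<and> frc r e \<phi> \<and> frc r e \<psi>" if q: "le q p" for q
  proof -
    have "le q q" using q le_PP le_refl by blast
    then have "\<not> frc q e (\<phi> \<^bold>\<longrightarrow> \<^bold>\<not>\<psi>)" using assms(1) q by (auto simp: Con_def Neg_def)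
    then obtain q1 q2 where "le q1 q" "frc q1 e \<phi>" "le q2 q1" "frc q2 e \<psi>" by (auto simp: Neg_def)
    then show ?thesis using frc_mono le_trans by blast
  qed
  then show "frc p e \<phi>" "frc p e \<psi>" using frc_stable[OF assms(2)] by blast+
qed

end

section \<open>The symmetric extension\<close>

locale flip_gen = flip +
  fixes G :: "nat set"
  assumes gen: "generic G"

sublocale flip_gen \<subseteq> generic_forcing E PP le T G
  by unfold_locales (rule gen)

locale flip_ext = flip_gen +
  fixes h :: "nat \<Rightarrow> nat" and NN :: "nat \<Rightarrow> nat \<Rightarrow> bool"
  assumes surj_h: "surj h"
    and h_eq: "Q x y \<longleftrightarrow> h x = h y"
    and h_mem: "EN x y \<longleftrightarrow> NN (h x) (h y)"
begin

lemma obtain_name: obtains u where "x = h u"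
  using surj_h by (metis surjD)

lemma obtain_env: obtains e where "e' = (\<lambda>n. h (e n))"
  using that[of "\<lambda>n. inv h (e' n)"] surj_f_inv_f[OF surj_h] by simp

lemma h_scons: "(\<lambda>n. h ((a ## e) n)) = h a ## (\<lambda>n. h (e n))"
  by (auto split: nat.split)

lemma NN_sat: "sat NN (\<lambda>n. h (e n)) \<phi> \<longleftrightarrow> (\<exists>p\<in>G. frc p e \<phi>)"
proof -
  have "qsat Q EN e \<phi> \<longleftrightarrow> sat NN (\<lambda>n. h (e n)) \<phi>"
    by (rule qsat_sat) (fact surj_h h_eq h_mem)+
  then show ?thesis using truth by simp
qed

lemma NN_mem: "NN x (h u) \<longleftrightarrow> (\<exists>b s. s \<in> G \<and> T u b s \<and> x = h b)"
proof -
  obtain v where "x = h v" by (rule obtain_name)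
  then show ?thesis using h_mem[of v u] h_eq by (auto simp: EN_def)
qed

lemma NN_fmem: "NN (h u) (h v) \<longleftrightarrow> (\<exists>p\<in>G. fmem p u v)"
  using h_mem EN_fmem by simp

lemma NN_ext: "(\<And>z. NN z x \<longleftrightarrow> NN z y) \<Longrightarrow> x = y"
proof -
  assume *: "\<And>z. NN z x \<longleftrightarrow> NN z y"
  obtain u v where "x = h u" "y = h v" using obtain_name by metis
  then show "x = y" using EN_ext[of u v] * h_eq h_mem by simp
qed

lemma one_G: "one \<in> G" using G_ex G_up le_one G_PP by blast

lemma h_off: "H \<epsilon> gr \<Longrightarrow> off H (sup u) \<Longrightarrow> h (act H u) = h u"
  using Eq_off G_ex G_PP h_eq Q_def by blast

lemma h_chk: "h (chk x) = h (chk y) \<longleftrightarrow> x = y"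
  using Eq_chk h_eq[of "chk x" "chk y"] by (auto simp: Q_def)

lemma NN_chk: "NN x (h (chk a)) \<longleftrightarrow> (\<exists>y. y \<epsilon> a \<and> x = h (chk y))"
  using G_ex G_PP by (auto simp: NN_mem T_chk)

text \<open>All entries carry the weakest condition, so membership in the interpreted set does not
  depend on the filter.\<close>

definition smpl where "smpl S X = pr zero (pr S (prd X (upr one one)))"

lemma tm_smpl [dfI]: "tm s \<Longrightarrow> tm t \<Longrightarrow> tm (\<lambda>e. smpl (s e) (t e))"
  by (rule tm_f2, unfold smpl_def, intro dfI)

lemma sup_smpl [simp]: "small S \<Longrightarrow> sup (smpl S X) = S" by (simp add: smpl_def)

text \<open>A name always contributes the orbit of its entries; the closure hypothesis says that
  translating by flips off the support produces no new element.\<close>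

lemma NN_smpl:
  assumes S: "small S" and cl: "\<And>v K. v \<epsilon> X \<Longrightarrow> K \<epsilon> gr \<Longrightarrow> off K S \<Longrightarrow> \<exists>v'. v' \<epsilon> X \<and> h (act K v) = h v'"
  shows "NN x (h (smpl S X)) \<longleftrightarrow> (\<exists>v. v \<epsilon> X \<and> x = h v)"
proof
  assume "NN x (h (smpl S X))"
  then obtain b s where "s \<in> G" "T (smpl S X) b s" "x = h b" by (auto simp: NN_mem)
  then show "\<exists>v. v \<epsilon> X \<and> x = h v"
    unfolding smpl_def T_pr[OF zero_gr S] using cl by auto
next
  assume "\<exists>v. v \<epsilon> X \<and> x = h v"
  then obtain v where v: "v \<epsilon> X" "x = h v" by blast
  have "T (smpl S X) v one"
    unfolding smpl_def T_pr[OF zero_gr S]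
    by (intro exI[of _ zero] exI[of _ v] exI[of _ one]) (use v in simp)
  then show "NN x (h (smpl S X))" unfolding NN_mem using one_G v by blast
qed

lemma NN_smpl_sup:
  assumes S: "small S" and cl: "\<And>v. v \<epsilon> X \<Longrightarrow> sub (sup v) S"
  shows "NN x (h (smpl S X)) \<longleftrightarrow> (\<exists>v. v \<epsilon> X \<and> x = h v)"
  by (rule NN_smpl[OF S]) (use h_off cl off_sub in blast)

text \<open>An upper bound only: the orbit may add further elements, which \<open>NN_sep\<close>
  cuts away in each application.\<close>

lemma NN_cover: "\<exists>y. \<forall>b. b \<epsilon> W \<longrightarrow> NN (h b) y"
proof (intro exI allI impI)
  fix b assume b: "b \<epsilon> W"
  have "T (pr zero (pr zero (prd W PP))) b one"
    unfolding T_pr[OF zero_gr small_zero]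
    by (intro exI[of _ zero] exI[of _ b] exI[of _ one]) (use b in simp)
  then show "NN (h b) (h (pr zero (pr zero (prd W PP))))" unfolding NN_mem using one_G by blast
qed

definition closedW where
  "closedW W \<longleftrightarrow> (\<forall>u v p. u \<epsilon> W \<longrightarrow> T u v p \<longrightarrow> v \<epsilon> W) \<and> (\<forall>H u. H \<epsilon> gr \<longrightarrow> u \<epsilon> W \<longrightarrow> act H u \<epsilon> W)"

lemma ex_closedW: "\<exists>W. closedW W \<and> u \<epsilon> W"
proof -
  obtain t where "trans t" "u \<epsilon> t" using transitive_superset by blast
  then show ?thesis using Wt_base Wt_T Wt_act unfolding closedW_def by blast
qed

lemma closedW_mem: "closedW W \<Longrightarrow> u \<epsilon> W \<Longrightarrow> NN x (h u) \<Longrightarrow> \<exists>b. b \<epsilon> W \<and> x = h b"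
  unfolding NN_mem closedW_def by blast

section \<open>The axioms of ZF in the extension\<close>

lemma ex_support:
  fixes n :: nat and e :: "nat \<Rightarrow> nat"
  shows "\<exists>S. small S \<and> (\<forall>i<n. sub (sup (e i)) S)"
proof (induction n)
  case 0
  show ?case using small_zero by blast
next
  case (Suc n)
  then obtain S where "small S" "\<forall>i<n. sub (sup (e i)) S" by blast
  then show ?case
    by (intro exI[of _ "cup S (sup (e n))"]) (auto simp: less_Suc_eq sub_def)
qed

text \<open>Each candidate \<open>w\<close> is paired with the conditions that force the formula of
  \<open>w\<close>; a support common to the parameters makes this set invariant. The conclusion
  keeps the bound \<open>prd W PP\<close> on \<open>X\<close> because Power Set needs all subsets to
  have names in a single set.\<close>

lemma sep_name:
  assumes W: "closedW W" "a \<epsilon> W"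
  shows "\<exists>S X. small S \<and> sub X (prd W PP) \<and>
    (\<forall>x. NN x (h (pr zero (pr S X))) \<longleftrightarrow> NN x (h a) \<and> sat NN (x ## (\<lambda>n. h (e n))) \<chi>)"
proof -
  \<comment> \<open>The assignment is external to the model, so a common small support is obtained
    only for the finitely many parameters that occur; the others become \<open>chk zero\<close>,
    whose support is empty.\<close>
  define e1 where "e1 n = (if n < bnd \<chi> then e n else chk zero)" for n
  define \<phi> where "\<phi> = (0 \<^bold>\<in> 1 \<^bold>\<and> ren (0 ## (\<lambda>n. n + 2)) \<chi>)"
  have sat\<phi>: "sat NN (x ## h a ## (\<lambda>n. h (e1 n))) \<phi> \<longleftrightarrow> NN x (h a) \<and> sat NN (x ## (\<lambda>n. h (e n))) \<chi>" for x
  proof -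
    have "(\<lambda>n. (x ## h a ## (\<lambda>n. h (e1 n))) ((0 ## (\<lambda>n. n + 2)) n)) = x ## (\<lambda>n. h (e1 n))"
      by (auto split: nat.split)
    moreover have "sat NN (x ## (\<lambda>n. h (e1 n))) \<chi> = sat NN (x ## (\<lambda>n. h (e n))) \<chi>"
      by (rule sat_bnd) (auto simp: e1_def split: nat.split)
    ultimately show ?thesis by (simp add: \<phi>_def del: add_2_eq_Suc')
  qed
  have sat_frc: "sat NN (h b ## h a ## (\<lambda>n. h (e1 n))) \<phi> \<longleftrightarrow> (\<exists>p\<in>G. frc p (b ## a ## e1) \<phi>)" for b
    using NN_sat[of "b ## a ## e1" \<phi>] by (simp add: h_scons)
  obtain S where S: "small S" "\<And>i. i < Suc (bnd \<chi>) \<Longrightarrow> sub (sup ((a ## e1) i)) S"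
    using ex_support[of "Suc (bnd \<chi>)" "a ## e1"] by blast
  have Sa: "sub (sup a) S" using S(2)[of 0] by simp
  have Se: "sub (sup (e1 i)) S" for i
    using S(2)[of "Suc i"] by (cases "i < bnd \<chi>") (auto simp: e1_def sub_def)
  define X where "X = sep (prd W PP) (\<lambda>z. frc (sn z) (fs z ## a ## e1) \<phi>)"
  have X: "z \<epsilon> X \<longleftrightarrow> z \<epsilon> prd W PP \<and> frc (sn z) (fs z ## a ## e1) \<phi>" for z
    unfolding X_def by (rule sep_iff) (intro dfI)
  \<comment> \<open>A flip off \<open>S\<close> moves \<open>w\<close> and \<open>q\<close> but
    fixes \<open>a\<close> and the parameters up to forced equality.\<close>
  have inv: "frc (ap K q) (act K w ## a ## e1) \<phi>"
    if "K \<epsilon> gr" "off K S" "q \<epsilon> PP" "frc q (w ## a ## e1) \<phi>" for K q w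
  proof (rule frc_cong)
    show "frc (ap K q) (\<lambda>n. act K ((w ## a ## e1) n)) \<phi>" by (rule frc_act[OF that(1,3,4)])
    have p: "ap K q \<epsilon> PP" using that by simp
    show "Eq (ap K q) (act K ((w ## a ## e1) i)) ((act K w ## a ## e1) i)" for i
      using p that(1,2) Sa Se by (auto split: nat.split intro: Eq_refl Eq_off off_sub)
  qed
  let ?u = "pr zero (pr S X)"
  have "NN x (h ?u) \<longleftrightarrow> NN x (h a) \<and> sat NN (x ## (\<lambda>n. h (e n))) \<chi>" for x
  proof
    assume "NN x (h ?u)"
    then obtain b s where *: "s \<in> G" "T ?u b s" "x = h b" by (auto simp: NN_mem)
    then have "frc s (b ## a ## e1) \<phi>"
      unfolding T_pr[OF zero_gr S(1)] using inv by (auto simp: X)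
    then have "sat NN (h b ## h a ## (\<lambda>n. h (e1 n))) \<phi>" using sat_frc *(1) by blast
    then show "NN x (h a) \<and> sat NN (x ## (\<lambda>n. h (e n))) \<chi>" using sat\<phi> *(3) by blast
  next
    assume x: "NN x (h a) \<and> sat NN (x ## (\<lambda>n. h (e n))) \<chi>"
    then obtain b where b: "b \<epsilon> W" "x = h b" using closedW_mem[OF W] by blast
    then obtain p where p: "p \<in> G" "frc p (b ## a ## e1) \<phi>" using x sat\<phi> sat_frc by blast
    have "T ?u b p"
      unfolding T_pr[OF zero_gr S(1)]
      by (intro exI[of _ zero] exI[of _ b] exI[of _ p]) (use b p G_PP in \<open>simp add: X\<close>)
    then show "NN x (h ?u)" unfolding NN_mem using p b by blast
  qed
  moreover have "sub X (prd W PP)" by (simp add: sub_def X)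
  ultimately show ?thesis using S(1) by blast
qed

lemma NN_sep: "\<exists>b. \<forall>x. NN x b \<longleftrightarrow> NN x a \<and> sat NN (x ## e) \<chi>"
proof -
  obtain u where u: "a = h u" by (rule obtain_name)
  obtain e1 where e1: "e = (\<lambda>n. h (e1 n))" by (rule obtain_env)
  obtain W where "closedW W" "u \<epsilon> W" using ex_closedW by blast
  from sep_name[OF this, of e1 \<chi>] show ?thesis unfolding u e1 by blast
qed

lemma NN_foundation:
  assumes "NN y x"
  shows "\<exists>y. NN y x \<and> (\<forall>z. NN z y \<longrightarrow> \<not> NN z x)"
proof -
  obtain a y0 where a: "x = h a" "y = h y0" using obtain_name by metis
  then obtain p0 where p0: "p0 \<in> G" "fmem p0 y0 a" using assms NN_fmem by blast
  \<comment> \<open>Either \<open>q\<close> has settled on a minimal element \<open>b\<close> of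
    \<open>a\<close>, or nothing below \<open>q\<close> enters \<open>a\<close>; the latter is
    excluded by \<open>p0\<close>. Minimality comes from the well-foundedness of names in the ground
    model.\<close>
  let ?D = "\<lambda>q. (\<exists>b. fmem q b a \<and> (\<forall>c s r. T b c s \<longrightarrow> le r q \<longrightarrow> le r s \<longrightarrow> \<not> fmem r c a)) \<or>
     \<not> (\<exists>b r. le r q \<and> fmem r b a)"
  have "\<exists>q\<in>G. ?D q"
  proof (rule G_dense)
    show "dfn (\<lambda>e. (\<exists>b. fmem (e 0) b a \<and> (\<forall>c s r. T b c s \<longrightarrow> le r (e 0) \<longrightarrow> le r s \<longrightarrow> \<not> fmem r c a)) \<or>
     \<not> (\<exists>b r. le r (e 0) \<and> fmem r b a))" by (intro dfI)
    fix p assume p: "p \<epsilon> PP"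
    show "\<exists>q. le q p \<and> ?D q"
    proof (cases "\<exists>b r. le r p \<and> fmem r b a")
      case False
      then show ?thesis using p le_refl by blast
    next
      case True
      then obtain b0 where b0: "\<exists>r. le r p \<and> fmem r b0 a" by blast
      have "dfn (\<lambda>e. \<exists>r. le r p \<and> fmem r (e 0) a)" by (intro dfI)
      from name_minimal[where C = "\<lambda>b. \<exists>r. le r p \<and> fmem r b a", OF this b0] obtain b r
        where b: "le r p" "fmem r b a" "\<And>c s. T b c s \<Longrightarrow> \<not> (\<exists>r. le r p \<and> fmem r c a)" by blast
      then have "?D r" using le_trans by blast
      then show ?thesis using b(1) by blast
    qed
  qed
  then obtain q where q: "q \<in> G" "?D q" by blast
  obtain r0 where r0: "le r0 q" "le r0 p0" using G_dir q(1) p0(1) by blast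
  have fm: "fmem r u v" if "fmem s u v" "le r s" for r s u v
    using that le_trans le_PP unfolding fmem_def by blast
  have "fmem r0 y0 a" using fm p0(2) r0(2) by blast
  then have "\<exists>b r. le r q \<and> fmem r b a" using r0 by blast
  with q(2) obtain b where b: "fmem q b a" "\<And>c s r. T b c s \<Longrightarrow> le r q \<Longrightarrow> le r s \<Longrightarrow> \<not> fmem r c a" by blast
  have "\<not> NN z x" if z: "NN z (h b)" for z
  proof
    assume "NN z x"
    from z obtain c s where c: "s \<in> G" "T b c s" "z = h c" by (auto simp: NN_mem)
    with \<open>NN z x\<close> obtain p where p: "p \<in> G" "fmem p c a" using a NN_fmem by blast
    obtain r1 where r1: "r1 \<in> G" "le r1 q" "le r1 s" using G_dir q(1) c(1) by blast
    obtain r where r: "le r r1" "le r p" using G_dir r1(1) p(1) by blast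
    then show False using b(2)[OF c(2), of r] r1 fm[OF p(2) r(2)] le_trans by blast
  qed
  moreover have "NN (h b) x" using a q(1) b(1) NN_fmem by blast
  ultimately show ?thesis by blast
qed

lemma is_empty_NN: "is_empty NN (h (chk zero))"
  by (simp add: is_empty_def NN_chk)

lemma is_succ_NN: "is_succ NN (h (chk n)) (h (chk (sc n)))"
  by (auto simp: is_succ_def NN_chk)

lemma is_inductive_NN: "is_inductive NN (h (chk om))"
  unfolding is_inductive_def NN_chk using is_empty_NN is_succ_NN zero_om sc_om by blast

lemma NN_pairing: "\<exists>z. is_upair NN x y z"
proof -
  obtain u v where uv: "x = h u" "y = h v" using obtain_name by metis
  obtain c where c: "\<And>b. b \<epsilon> upr u v \<Longrightarrow> NN (h b) c" using NN_cover by blast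
  obtain b where "\<And>z. NN z b \<longleftrightarrow> NN z c \<and> sat NN (z ## x ## (\<lambda>_. y)) (0 \<^bold>= 1 \<^bold>\<or> 0 \<^bold>= 2)"
    using NN_sep by blast
  then have "is_upair NN x y b" using c[of u] c[of v] uv by (auto simp: is_upair_def)
  then show ?thesis ..
qed

lemma NN_union: "\<exists>u. \<forall>z. NN z u \<longleftrightarrow> (\<exists>y. NN y x \<and> NN z y)"
proof -
  obtain a where a: "x = h a" by (rule obtain_name)
  obtain W where W: "closedW W" "a \<epsilon> W" using ex_closedW by blast
  obtain c where c: "\<And>b. b \<epsilon> W \<Longrightarrow> NN (h b) c" using NN_cover by blast
  obtain b where b: "\<And>z. NN z b \<longleftrightarrow> NN z c \<and> sat NN (z ## (\<lambda>_. x)) (BEx 1 (1 \<^bold>\<in> 0))"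
    using NN_sep by blast
  have "NN z c" if z: "NN y x" "NN z y" for y z
  proof -
    from z(1) obtain y1 where "y1 \<epsilon> W" "y = h y1" using closedW_mem[OF W] a by blast
    with z(2) obtain z1 where "z1 \<epsilon> W" "z = h z1" using closedW_mem[OF W(1)] by blast
    then show ?thesis using c by blast
  qed
  then show ?thesis using b by (intro exI[of _ b]) auto
qed

lemma NN_pow: "\<exists>p. \<forall>z. NN z p \<longleftrightarrow> is_sub NN z x"
proof -
  obtain a where a: "x = h a" by (rule obtain_name)
  obtain W where W: "closedW W" "a \<epsilon> W" using ex_closedW by blast
  \<comment> \<open>By \<open>sep_name\<close>, every subset of \<open>x\<close> has a name with
    first component \<open>zero\<close> and entries from \<open>prd W PP\<close>; these names form a
    set.\<close>
  let ?V = "prd (upr zero zero) (prd (pow II) (pow (prd W PP)))"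
  obtain c where c: "\<And>b. b \<epsilon> ?V \<Longrightarrow> NN (h b) c" using NN_cover by blast
  obtain b where b: "\<And>z. NN z b \<longleftrightarrow> NN z c \<and> sat NN (z ## (\<lambda>_. x)) (sub_fm 0 1)"
    using NN_sep by blast
  have "NN z c" if z: "is_sub NN z x" for z
  proof -
    obtain v where v: "z = h v" by (rule obtain_name)
    obtain S X where SX: "small S" "sub X (prd W PP)"
      "\<And>y. NN y (h (pr zero (pr S X))) \<longleftrightarrow> NN y (h a) \<and> sat NN (y ## (\<lambda>n. h v)) (0 \<^bold>\<in> 1)"
      using sep_name[OF W, of "\<lambda>_. v" "0 \<^bold>\<in> 1"] by blast
    have "z = h (pr zero (pr S X))"
      by (rule NN_ext) (use SX(3) z v a in \<open>auto simp: is_sub_def\<close>)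
    moreover have "pr zero (pr S X) \<epsilon> ?V" using SX(1,2) by (simp add: small_def)
    ultimately show ?thesis using c by simp
  qed
  then show ?thesis using b by (intro exI[of _ b]) auto
qed

lemma NN_replacement: "sat NN e0 (Replacement \<phi>)"
  unfolding sat_Replacement
proof (intro allI impI)
  fix e a assume fn: "\<forall>x. NN x a \<longrightarrow> (\<forall>y y'. sat NN (x ## y ## a ## e) \<phi> \<and> sat NN (x ## y' ## a ## e) \<phi> \<longrightarrow> y = y')"
  obtain u where u: "a = h u" by (rule obtain_name)
  obtain e1 where e1: "e = (\<lambda>n. h (e1 n))" by (rule obtain_env)
  obtain W where W: "closedW W" "u \<epsilon> W" using ex_closedW by blast
  have sf: "sat NN (h x ## h y ## a ## e) \<phi> \<longleftrightarrow> (\<exists>p\<in>G. frc p (x ## y ## u ## e1) \<phi>)" for x y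
    using NN_sat[of "x ## y ## u ## e1" \<phi>] by (simp add: h_scons u e1)
  have "dfn (\<lambda>e. frc (sn (e 0)) (fs (e 0) ## e 1 ## (u ## e1)) \<phi>)" by (intro dfI)
  \<comment> \<open>Collection in the ground model runs over pairs of a name and a condition, since
    different conditions may force different values.\<close>
  from collection[where K = "\<lambda>z y. frc (sn z) (fs z ## y ## u ## e1) \<phi>", OF this, of "prd W PP"]
  obtain Y where Y: "\<And>z y. z \<epsilon> prd W PP \<Longrightarrow> frc (sn z) (fs z ## y ## u ## e1) \<phi> \<Longrightarrow>
      \<exists>y. y \<epsilon> Y \<and> frc (sn z) (fs z ## y ## u ## e1) \<phi>" by blast
  obtain c where c: "\<And>b. b \<epsilon> Y \<Longrightarrow> NN (h b) c" using NN_cover by blast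
  obtain b where b: "\<And>z. NN z b \<longleftrightarrow> NN z c \<and> sat NN (z ## a ## e) (BEx 1 \<phi>)"
    using NN_sep by blast
  have "NN y c" if y: "NN x a" "sat NN (x ## y ## a ## e) \<phi>" for x y
  proof -
    from y(1) obtain x1 where x1: "x1 \<epsilon> W" "x = h x1" using closedW_mem[OF W] u by blast
    obtain y1 where y1: "y = h y1" by (rule obtain_name)
    obtain p where p: "p \<in> G" "frc p (x1 ## y1 ## u ## e1) \<phi>" using y(2) sf x1 y1 by blast
    then have "\<exists>y. y \<epsilon> Y \<and> frc p (x1 ## y ## u ## e1) \<phi>"
      using Y[of "pr x1 p" y1] x1 G_PP by simp
    then obtain y2 where y2: "y2 \<epsilon> Y" "frc p (x1 ## y2 ## u ## e1) \<phi>" by blast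
    then have "sat NN (x ## h y2 ## a ## e) \<phi>" using sf p(1) x1 by blast
    then have "y = h y2" using fn y by blast
    then show ?thesis using c y2 by blast
  qed
  then show "\<exists>b. \<forall>y. NN y b \<longleftrightarrow> (\<exists>x. NN x a \<and> sat NN (x ## y ## a ## e) \<phi>)"
    using b by (intro exI[of _ b]) auto
qed

sublocale N: zf_model NN
proof
  fix q e assume "q \<in> ZF"
  then consider "q = Extensionality_Ax" | "q = Foundation_Ax" | "q = Pairing_Ax" | "q = Union_Ax"
    | "q = Powerset_Ax" | "q = Infinity_Ax" | \<phi> where "q = Separation \<phi>" | \<phi> where "q = Replacement \<phi>"
    by (auto simp: ZF_def)
  then show "sat NN e q"
  proof cases
    case 1
    then show ?thesis using NN_ext by (auto simp: sat_Extensionality)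
  next
    case 2
    then show ?thesis using NN_foundation by (auto simp: sat_Foundation)
  next
    case 3
    then show ?thesis using NN_pairing by (simp add: sat_Pairing)
  next
    case 4
    then show ?thesis using NN_union by (simp add: sat_Union)
  next
    case 5
    then show ?thesis using NN_pow by (simp add: sat_Powerset)
  next
    case 6
    then show ?thesis using is_inductive_NN by (auto simp: sat_Infinity)
  next
    case 7
    then show ?thesis using NN_sep by (simp add: sat_Separation)
  next
    case 8
    then show ?thesis by (simp add: NN_replacement)
  qed
qed

section \<open>\<omega> and ordered pairs in the extension\<close>

lemma N_zero: "N.zero = h (chk zero)" using is_empty_NN N.is_empty_iff by simp
lemma N_sc: "N.sc (h (chk n)) = h (chk (sc n))" using is_succ_NN N.is_succ_iff by simp

text \<open>Numerals of the model may be nonstandard, so induction on HOL numbers is of no use.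
  Instead, Foundation in the extension yields a minimal numeral outside \<open>N.om\<close>, and its
  predecessor gives the contradiction.\<close>

lemma N_om: "N.om = h (chk om)"
proof (rule NN_ext)
  fix z
  have ind: "N.ind (h (chk om))" using is_inductive_NN N.is_inductive_iff by simp
  show "NN z N.om \<longleftrightarrow> NN z (h (chk om))"
  proof
    assume "NN z (h (chk om))"
    let ?d = "N.sep (h (chk om)) (\<lambda>z. \<not> NN z N.om)"
    have d: "NN z ?d \<longleftrightarrow> NN z (h (chk om)) \<and> \<not> NN z N.om" for z
      by (rule N.sep_iff) (intro dfI)
    show "NN z N.om"
    proof (rule ccontr)
      assume "\<not> NN z N.om"
      then have "NN z ?d" using d \<open>NN z (h (chk om))\<close> by blast
      from N.foundation[OF this] obtain y where y: "NN y ?d" "\<And>z. NN z y \<Longrightarrow> \<not> NN z ?d" by blast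
      then obtain n where n: "n \<epsilon> om" "y = h (chk n)" "\<not> NN y N.om" unfolding d NN_chk by blast
      have "n \<noteq> zero" using n N_zero N.zero_om by auto
      then obtain m where m: "m \<epsilon> om" "n = sc m" using om_cases n by blast
      have "NN (h (chk m)) y" using n m by (simp add: NN_chk h_chk)
      then have "\<not> NN (h (chk m)) ?d" using y(2) by blast
      then have "NN (h (chk m)) N.om" unfolding d using m by (auto simp: NN_chk)
      then have "NN (h (chk n)) N.om" using N_sc m N.sc_om by metis
      then show False using n by blast
    qed
  qed (use ind N.om_iff in blast)
qed

definition dn where "dn u v = smpl (cup (sup u) (sup v)) (upr u v)"
definition op where "op u v = dn (dn u u) (dn u v)"

lemma tm_op [dfI]: "tm s \<Longrightarrow> tm t \<Longrightarrow> tm (\<lambda>e. op (s e) (t e))"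
  by (rule tm_f2, unfold op_def dn_def, intro dfI)

lemma h_dn: "h (dn u v) = N.upr (h u) (h v)"
  by (rule NN_ext, unfold dn_def, subst NN_smpl_sup) (auto simp: sub_def)

lemma h_op: "h (op u v) = N.pr (h u) (h v)"
  by (simp add: op_def h_dn N.pr_def)

lemma sup_op: "z \<epsilon> sup (op u v) \<longleftrightarrow> z \<epsilon> sup u \<or> z \<epsilon> sup v"
  by (auto simp: op_def dn_def)

lemma N_pr_chk: "h (chk (pr x y)) = N.pr (h (chk x)) (h (chk y))"
proof -
  have "h (chk (upr x y)) = N.upr (h (chk x)) (h (chk y))" for x y
    by (rule NN_ext) (auto simp: NN_chk)
  then show ?thesis by (simp add: pr_def N.pr_def)
qed

section \<open>Dependent choice in the extension\<close>

text \<open>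
  Below any condition forcing totality, dependent choice in the ground model gives a descending
  sequence of conditions with witnessing names; a lower bound of it lies in \<open>G\<close> by genericity.
\<close>

lemma dc_sequence:
  assumes ne: "NN x0 (h a)"
    and tot: "\<And>x. NN x (h a) \<Longrightarrow> \<exists>y. NN y (h a) \<and> NN (N.pr x y) (h r)"
  shows "\<exists>u. tm (\<lambda>e. u (e 0)) \<and> (\<forall>n. n \<epsilon> om \<longrightarrow> NN (h (u n)) (h a) \<and> NN (N.pr (h (u n)) (h (u (sc n)))) (h r))"
proof -
  obtain W where W: "closedW W" "a \<epsilon> W" using ex_closedW by blast
  define e1 where "e1 = (a ## r ## (\<lambda>_::nat. a))"
  let ?\<psi> = "BAll 0 (BEx 1 (pair_in_fm 1 0 3))"
  have "sat NN (\<lambda>n. h (e1 n)) ?\<psi>"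
    using tot by (auto simp: e1_def N.pair_in_iff numeral_eq_Suc)
  then obtain p1 where p1: "p1 \<in> G" "frc p1 e1 ?\<psi>" unfolding NN_sat by blast
  obtain u0 where u0: "u0 \<epsilon> W" "x0 = h u0" using closedW_mem[OF W ne] by blast
  then obtain p2 where p2: "p2 \<in> G" "fmem p2 u0 a" using ne NN_fmem by blast
  obtain p0 where p0: "p0 \<in> G" "le p0 p1" "le p0 p2" using G_dir p1 p2 by blast
  let ?P = "pair_in_fm 1 0 3"
  define R where "R z z' \<longleftrightarrow> le (fs z') (fs z) \<and> frc (fs z') (sn z' ## sn z ## e1) ?P" for z z'
  have dR: "dfn (\<lambda>e. R (e 0) (e 1))" unfolding R_def by (intro dfI)
  define W0 where "W0 = sep (prd PP W) (\<lambda>z. le (fs z) p0 \<and> fmem (fs z) (sn z) a)"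
  have W0: "z \<epsilon> W0 \<longleftrightarrow> z \<epsilon> prd PP W \<and> le (fs z) p0 \<and> fmem (fs z) (sn z) a" for z
    unfolding W0_def by (rule sep_iff) (intro dfI)
  have ex: "\<exists>z'. z' \<epsilon> W0 \<and> R z z'" if z: "z \<epsilon> W0" for z
  proof -
    obtain p u where pu: "z = pr p u" "p \<epsilon> PP" "u \<epsilon> W" "le p p0" "fmem p u a" using z unfolding W0 prd_iff by auto
    have "le p p1" using pu p0 le_trans by blast
    moreover have "frc p1 (u ## e1) (0 \<^bold>\<in> 1 \<^bold>\<longrightarrow> BEx 1 ?P)" using p1(2) by (simp add: BAll_def)
    ultimately have "frc p (u ## e1) (BEx 1 ?P)" using pu(5) by (auto simp: e1_def)
    from frc_ExiD[OF this[unfolded BEx_def] pu(2)]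
    obtain q y where q: "le q p" "frc q (y ## u ## e1) (0 \<^bold>\<in> Suc 1 \<^bold>\<and> ?P)" by blast
    have qP: "q \<epsilon> PP" using q le_PP by blast
    from frc_ConD[OF q(2) qP] have "fmem q y a" "frc q (y ## u ## e1) ?P"
      by (simp_all add: e1_def)
    \<comment> \<open>The witness \<open>y\<close> is replaced by an entry \<open>b\<close> of the
      name \<open>a\<close>, which stays in the set \<open>W\<close> from which the ground model
      chooses.\<close>
    moreover from this obtain q2 b s where q2: "le q2 q" "T a b s" "le q2 s" "Eq q2 y b"
      unfolding fmem_def hits_def using le_refl[OF qP] by blast
    ultimately have 1: "fmem q2 y a" "frc q2 (y ## u ## e1) ?P"
      using frc_mono le_trans le_PP unfolding fmem_def by blast+
    have q2P: "q2 \<epsilon> PP" using q2 le_PP by blast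
    have "b \<epsilon> W" using W q2 unfolding closedW_def by blast
    moreover have "fmem q2 b a" using fmem_cong[OF 1(1) q2(4) Eq_refl[OF q2P]] .
    moreover have "frc q2 (b ## u ## e1) ?P"
      by (rule frc_cong[OF 1(2)]) (use q2 q2P in \<open>auto split: nat.split intro: Eq_refl\<close>)
    moreover have "le q2 p" "le q2 p0" using q2 q pu le_trans by blast+
    ultimately show ?thesis using pu q2P
      by (intro exI[of _ "pr q2 b"]) (simp add: W0 R_def)
  qed
  \<comment> \<open>The filter yields only \<open>q\<close> together with some ground set
    \<open>g\<close>, so \<open>g\<close> must code the whole sequence. The uniqueness clause lets
    the sequence be read back from \<open>g\<close> as a term, and \<open>le q (fs z)\<close> puts
    all its conditions into the filter.\<close>
  let ?C = "\<lambda>q g n z. pr n z \<epsilon> g \<and> z \<epsilon> W0 \<and> le q (fs z) \<and> (\<forall>z'. pr n z' \<epsilon> g \<longrightarrow> z' = z) \<and>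
      (\<exists>z'. pr (sc n) z' \<epsilon> g \<and> R z z')"
  have "\<exists>q\<in>G. le q p0 \<and> (\<exists>g. \<forall>n. n \<epsilon> om \<longrightarrow> (\<exists>z. ?C q g n z))"
  proof (rule G_dense_below[OF _ p0(1)])
    show "dfn (\<lambda>e. \<exists>g. \<forall>n. n \<epsilon> om \<longrightarrow> (\<exists>z. ?C (e 0) g n z))" by (intro dfI dfn_P2[OF dR])
    fix q assume q: "le q p0"
    have "fmem q u0 a" using p2(2) q p0(3) le_trans le_PP unfolding fmem_def by blast
    then have "pr q u0 \<epsilon> W0" using q u0 le_PP by (simp add: W0)
    from dependent_choice[OF dR this ex] obtain s where s: "tm (\<lambda>e. s (e 0))" "s zero = pr q u0"
      "\<And>n. n \<epsilon> om \<Longrightarrow> s n \<epsilon> W0 \<and> R (s n) (s (sc n))" by blast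
    have tm_s: "tm (\<lambda>e. fs (s (e 0)))" by (intro dfI s(1))
    have "\<exists>q. \<forall>n. n \<epsilon> om \<longrightarrow> le q (fs (s n))"
      by (rule lower_bound[OF tm_s]) (use s(3) in \<open>simp add: R_def\<close>)
    then obtain q' where q': "\<And>n. n \<epsilon> om \<Longrightarrow> le q' (fs (s n))" by blast
    let ?g = "img (\<lambda>n. pr n (s n)) om"
    have g: "z \<epsilon> ?g \<longleftrightarrow> (\<exists>n. n \<epsilon> om \<and> z = pr n (s n))" for z
      by (rule img_iff) (intro dfI s(1))
    have C: "?C q' ?g n (s n)" if n: "n \<epsilon> om" for n
      using n s(3)[OF n] q' sc_om by (auto simp: g)
    have "\<exists>g. \<forall>n. n \<epsilon> om \<longrightarrow> (\<exists>z. ?C q' g n z)"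
    proof (rule exI[of _ ?g], intro allI impI)
      fix n assume "n \<epsilon> om"
      then show "\<exists>z. ?C q' ?g n z" by (intro exI[of _ "s n"]) (rule C)
    qed
    moreover have "le q' q" using q'[OF zero_om] s(2) by simp
    ultimately show "\<exists>r. le r q \<and> (\<exists>g. \<forall>n. n \<epsilon> om \<longrightarrow> (\<exists>z. ?C r g n z))" by blast
  qed
  then obtain q g where q: "q \<in> G" "\<And>n. n \<epsilon> om \<Longrightarrow> \<exists>z. ?C q g n z" by blast
  define s where "s n = coll (\<lambda>x. \<exists>z. pr n z \<epsilon> g \<and> x \<epsilon> z)" for n
  have tm_s: "tm (\<lambda>e. s (e 0))" unfolding s_def by (intro dfI)
  have s: "pr n (s n) \<epsilon> g \<and> s n \<epsilon> W0 \<and> le q (fs (s n)) \<and> R (s n) (s (sc n))" if n: "n \<epsilon> om" for n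
  proof -
    have eq: "s n = z" if "?C q g n z" for n z
      unfolding s_def by (rule coll_eq) (use that in blast)
    obtain z where z: "?C q g n z" using q(2)[OF n] by blast
    then obtain z' where z': "pr (sc n) z' \<epsilon> g" "R z z'" by blast
    obtain z2 where z2: "?C q g (sc n) z2" using q(2) n sc_om by blast
    then have "z' = z2" using z' by blast
    then show ?thesis using eq[OF z] eq[OF z2] z z' by simp
  qed
  have "NN (h (sn (s n))) (h a) \<and> NN (N.pr (h (sn (s n))) (h (sn (s (sc n))))) (h r)" if n: "n \<epsilon> om" for n
  proof -
    have "fmem (fs (s n)) (sn (s n)) a" using s[OF n] by (simp add: W0)
    moreover have "fs (s n) \<in> G" "fs (s (sc n)) \<in> G"
      using s[OF n] s[OF sc_om[OF n]] q(1) G_up by blast+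
    moreover have "frc (fs (s (sc n))) (sn (s (sc n)) ## sn (s n) ## e1) ?P"
      using s[OF n] by (simp add: R_def)
    ultimately have "NN (h (sn (s n))) (h a)"
      "sat NN (\<lambda>k. h ((sn (s (sc n)) ## sn (s n) ## e1) k)) ?P"
      using NN_fmem NN_sat by blast+
    then show ?thesis by (simp add: N.pair_in_iff e1_def numeral_eq_Suc)
  qed
  moreover have "tm (\<lambda>e. sn (s (e 0)))" by (intro dfI tm_s)
  ultimately show ?thesis by (intro exI[of _ "\<lambda>n. sn (s n)"]) simp
qed

text \<open>The sequence of names is definable in the ground model, so the union of its supports is
  countable there and one symmetric name can collect all the ordered pairs.\<close>

theorem NN_DC: "sat NN e DC"
  unfolding sat_DC N.is_omega_iff N.pair_in_iff N.is_succ_iff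
proof (intro allI impI)
  fix a' r' assume *: "(\<exists>x. NN x a') \<and> (\<forall>x. NN x a' \<longrightarrow> (\<exists>y. NN y a' \<and> NN (N.pr x y) r'))"
  obtain a r where ar: "a' = h a" "r' = h r" using obtain_name by metis
  from * obtain x0 where "NN x0 (h a)" unfolding ar by blast
  from dc_sequence[OF this, of r] * obtain u where u: "tm (\<lambda>e. u (e 0))"
    "\<And>n. n \<epsilon> om \<Longrightarrow> NN (h (u n)) (h a) \<and> NN (N.pr (h (u n)) (h (u (sc n)))) (h r)" unfolding ar by blast
  let ?sup = "\<lambda>n. sup (u n)"
  have tsup: "tm (\<lambda>e. ?sup (e 0))" by (intro dfI u(1))
  define S where "S = uni (img ?sup om)"
  have Siff: "z \<epsilon> S \<longleftrightarrow> (\<exists>n. n \<epsilon> om \<and> z \<epsilon> sup (u n))" for z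
    unfolding S_def uni_iff img_iff[OF tsup] by blast
  have "cnt S" unfolding S_def by (rule cnt_UN[OF tsup]) (use small_sup small_def in blast)
  moreover have "sub S II" unfolding sub_def Siff using small_sup unfolding small_def sub_def by blast
  ultimately have S: "small S" by (simp add: small_def)
  let ?F = "\<lambda>n. op (chk n) (u n)"
  define X where "X = img ?F om"
  have tF: "tm (\<lambda>e. ?F (e 0))" by (intro dfI u(1))
  have X: "z \<epsilon> X \<longleftrightarrow> (\<exists>n. n \<epsilon> om \<and> z = op (chk n) (u n))" for z
    unfolding X_def by (rule img_iff[OF tF])
  have f: "NN z (h (smpl S X)) \<longleftrightarrow> (\<exists>n. n \<epsilon> om \<and> z = N.pr (h (chk n)) (h (u n)))" for z
  proof -
    have "NN z (h (smpl S X)) \<longleftrightarrow> (\<exists>v. v \<epsilon> X \<and> z = h v)"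
      by (rule NN_smpl_sup[OF S]) (auto simp: X sub_def sup_op Siff)
    then show ?thesis by (auto simp: X h_op)
  qed
  have f': "NN (N.pr x y) (h (smpl S X)) \<longleftrightarrow> (\<exists>n. n \<epsilon> om \<and> x = h (chk n) \<and> y = h (u n))" for x y
    by (auto simp: f)
  have "is_func NN (h (smpl S X)) N.om (h a)"
    unfolding is_func_def is_rel_def N.is_opair_iff N.pair_in_iff N_om NN_chk
    using u(2) f f' h_chk by metis
  moreover have "NN (N.pr x y) (h r)"
    if "NN n N.om" "NN (N.pr n x) (h (smpl S X))" "NN (N.pr (N.sc n) y) (h (smpl S X))" for n x y
    using that u(2) unfolding f' by (auto simp: N_sc h_chk)
  ultimately show "\<exists>w f. w = N.om \<and> is_func NN f w a' \<and> (\<forall>n m. NN n w \<longrightarrow> NN m w \<longrightarrow> m = N.sc n \<longrightarrow>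
      (\<forall>x y. NN x a' \<longrightarrow> NN y a' \<longrightarrow> NN (N.pr n x) f \<and> NN (N.pr m y) f \<longrightarrow> NN (N.pr x y) r'))"
    unfolding ar by blast
qed

end

section \<open>A family of sets without uncountable partial choice functions\<close>

text \<open>All that the two notions of forcing require, stated for an arbitrary model so that they
  can be built without reference to names. In the last clause \<open>A\<close> is a partial
  selector.\<close>

definition (in zf_model) fam where
  "fam BB \<longleftrightarrow> (\<forall>B. B \<epsilon> BB \<longrightarrow> (\<exists>x. x \<epsilon> B)) \<and>
     (\<forall>B B' x. B \<epsilon> BB \<longrightarrow> B' \<epsilon> BB \<longrightarrow> x \<epsilon> B \<longrightarrow> x \<epsilon> B' \<longrightarrow> B = B') \<and>
     (\<forall>A. (\<forall>x. x \<epsilon> A \<longrightarrow> (\<exists>B. B \<epsilon> BB \<and> x \<epsilon> B)) \<longrightarrow>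
        (\<forall>B x y. B \<epsilon> BB \<longrightarrow> x \<epsilon> B \<longrightarrow> y \<epsilon> B \<longrightarrow> x \<epsilon> A \<longrightarrow> y \<epsilon> A \<longrightarrow> x = y) \<longrightarrow>
        cnt A \<and> (\<exists>B. B \<epsilon> BB \<and> (\<forall>x. x \<epsilon> B \<longrightarrow> \<not> x \<epsilon> A)))"

context flip_ext
begin

text \<open>
  \<open>xn \<alpha>\<close> names row \<open>\<alpha>\<close> of the generic set together with the tag \<open>(\<alpha>,II)\<close>, which makes the
  classes \<open>Bn \<alpha>\<close> disjoint. \<open>Bn \<alpha>\<close> collects all translates of the row by sets of the ground model.
\<close>

definition Xs where
  "Xs \<alpha> = sep (prd (img chk (cup Z (upr (pr \<alpha> II) (pr \<alpha> II)))) PP)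
     (\<lambda>w. \<exists>z p. w = pr (chk z) p \<and> (z = pr \<alpha> II \<or> (\<exists>j. z = pr \<alpha> j \<and> z \<epsilon> fs p \<and> z \<epsilon> sn p)))"
definition xn where "xn \<alpha> = pr zero (pr (upr \<alpha> \<alpha>) (Xs \<alpha>))"
definition Bn where "Bn \<alpha> = smpl zero (img (\<lambda>F. act F (xn \<alpha>)) gr)"
definition BB where "BB = smpl zero (img Bn II)"

lemma tm_xn [dfI]: "tm s \<Longrightarrow> tm (\<lambda>e. xn (s e))"
  by (rule tm_f1, unfold xn_def Xs_def, intro dfI)
lemma tm_Bn [dfI]: "tm s \<Longrightarrow> tm (\<lambda>e. Bn (s e))"
  by (rule tm_f1, unfold Bn_def, intro dfI)

lemma Xs_iff: "pr w p \<epsilon> Xs \<alpha> \<longleftrightarrow> p \<epsilon> PP \<and>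
    (\<exists>z. w = chk z \<and> (z = pr \<alpha> II \<or> (\<exists>j. z = pr \<alpha> j \<and> z \<epsilon> fs p \<and> z \<epsilon> sn p)))"
proof -
  have 1: "x \<epsilon> img chk a \<longleftrightarrow> (\<exists>y. y \<epsilon> a \<and> x = chk y)" for x a
    by (rule img_iff) (intro dfI)
  have 2: "x \<epsilon> Xs \<alpha> \<longleftrightarrow> x \<epsilon> prd (img chk (cup Z (upr (pr \<alpha> II) (pr \<alpha> II)))) PP \<and>
     (\<exists>z p. x = pr (chk z) p \<and> (z = pr \<alpha> II \<or> (\<exists>j. z = pr \<alpha> j \<and> z \<epsilon> fs p \<and> z \<epsilon> sn p)))" for x
    unfolding Xs_def by (rule sep_iff) (intro dfI)
  have 3: "z \<epsilon> Z" if "p \<epsilon> PP" "z \<epsilon> fs p" for z p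
    using that by (auto simp: PP_iff gr_iff sub_def)
  show ?thesis unfolding 2 pr_prd 1 using 3 by auto
qed

lemma small_sng: "\<alpha> \<epsilon> II \<Longrightarrow> small (upr \<alpha> \<alpha>)"
  by (simp add: small_def sub_def cnt_upr)

lemma act_xn: "\<alpha> \<epsilon> II \<Longrightarrow> act F (xn \<alpha>) = pr F (pr (upr \<alpha> \<alpha>) (Xs \<alpha>))"
  by (simp add: xn_def act_pr small_sng)

text \<open>Apart from the tag this is row \<alpha> of the generic set flipped by \<open>F\<close>:
  position \<open>j\<close> is present iff the generic bit differs from that of
  \<open>F\<close>.\<close>

lemma NN_xn:
  assumes \<alpha>: "\<alpha> \<epsilon> II" and F: "F \<epsilon> gr"
  shows "NN x (h (act F (xn \<alpha>))) \<longleftrightarrow> x = h (chk (pr \<alpha> II)) \<or>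
    (\<exists>j. x = h (chk (pr \<alpha> j)) \<and> (\<exists>q\<in>G. pr \<alpha> j \<epsilon> fs q \<and> (pr \<alpha> j \<epsilon> sn q) \<noteq> (pr \<alpha> j \<epsilon> F)))"
    (is "_ \<longleftrightarrow> ?R")
proof
  assume "NN x (h (act F (xn \<alpha>)))"
  then obtain b s where b: "s \<in> G" "T (act F (xn \<alpha>)) b s" "x = h b" by (auto simp: NN_mem)
  from b(2)[unfolded act_xn[OF \<alpha>] T_pr[OF F small_sng[OF \<alpha>]] Xs_iff]
  obtain K z q where *: "K \<epsilon> gr" "off K (upr \<alpha> \<alpha>)" "q \<epsilon> PP" "b = chk z" "s = ap (sd F K) q"
    "z = pr \<alpha> II \<or> (\<exists>j. z = pr \<alpha> j \<and> z \<epsilon> fs q \<and> z \<epsilon> sn q)" by auto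
  from *(6) show ?R
  proof
    assume "z = pr \<alpha> II"
    then show ?R using b(3) * by simp
  next
    assume "\<exists>j. z = pr \<alpha> j \<and> z \<epsilon> fs q \<and> z \<epsilon> sn q"
    then obtain j where j: "z = pr \<alpha> j" "z \<epsilon> fs q" "z \<epsilon> sn q" by blast
    \<comment> \<open>The row \<alpha> is the support of the name, so the flips \<open>K\<close>
      that generate its orbit leave this bit alone.\<close>
    have "\<not> pr \<alpha> j \<epsilon> K" using *(2) by (auto simp: off_def)
    then have "pr \<alpha> j \<epsilon> fs s" "(pr \<alpha> j \<epsilon> sn s) \<noteq> (pr \<alpha> j \<epsilon> F)" using * j by auto
    moreover have "x = h (chk (pr \<alpha> j))" using b(3) * j by simp
    ultimately show ?R using b(1) by blast
  qed
next
  assume ?R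
  then have "\<exists>z q. q \<in> G \<and> x = h (chk z) \<and> pr (chk z) (ap F q) \<epsilon> Xs \<alpha>"
  proof
    assume "x = h (chk (pr \<alpha> II))"
    then show ?thesis using one_G F
      by (intro exI[of _ "pr \<alpha> II"] exI[of _ one]) (auto simp: Xs_iff)
  next
    assume "\<exists>j. x = h (chk (pr \<alpha> j)) \<and> (\<exists>q\<in>G. pr \<alpha> j \<epsilon> fs q \<and> (pr \<alpha> j \<epsilon> sn q) \<noteq> (pr \<alpha> j \<epsilon> F))"
    then obtain j q where "x = h (chk (pr \<alpha> j))" "q \<in> G" "pr \<alpha> j \<epsilon> fs q" "(pr \<alpha> j \<epsilon> sn q) \<noteq> (pr \<alpha> j \<epsilon> F)"
      by blast
    then show ?thesis using F G_PP[of q]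
      by (intro exI[of _ "pr \<alpha> j"] exI[of _ q]) (auto simp: Xs_iff)
  qed
  then obtain z q where q: "q \<in> G" "x = h (chk z)" "pr (chk z) (ap F q) \<epsilon> Xs \<alpha>" by blast
  have "T (act F (xn \<alpha>)) (chk z) q"
    unfolding act_xn[OF \<alpha>] T_pr[OF F small_sng[OF \<alpha>]]
    by (intro exI[of _ zero] exI[of _ "chk z"] exI[of _ "ap F q"]) (use q F G_PP in simp)
  then show "NN x (h (act F (xn \<alpha>)))" using q NN_mem by blast
qed

lemma NN_Bn:
  assumes \<alpha>: "\<alpha> \<epsilon> II"
  shows "NN x (h (Bn \<alpha>)) \<longleftrightarrow> (\<exists>F. F \<epsilon> gr \<and> x = h (act F (xn \<alpha>)))"
proof -
  let ?X = "img (\<lambda>F. act F (xn \<alpha>)) gr"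
  have X: "y \<epsilon> ?X \<longleftrightarrow> (\<exists>F. F \<epsilon> gr \<and> y = act F (xn \<alpha>))" for y
    by (rule img_iff) (intro dfI)
  have "NN x (h (smpl zero ?X)) \<longleftrightarrow> (\<exists>v. v \<epsilon> ?X \<and> x = h v)"
    by (rule NN_smpl[OF small_zero]) (metis X act_act sd_gr)
  then show ?thesis unfolding Bn_def X by blast
qed

lemma NN_BB: "NN x (h BB) \<longleftrightarrow> (\<exists>\<alpha>. \<alpha> \<epsilon> II \<and> x = h (Bn \<alpha>))"
proof -
  let ?X = "img Bn II"
  have X: "y \<epsilon> ?X \<longleftrightarrow> (\<exists>\<alpha>. \<alpha> \<epsilon> II \<and> y = Bn \<alpha>)" for y
    by (rule img_iff) (intro dfI)
  have "h (act K (Bn \<alpha>)) = h (Bn \<alpha>)" if "K \<epsilon> gr" for K \<alpha>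
    by (rule h_off[OF that]) (simp add: Bn_def)
  then have "NN x (h (smpl zero ?X)) \<longleftrightarrow> (\<exists>v. v \<epsilon> ?X \<and> x = h v)"
    by (intro NN_smpl[OF small_zero]) (metis X)
  then show ?thesis unfolding BB_def X by blast
qed

lemma Bn_tag:
  assumes "\<alpha> \<epsilon> II" "\<beta> \<epsilon> II" "NN x (h (Bn \<alpha>))"
  shows "NN (h (chk (pr \<beta> II))) x \<longleftrightarrow> \<alpha> = \<beta>"
proof -
  from assms(3) obtain F where F: "F \<epsilon> gr" "x = h (act F (xn \<alpha>))" using NN_Bn[OF assms(1)] by blast
  \<comment> \<open>Second coordinates of bit positions are elements of \<open>II\<close>, so the
    tag cannot be confused with a position.\<close>
  have "\<not> II \<epsilon> II" by (rule irrefl)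
  moreover have "pr \<alpha> j \<epsilon> fs q \<Longrightarrow> q \<in> G \<Longrightarrow> j \<epsilon> II" for j q
    using G_PP[of q] by (auto simp: PP_iff gr_iff sub_def Z_def)
  ultimately show ?thesis unfolding F(2) NN_xn[OF assms(1) F(1)] h_chk by auto
qed

text \<open>A row has as many bits as \<open>pow om\<close> has elements, while the domain of a
  condition is countable.\<close>

lemma undecided:
  assumes "\<alpha> \<epsilon> II" "p \<epsilon> PP"
  shows "\<exists>j. j \<epsilon> II \<and> \<not> pr \<alpha> j \<epsilon> fs p"
proof (rule ccontr)
  assume *: "\<not> ?thesis"
  have sn: "tm (\<lambda>e. sn (e 0))" by (intro dfI)
  have "cnt (img sn (fs p))" by (rule cnt_img[OF sn]) (use assms(2) in \<open>auto simp: PP_iff\<close>)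
  moreover have "sub II (img sn (fs p))" using * unfolding sub_def img_iff[OF sn] by (metis sn_pr)
  ultimately have "cnt II" by (rule cnt_sub)
  then show False using not_cnt_pow_om by (simp add: II_def)
qed

lemma decided:
  assumes "\<alpha> \<epsilon> II" "j \<epsilon> II"
  shows "\<exists>q\<in>G. pr \<alpha> j \<epsilon> fs q"
proof (rule G_dense)
  show "dfn (\<lambda>e. pr \<alpha> j \<epsilon> fs (e 0))" by (intro dfI)
  fix p assume p: "p \<epsilon> PP"
  let ?z = "pr \<alpha> j"
  have z: "?z \<epsilon> Z" using assms by (simp add: Z_def)
  from p obtain D A where DA: "p = pr D A" "D \<epsilon> gr" "A \<epsilon> gr" "cnt D" by (auto simp: PP_iff)
  have "pr (cup D (upr ?z ?z)) A \<epsilon> PP"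
    unfolding PP_iff using DA z cnt_cup[OF DA(4) cnt_upr] by (auto simp: gr_iff sub_def)
  then have "le (pr (cup D (upr ?z ?z)) A) p" using p DA by (simp add: le_def sub_def)
  then show "\<exists>q. le q p \<and> ?z \<epsilon> fs q" by (intro exI[of _ "pr (cup D (upr ?z ?z)) A"]) simp
qed

text \<open>
  A set with support \<open>S\<close> cannot select from \<open>Bn \<alpha>\<close> for \<open>\<alpha>\<close> outside \<open>S\<close>: flipping one undecided
  bit of row \<open>\<alpha>\<close> fixes the set but moves the selected element.
\<close>

lemma no_selection:
  assumes \<alpha>: "\<alpha> \<epsilon> II" "\<not> \<alpha> \<epsilon> sup A"
    and sel: "\<And>x y. NN x (h (Bn \<alpha>)) \<Longrightarrow> NN y (h (Bn \<alpha>)) \<Longrightarrow> NN x (h A) \<Longrightarrow> NN y (h A) \<Longrightarrow> x = y"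
  shows "NN x (h (Bn \<alpha>)) \<Longrightarrow> \<not> NN x (h A)"
proof
  assume xB: "NN x (h (Bn \<alpha>))" and xA: "NN x (h A)"
  from xB obtain F where F: "F \<epsilon> gr" "x = h (act F (xn \<alpha>))" using NN_Bn[OF \<alpha>(1)] by blast
  obtain p where p: "p \<in> G" "fmem p (act F (xn \<alpha>)) A" using xA NN_fmem F by blast
  obtain j where j: "j \<epsilon> II" "\<not> pr \<alpha> j \<epsilon> fs p" using undecided[OF \<alpha>(1) G_PP[OF p(1)]] by blast
  let ?H = "upr (pr \<alpha> j) (pr \<alpha> j)"
  have H: "?H \<epsilon> gr" using \<alpha> j by (auto simp: gr_iff sub_def Z_def)
  have "off ?H (sup A)" using \<alpha>(2) by (auto simp: off_def)
  then have HA: "h (act ?H A) = h A" using H by (intro h_off)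
  have pP: "p \<epsilon> PP" using p G_PP by blast
  \<comment> \<open>The bit lies outside the domain of \<open>p\<close>, so \<open>p\<close> extends
    its own translate, which therefore lies in \<open>G\<close>: one filter serves both the original
    and the flipped statement.\<close>
  have "le p (ap ?H p)" using pP H j(2) by (auto simp: le_def)
  then have "ap ?H p \<in> G" using p(1) G_up by blast
  moreover have "fmem (ap ?H p) (act ?H (act F (xn \<alpha>))) (act ?H A)" by (rule fmem_act[OF H p(2)])
  ultimately have "NN (h (act ?H (act F (xn \<alpha>)))) (h (act ?H A))" using NN_fmem by blast
  then have 1: "NN (h (act (sd ?H F) (xn \<alpha>))) (h A)" using HA F by simp
  have HF: "sd ?H F \<epsilon> gr" using H F by simp
  then have "NN (h (act (sd ?H F) (xn \<alpha>))) (h (Bn \<alpha>))" using NN_Bn[OF \<alpha>(1)] by blast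
  then have eq: "h (act (sd ?H F) (xn \<alpha>)) = h (act F (xn \<alpha>))" using sel 1 xB xA F by blast
  let ?z = "pr \<alpha> j"
  obtain q where q: "q \<in> G" "?z \<epsilon> fs q" using decided \<alpha> j by blast
  have jII: "j \<noteq> II" using j irrefl by blast
  \<comment> \<open>Position \<open>j\<close> belongs to the translate by \<open>L\<close> iff the
    generic bit there differs from that of \<open>L\<close>; the translates by \<open>F\<close> and
    by \<open>sd ?H F\<close> disagree at it.\<close>
  have "NN (h (chk ?z)) (h (act L (xn \<alpha>))) \<longleftrightarrow> (?z \<epsilon> sn q) \<noteq> (?z \<epsilon> L)" if L: "L \<epsilon> gr" for L
  proof -
    have same: "?z \<epsilon> sn r \<longleftrightarrow> ?z \<epsilon> sn q" if r: "r \<in> G" "?z \<epsilon> fs r" for r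
    proof -
      obtain s where "le s r" "le s q" using G_dir r(1) q(1) by blast
      then show ?thesis using r q by (auto simp: le_def)
    qed
    have "NN (h (chk ?z)) (h (act L (xn \<alpha>))) \<longleftrightarrow> (\<exists>r\<in>G. ?z \<epsilon> fs r \<and> (?z \<epsilon> sn r) \<noteq> (?z \<epsilon> L))"
      unfolding NN_xn[OF \<alpha>(1) L] h_chk pr_eq using jII by simp
    then show ?thesis using same q by blast
  qed
  from this[OF HF] this[OF F(1)] eq show False by auto
qed

theorem fam_BB: "N.fam (h BB)"
  unfolding N.fam_def
proof (intro conjI allI impI)
  fix B assume "NN B (h BB)"
  then obtain \<alpha> where \<alpha>: "\<alpha> \<epsilon> II" "B = h (Bn \<alpha>)" unfolding NN_BB by blast
  then have "NN (h (act zero (xn \<alpha>))) B" using NN_Bn zero_gr by blast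
  then show "\<exists>x. NN x B" ..
next
  fix B B' x assume "NN B (h BB)" "NN B' (h BB)" "NN x B" "NN x B'"
  then show "B = B'" unfolding NN_BB using Bn_tag by metis
next
  fix A'
  assume A1: "\<forall>x. NN x A' \<longrightarrow> (\<exists>B. NN B (h BB) \<and> NN x B)"
    and A2: "\<forall>B x y. NN B (h BB) \<longrightarrow> NN x B \<longrightarrow> NN y B \<longrightarrow> NN x A' \<longrightarrow> NN y A' \<longrightarrow> x = y"
  obtain A where A: "A' = h A" by (rule obtain_name)
  have cS: "cnt (sup A)" and SII: "sub (sup A) II" using small_sup[of A] by (auto simp: small_def)
  have ex: "\<exists>\<alpha>. \<alpha> \<epsilon> II \<and> NN x (h (Bn \<alpha>))" if "NN x A'" for x
  proof -
    from A1 that obtain B where "NN B (h BB)" "NN x B" by blast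
    then show ?thesis unfolding NN_BB by blast
  qed
  have sel: "x = y" if "\<alpha> \<epsilon> II" "NN x (h (Bn \<alpha>))" "NN y (h (Bn \<alpha>))" "NN x A'" "NN y A'" for x y \<alpha>
    using A2 that NN_BB by blast
  have none: "\<not> NN x A'" if "\<alpha> \<epsilon> II" "\<not> \<alpha> \<epsilon> sup A" "NN x (h (Bn \<alpha>))" for \<alpha> x
    using no_selection[OF that(1,2) _ that(3)] sel[OF that(1)] unfolding A by blast
  have "\<exists>\<alpha>. \<alpha> \<epsilon> II \<and> \<not> \<alpha> \<epsilon> sup A"
  proof (rule ccontr)
    assume "\<not> ?thesis"
    then have "sub II (sup A)" by (auto simp: sub_def)
    with cS have "cnt II" by (rule cnt_sub)
    then show False using not_cnt_pow_om by (simp add: II_def)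
  qed
  then show "\<exists>B. NN B (h BB) \<and> (\<forall>x. NN x B \<longrightarrow> \<not> NN x A')" using none NN_BB by blast
  obtain g0 where g0: "\<And>y. y \<epsilon> sup A \<Longrightarrow> \<exists>n. n \<epsilon> om \<and> pr n y \<epsilon> g0"
    "\<And>n y y'. pr n y \<epsilon> g0 \<Longrightarrow> pr n y' \<epsilon> g0 \<Longrightarrow> y = y'" using cS unfolding cnt_def by blast
  define g where "g = sep (prd om (sup A)) (\<lambda>z. z \<epsilon> g0)"
  have g: "z \<epsilon> g \<longleftrightarrow> z \<epsilon> prd om (sup A) \<and> z \<epsilon> g0" for z
    unfolding g_def by (rule sep_iff) (intro dfI)
  \<comment> \<open>The tag \<open>(i, II)\<close> reveals the row to which \<open>x\<close>
    belongs. As every row met by \<open>A'\<close> lies in the support of \<open>A\<close>, a ground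
    enumeration of that support, taken through its canonical name, enumerates
    \<open>A'\<close>.\<close>
  let ?K = "\<lambda>n x. \<exists>i. NN (N.pr n i) (h (chk g)) \<and> NN (N.pr i (h (chk II))) x"
  have K: "\<exists>n0 i0. n = h (chk n0) \<and> pr n0 i0 \<epsilon> g \<and> i0 \<epsilon> sup A \<and> NN (h (chk (pr i0 II))) x" if K: "?K n x" for n x
  proof -
    obtain i where i: "NN (N.pr n i) (h (chk g))" "NN (N.pr i (h (chk II))) x" using K by blast
    then obtain w where w: "w \<epsilon> g" "N.pr n i = h (chk w)" unfolding NN_chk by blast
    then obtain n0 i0 where "w = pr n0 i0" "i0 \<epsilon> sup A" unfolding g prd_iff by blast
    then show ?thesis using i w by (auto simp: N_pr_chk)
  qed
  show "N.cnt A'"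
  proof (rule N.cntI[where K = ?K])
    show "N.dfn (\<lambda>e. \<exists>i. NN (N.pr (e 0) i) (h (chk g)) \<and> NN (N.pr i (h (chk II))) (e 1))" by (intro dfI)
  next
    fix x assume x: "NN x A'"
    then obtain \<alpha> where \<alpha>: "\<alpha> \<epsilon> II" "NN x (h (Bn \<alpha>))" using ex by blast
    then have \<alpha>S: "\<alpha> \<epsilon> sup A" using none x by blast
    from g0(1)[OF this] obtain n where "n \<epsilon> om" "pr n \<alpha> \<epsilon> g0" by blast
    with \<alpha>S have n: "n \<epsilon> om" "pr n \<alpha> \<epsilon> g" by (simp_all add: g)
    have "NN (N.pr (h (chk n)) (h (chk \<alpha>))) (h (chk g))"
      using n unfolding N_pr_chk[symmetric] NN_chk by blast
    moreover have "NN (N.pr (h (chk \<alpha>)) (h (chk II))) x"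
      using Bn_tag \<alpha> unfolding N_pr_chk[symmetric] by blast
    moreover have "NN (h (chk n)) N.om" using n unfolding N_om NN_chk by blast
    ultimately show "\<exists>n. NN n N.om \<and> ?K n x" by blast
  next
    fix n x y assume *: "NN x A'" "NN y A'" "?K n x" "?K n y"
    obtain n0 i where i: "n = h (chk n0)" "pr n0 i \<epsilon> g" "i \<epsilon> sup A" "NN (h (chk (pr i II))) x" using K[OF *(3)] by blast
    obtain n1 j where j: "n = h (chk n1)" "pr n1 j \<epsilon> g" "NN (h (chk (pr j II))) y" using K[OF *(4)] by blast
    have "n0 = n1" using i j h_chk by blast
    then have "j = i" using i j g g0(2) by blast
    have iII: "i \<epsilon> II" using i(3) SII by (rule subD[rotated])
    have "NN z (h (Bn i))" if "NN z A'" "NN (h (chk (pr i II))) z" for z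
    proof -
      obtain \<alpha> where \<alpha>: "\<alpha> \<epsilon> II" "NN z (h (Bn \<alpha>))" using ex[OF \<open>NN z A'\<close>] by blast
      then show ?thesis using Bn_tag[OF \<alpha>(1) iII \<alpha>(2)] \<open>NN (h (chk (pr i II))) z\<close> by blast
    qed
    then show "x = y" using sel[OF iII] * i j \<open>j = i\<close> by blast
  qed
qed

end

section \<open>The notions of forcing\<close>

context zf_model
begin

text \<open>The top element is \<open>C\<close> itself; below it, elements are compatible iff they lie in the same cell.\<close>

lemma cell_poset:
  assumes d: "dfn (\<lambda>e. eqv (e 0) (e 1))"
    and refl: "\<And>x. x \<epsilon> C \<Longrightarrow> eqv x x"
    and sym: "\<And>x y. eqv x y \<Longrightarrow> eqv y x"
    and trans: "\<And>x y z. eqv x y \<Longrightarrow> eqv y z \<Longrightarrow> eqv x z"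
  shows "\<exists>P L. is_forcing E P L \<and> (\<forall>p. p \<epsilon> P \<longleftrightarrow> p \<epsilon> C \<or> p = C) \<and>
    (\<forall>p q. p \<epsilon> P \<longrightarrow> q \<epsilon> P \<longrightarrow> (is_compat E P L p q \<longleftrightarrow> p = C \<or> q = C \<or> eqv p q \<and> p \<epsilon> C \<and> q \<epsilon> C))"
proof -
  let ?P = "sc C"
  let ?L = "sep (prd ?P ?P) (\<lambda>z. \<exists>x y. z = pr x y \<and> (y = C \<or> (x \<epsilon> C \<and> y \<epsilon> C \<and> eqv x y)))"
  have L0: "z \<epsilon> ?L \<longleftrightarrow> z \<epsilon> prd ?P ?P \<and> (\<exists>x y. z = pr x y \<and> (y = C \<or> (x \<epsilon> C \<and> y \<epsilon> C \<and> eqv x y)))" for z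
    by (rule sep_iff) (intro dfI dfn_P2[OF d])
  have L: "pr x y \<epsilon> ?L \<longleftrightarrow> (x \<epsilon> C \<or> x = C) \<and> (y \<epsilon> C \<or> y = C) \<and> (y = C \<or> (x \<epsilon> C \<and> y \<epsilon> C \<and> eqv x y))" for x y
    by (auto simp: L0)
  have C: "\<not> C \<epsilon> C" by (rule irrefl)
  have "is_rel E ?L ?P ?P" unfolding is_rel_def is_opair_iff L0 prd_iff by blast
  then have "is_forcing E ?P ?L"
    unfolding is_forcing_def pair_in_iff L using refl trans C by (auto simp: L)
  moreover have "is_compat E ?P ?L p q \<longleftrightarrow> p = C \<or> q = C \<or> eqv p q \<and> p \<epsilon> C \<and> q \<epsilon> C"
    if "p \<epsilon> ?P" "q \<epsilon> ?P" for p q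
  proof
    assume "is_compat E ?P ?L p q"
    then obtain r where "pr r p \<epsilon> ?L" "pr r q \<epsilon> ?L" unfolding is_compat_def pair_in_iff by blast
    then show "p = C \<or> q = C \<or> eqv p q \<and> p \<epsilon> C \<and> q \<epsilon> C" unfolding L using sym trans by blast
  next
    assume "p = C \<or> q = C \<or> eqv p q \<and> p \<epsilon> C \<and> q \<epsilon> C"
    then show "is_compat E ?P ?L p q"
      unfolding is_compat_def pair_in_iff L using that refl sym sc_iff by metis
  qed
  ultimately show ?thesis by (intro exI[of _ ?P] exI[of _ ?L]) auto
qed

text \<open>The top element is compatible with everything, so an antichain containing it is a
  singleton; any other antichain has at most one element in each cell.\<close>

lemma cell_antichain:
  assumes P: "\<And>p. p \<epsilon> P \<longleftrightarrow> p \<epsilon> C \<or> p = C"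
    and compat: "\<And>p q. p \<epsilon> P \<Longrightarrow> q \<epsilon> P \<Longrightarrow> is_compat E P L p q \<longleftrightarrow> p = C \<or> q = C \<or> eqv p q \<and> p \<epsilon> C \<and> q \<epsilon> C"
    and A: "is_antichain E P L A"
  shows "cnt A \<or> (sub A C \<and> (\<forall>x y. x \<epsilon> A \<longrightarrow> y \<epsilon> A \<longrightarrow> eqv x y \<longrightarrow> x = y))"
proof (cases "C \<epsilon> A")
  case True
  have "x = C" if "x \<epsilon> A" for x
    using A True that compat unfolding is_antichain_def is_sub_def by blast
  then have "sub A (upr C C)" by (auto simp: sub_def)
  then show ?thesis using cnt_sub[OF cnt_upr] by blast
next
  case False
  then have "sub A C" using A P unfolding is_antichain_def is_sub_def sub_def by metis
  then show ?thesis using A compat P unfolding is_antichain_def is_sub_def sub_def by meson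
qed

lemma CCC2_not_CCC3:
  assumes "fam BB"
  shows "\<exists>P L. is_forcing E P L \<and> is_CCC2 E P L \<and> \<not> is_CCC3 E P L"
proof -
  have ne: "\<And>B. B \<epsilon> BB \<Longrightarrow> \<exists>x. x \<epsilon> B"
    and dj: "\<And>B B' x. B \<epsilon> BB \<Longrightarrow> B' \<epsilon> BB \<Longrightarrow> x \<epsilon> B \<Longrightarrow> x \<epsilon> B' \<Longrightarrow> B = B'"
    and sel: "\<And>A. (\<And>x. x \<epsilon> A \<Longrightarrow> \<exists>B. B \<epsilon> BB \<and> x \<epsilon> B) \<Longrightarrow>
        (\<And>B x y. B \<epsilon> BB \<Longrightarrow> x \<epsilon> B \<Longrightarrow> y \<epsilon> B \<Longrightarrow> x \<epsilon> A \<Longrightarrow> y \<epsilon> A \<Longrightarrow> x = y) \<Longrightarrow>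
        cnt A \<and> (\<exists>B. B \<epsilon> BB \<and> (\<forall>x. x \<epsilon> B \<longrightarrow> \<not> x \<epsilon> A))"
    using assms unfolding fam_def by blast+
  define C where "C = uni BB"
  define eqv where "eqv x y \<longleftrightarrow> (\<exists>B. B \<epsilon> BB \<and> x \<epsilon> B \<and> y \<epsilon> B)" for x y
  have deqv: "dfn (\<lambda>e. eqv (s e) (t e))" if "tm s" "tm t" for s t
    by (rule dfn_P2[OF _ that], unfold eqv_def, intro dfI)
  have C: "x \<epsilon> C \<longleftrightarrow> (\<exists>B. B \<epsilon> BB \<and> x \<epsilon> B)" for x by (auto simp: C_def)
  have "\<exists>P L. is_forcing E P L \<and> (\<forall>p. p \<epsilon> P \<longleftrightarrow> p \<epsilon> C \<or> p = C) \<and>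
    (\<forall>p q. p \<epsilon> P \<longrightarrow> q \<epsilon> P \<longrightarrow> (is_compat E P L p q \<longleftrightarrow> p = C \<or> q = C \<or> eqv p q \<and> p \<epsilon> C \<and> q \<epsilon> C))"
  proof (rule cell_poset)
    show "dfn (\<lambda>e. eqv (e 0) (e 1))" by (intro deqv dfI)
    show "eqv x z" if "eqv x y" "eqv y z" for x y z
      using that dj unfolding eqv_def by metis
  qed (use C in \<open>auto simp: eqv_def\<close>)
  then obtain P L where F: "is_forcing E P L" and P: "\<And>p. p \<epsilon> P \<longleftrightarrow> p \<epsilon> C \<or> p = C"
    and compat: "\<And>p q. p \<epsilon> P \<Longrightarrow> q \<epsilon> P \<Longrightarrow> is_compat E P L p q \<longleftrightarrow> p = C \<or> q = C \<or> eqv p q \<and> p \<epsilon> C \<and> q \<epsilon> C"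
    by blast
  have "is_CCC2 E P L"
    unfolding is_CCC2_def is_countable_iff
  proof (intro allI impI)
    fix A assume "is_antichain E P L A"
    from cell_antichain[OF P compat this] show "cnt A"
    proof
      assume A: "sub A C \<and> (\<forall>x y. x \<epsilon> A \<longrightarrow> y \<epsilon> A \<longrightarrow> eqv x y \<longrightarrow> x = y)"
      have "cnt A \<and> (\<exists>B. B \<epsilon> BB \<and> (\<forall>x. x \<epsilon> B \<longrightarrow> \<not> x \<epsilon> A))"
      proof (rule sel)
        show "\<exists>B. B \<epsilon> BB \<and> x \<epsilon> B" if "x \<epsilon> A" for x using A that C subD by blast
        show "x = y" if "B \<epsilon> BB" "x \<epsilon> B" "y \<epsilon> B" "x \<epsilon> A" "y \<epsilon> A" for B x y
          using A that unfolding eqv_def by blast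
      qed
      then show ?thesis ..
    qed
  qed
  moreover have "\<not> is_CCC3 E P L"
  proof
    assume CCC3: "is_CCC3 E P L"
    have "\<exists>B. B \<epsilon> BB" using sel[of zero] by auto
    then obtain c where c: "c \<epsilon> C" using ne C by blast
    have "is_predense E P L C"
      unfolding is_predense_def is_sub_def
    proof (intro conjI allI impI)
      fix p assume p: "p \<epsilon> P"
      have "eqv p p \<or> p = C" using p P C by (auto simp: eqv_def)
      then show "\<exists>q. q \<epsilon> C \<and> is_compat E P L p q" using compat p c P by metis
    qed (simp add: P)
    then obtain K where K: "sub K C" "cnt K" "is_predense E P L K"
      using CCC3 unfolding is_CCC3_def is_sub_iff is_countable_iff by blast
    obtain g where g: "\<And>y. y \<epsilon> K \<Longrightarrow> \<exists>n. n \<epsilon> om \<and> pr n y \<epsilon> g"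
      "\<And>n y y'. pr n y \<epsilon> g \<Longrightarrow> pr n y' \<epsilon> g \<Longrightarrow> y = y'" using K(2) unfolding cnt_def by blast
    \<comment> \<open>From each cell the element of \<open>K\<close> with least index is selected:
      \<open>n\<close> enumerates \<open>x\<close>, and no element of \<open>K\<close> in the cell
      of \<open>x\<close> has a smaller index.\<close>
    let ?n = "\<lambda>x n. n \<epsilon> om \<and> pr n x \<epsilon> g \<and>
      (\<forall>m. m \<epsilon> om \<longrightarrow> (\<exists>y. pr m y \<epsilon> g \<and> y \<epsilon> K \<and> eqv x y) \<longrightarrow> n = m \<or> n \<epsilon> m)"
    let ?A = "sep K (\<lambda>x. \<exists>n. ?n x n)"
    have A: "x \<epsilon> ?A \<longleftrightarrow> x \<epsilon> K \<and> (\<exists>n. ?n x n)" for x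
      by (rule sep_iff) (intro dfI deqv)
    have hit: "\<exists>x. x \<epsilon> B \<and> x \<epsilon> ?A" if B: "B \<epsilon> BB" for B
    proof -
      obtain b where b: "b \<epsilon> B" using ne[OF B] by blast
      then have bC: "b \<epsilon> C" using B C by blast
      then obtain q where q: "q \<epsilon> K" "is_compat E P L b q" using K(3) P unfolding is_predense_def by blast
      have qC: "q \<epsilon> C" using q(1) K(1) subD by blast
      then have "eqv b q" using compat[of b q] q(2) P bC irrefl by metis
      then have "q \<epsilon> B" using dj B b unfolding eqv_def by metis
      obtain k where k: "k \<epsilon> om" "pr k q \<epsilon> g" using g(1)[OF q(1)] by blast
      have "dfn (\<lambda>e. \<exists>x. pr (e 0) x \<epsilon> g \<and> x \<epsilon> K \<and> x \<epsilon> B)" by (intro dfI)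
      from om_least[where Q = "\<lambda>n. \<exists>x. pr n x \<epsilon> g \<and> x \<epsilon> K \<and> x \<epsilon> B" and k = k, OF this] k q \<open>q \<epsilon> B\<close>
      obtain n x where n: "n \<epsilon> om" "pr n x \<epsilon> g" "x \<epsilon> K" "x \<epsilon> B"
        "\<And>m y. m \<epsilon> om \<Longrightarrow> pr m y \<epsilon> g \<Longrightarrow> y \<epsilon> K \<Longrightarrow> y \<epsilon> B \<Longrightarrow> n = m \<or> n \<epsilon> m" by blast
      have "y \<epsilon> B" if "eqv x y" for y using that n(4) dj B unfolding eqv_def by metis
      then have "?n x n" using n by blast
      then show ?thesis using n A by blast
    qed
    have "cnt ?A \<and> (\<exists>B. B \<epsilon> BB \<and> (\<forall>x. x \<epsilon> B \<longrightarrow> \<not> x \<epsilon> ?A))"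
    proof (rule sel)
      show "\<exists>B. B \<epsilon> BB \<and> x \<epsilon> B" if "x \<epsilon> ?A" for x
        using that K(1) C unfolding A sub_def by blast
      fix B x y assume *: "B \<epsilon> BB" "x \<epsilon> B" "y \<epsilon> B" "x \<epsilon> ?A" "y \<epsilon> ?A"
      obtain n where n: "?n x n" "x \<epsilon> K" using *(4) A by blast
      obtain m where m: "?n y m" "y \<epsilon> K" using *(5) A by blast
      have "eqv x y" "eqv y x" using * by (auto simp: eqv_def)
      then have "n = m \<or> n \<epsilon> m" "m = n \<or> m \<epsilon> n" using n m by blast+
      then have "n = m" using asym by blast
      then show "x = y" using g(2) n m by blast
    qed
    then show False using hit by blast
  qed
  ultimately show ?thesis using F by blast
qed

text \<open>
  Here uncountably many one-element cells \<open>{C, z}\<close> are added; they form an antichain, but no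
  maximal antichain other than the top element exists, as it would yield a choice function.
\<close>

lemma CCC1_not_CCC2:
  assumes "fam BB"
  shows "\<exists>P L. is_forcing E P L \<and> is_CCC1 E P L \<and> \<not> is_CCC2 E P L"
proof -
  have ne: "\<And>B. B \<epsilon> BB \<Longrightarrow> \<exists>x. x \<epsilon> B"
    and dj: "\<And>B B' x. B \<epsilon> BB \<Longrightarrow> B' \<epsilon> BB \<Longrightarrow> x \<epsilon> B \<Longrightarrow> x \<epsilon> B' \<Longrightarrow> B = B'"
    and sel: "\<And>A. (\<And>x. x \<epsilon> A \<Longrightarrow> \<exists>B. B \<epsilon> BB \<and> x \<epsilon> B) \<Longrightarrow>
        (\<And>B x y. B \<epsilon> BB \<Longrightarrow> x \<epsilon> B \<Longrightarrow> y \<epsilon> B \<Longrightarrow> x \<epsilon> A \<Longrightarrow> y \<epsilon> A \<Longrightarrow> x = y) \<Longrightarrow>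
        cnt A \<and> (\<exists>B. B \<epsilon> BB \<and> (\<forall>x. x \<epsilon> B \<longrightarrow> \<not> x \<epsilon> A))"
    using assms unfolding fam_def by blast+
  define Y where "Y = uni BB"
  have Y: "x \<epsilon> Y \<longleftrightarrow> (\<exists>B. B \<epsilon> BB \<and> x \<epsilon> B)" for x by (auto simp: Y_def)
  \<comment> \<open>The pair \<open>{Y, z}\<close> contains \<open>Y\<close>, so it is not an
    element of \<open>Y\<close>, and it determines \<open>z\<close>. Thus \<open>U\<close> is an
    uncountable set disjoint from the cells of the family.\<close>
  define U where "U = img (upr Y) (pow om)"
  have U: "x \<epsilon> U \<longleftrightarrow> (\<exists>z. z \<epsilon> pow om \<and> x = upr Y z)" for x
    unfolding U_def by (rule img_iff) (intro dfI)
  have UY: "\<not> x \<epsilon> Y" if "x \<epsilon> U" for x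
    using that asym[of Y x] by (auto simp: U)
  define C where "C = cup Y U"
  define eqv where "eqv x y \<longleftrightarrow> (\<exists>B. B \<epsilon> BB \<and> x \<epsilon> B \<and> y \<epsilon> B) \<or> x = y" for x y
  have deqv: "dfn (\<lambda>e. eqv (e 0) (e 1))" unfolding eqv_def by (intro dfI)
  have C: "x \<epsilon> C \<longleftrightarrow> x \<epsilon> Y \<or> x \<epsilon> U" for x by (auto simp: C_def)
  have "\<exists>P L. is_forcing E P L \<and> (\<forall>p. p \<epsilon> P \<longleftrightarrow> p \<epsilon> C \<or> p = C) \<and>
    (\<forall>p q. p \<epsilon> P \<longrightarrow> q \<epsilon> P \<longrightarrow> (is_compat E P L p q \<longleftrightarrow> p = C \<or> q = C \<or> eqv p q \<and> p \<epsilon> C \<and> q \<epsilon> C))"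
  proof (rule cell_poset[OF deqv])
    show "eqv x z" if "eqv x y" "eqv y z" for x y z
      using that dj unfolding eqv_def by metis
  qed (auto simp: eqv_def)
  then obtain P L where F: "is_forcing E P L" and P: "\<And>p. p \<epsilon> P \<longleftrightarrow> p \<epsilon> C \<or> p = C"
    and compat: "\<And>p q. p \<epsilon> P \<Longrightarrow> q \<epsilon> P \<Longrightarrow> is_compat E P L p q \<longleftrightarrow> p = C \<or> q = C \<or> eqv p q \<and> p \<epsilon> C \<and> q \<epsilon> C"
    by blast
  have "is_CCC1 E P L"
    unfolding is_CCC1_def is_countable_iff
  proof (intro allI impI)
    fix A assume max: "is_maximal_antichain E P L A"
    then have A: "is_antichain E P L A" by (simp add: is_maximal_antichain_def)
    from cell_antichain[OF P compat this] show "cnt A"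
    proof
      assume AC: "sub A C \<and> (\<forall>x y. x \<epsilon> A \<longrightarrow> y \<epsilon> A \<longrightarrow> eqv x y \<longrightarrow> x = y)"
      \<comment> \<open>Only the part of \<open>A\<close> inside \<open>Y\<close> is a partial
        selector. It misses some cell \<open>B\<close> entirely, and any element of \<open>B\<close>
        can be added to \<open>A\<close>, against maximality.\<close>
      let ?A = "sep A (\<lambda>x. x \<epsilon> Y)"
      have A': "x \<epsilon> ?A \<longleftrightarrow> x \<epsilon> A \<and> x \<epsilon> Y" for x by (rule sep_iff) (intro dfI)
      have "cnt ?A \<and> (\<exists>B. B \<epsilon> BB \<and> (\<forall>x. x \<epsilon> B \<longrightarrow> \<not> x \<epsilon> ?A))"
      proof (rule sel)
        show "\<exists>B. B \<epsilon> BB \<and> x \<epsilon> B" if "x \<epsilon> ?A" for x using that A' Y by blast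
        show "x = y" if "B \<epsilon> BB" "x \<epsilon> B" "y \<epsilon> B" "x \<epsilon> ?A" "y \<epsilon> ?A" for B x y
          using AC that A' unfolding eqv_def by blast
      qed
      then obtain B where B: "B \<epsilon> BB" "\<And>x. x \<epsilon> B \<Longrightarrow> \<not> x \<epsilon> A" using A' Y by blast
      obtain b where b: "b \<epsilon> B" using ne[OF B(1)] by blast
      have bC: "b \<epsilon> C" using b B Y C by blast
      let ?A1 = "cup A (upr b b)"
      have new: "\<not> is_compat E P L x b \<and> \<not> is_compat E P L b x" if x: "x \<epsilon> A" for x
      proof -
        have xC: "x \<epsilon> C" using AC x subD by blast
        have "\<not> eqv x b" "\<not> eqv b x" using dj B b x unfolding eqv_def by metis+
        then show ?thesis using compat P bC xC irrefl by metis
      qed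
      have "is_antichain E P L ?A1"
        using A new bC P unfolding is_antichain_def is_sub_def cup_iff upr_iff by metis
      moreover have "is_sub E A ?A1" by (simp add: is_sub_def)
      ultimately have "?A1 = A" using max unfolding is_maximal_antichain_def by blast
      then have "b \<epsilon> A" by (metis cup_iff upr_iff)
      then show ?thesis using B b by blast
    qed
  qed
  moreover have "\<not> is_CCC2 E P L"
  proof
    assume CCC2: "is_CCC2 E P L"
    have "is_antichain E P L U"
      unfolding is_antichain_def is_sub_def
    proof (intro conjI allI impI)
      fix p q assume pq: "p \<epsilon> U" "q \<epsilon> U" "p \<noteq> q"
      have "\<not> eqv p q" using pq UY Y unfolding eqv_def by blast
      then show "\<not> is_compat E P L p q" using compat pq P C irrefl by metis
    qed (simp add: P C)
    then have "cnt U" using CCC2 unfolding is_CCC2_def is_countable_iff by blast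
    then obtain g where g: "\<And>y. y \<epsilon> U \<Longrightarrow> \<exists>n. n \<epsilon> om \<and> pr n y \<epsilon> g"
      "\<And>n y y'. pr n y \<epsilon> g \<Longrightarrow> pr n y' \<epsilon> g \<Longrightarrow> y = y'" unfolding cnt_def by blast
    have "cnt (pow om)"
    proof (rule cntI[where K = "\<lambda>n z. pr n (upr Y z) \<epsilon> g"])
      show "dfn (\<lambda>e. pr (e 0) (upr Y (e 1)) \<epsilon> g)" by (intro dfI)
      show "\<exists>n. n \<epsilon> om \<and> pr n (upr Y z) \<epsilon> g" if "z \<epsilon> pow om" for z
        by (rule g(1)) (use that U in blast)
      show "z = z'" if "pr n (upr Y z) \<epsilon> g" "pr n (upr Y z') \<epsilon> g" for n z z'
        using g(2)[OF that] by (auto simp: upr_eq)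
    qed
    then show False using not_cnt_pow_om by blast
  qed
  ultimately show ?thesis using F by blast
qed

lemma CCC2_imp_CCC1: "is_CCC2 E P L \<Longrightarrow> is_CCC1 E P L"
  by (simp add: is_CCC1_def is_CCC2_def is_maximal_antichain_def)

text \<open>Extending \<open>A\<close> to a maximal antichain would need choice. Adding instead all
  conditions incompatible with every member of \<open>A\<close> gives a predense set in which a
  member of \<open>A\<close> is compatible only with itself, so each predense subset of it contains
  \<open>A\<close>.\<close>

lemma CCC3_imp_CCC2:
  assumes F: "is_forcing E P L" and CCC3: "is_CCC3 E P L"
  shows "is_CCC2 E P L"
  unfolding is_CCC2_def is_countable_iff
proof (intro allI impI)
  fix A assume A: "is_antichain E P L A"
  have dc: "dfn (\<lambda>e. is_compat E P L (s e) (t e))" if "tm s" "tm t" for s t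
    by (rule dfn_P2[OF _ that], unfold is_compat_def pair_in_iff, intro dfI)
  let ?D = "sep P (\<lambda>p. p \<epsilon> A \<or> (\<forall>a. a \<epsilon> A \<longrightarrow> \<not> is_compat E P L p a))"
  have D: "p \<epsilon> ?D \<longleftrightarrow> p \<epsilon> P \<and> (p \<epsilon> A \<or> (\<forall>a. a \<epsilon> A \<longrightarrow> \<not> is_compat E P L p a))" for p
    by (rule sep_iff) (intro dfI dc)
  have refl: "is_compat E P L p p" if "p \<epsilon> P" for p
    using F that unfolding is_forcing_def is_compat_def by blast
  have AP: "a \<epsilon> P" if "a \<epsilon> A" for a using A that unfolding is_antichain_def is_sub_def by blast
  have "is_predense E P L ?D"
    unfolding is_predense_def is_sub_def D using refl AP by blast
  then obtain K where K: "sub K ?D" "cnt K" "is_predense E P L K"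
    using CCC3 unfolding is_CCC3_def is_sub_iff is_countable_iff by blast
  have "a \<epsilon> K" if a: "a \<epsilon> A" for a
  proof -
    obtain c where c: "c \<epsilon> K" "is_compat E P L a c" using K(3) AP[OF a] unfolding is_predense_def by blast
    have "is_compat E P L c a" using c(2) unfolding is_compat_def by blast
    moreover have "c \<epsilon> ?D" using c K(1) subD by blast
    ultimately have "c \<epsilon> A" using a D by blast
    then have "c = a" using A a c(2) unfolding is_antichain_def by blast
    then show ?thesis using c by simp
  qed
  then have "sub A K" by (simp add: sub_def)
  with K(2) show "cnt A" by (rule cnt_sub)
qed

end

section \<open>The theorem\<close>

text \<open>If ZF did not prove the sentence, its negation would be consistent with ZF, and
  completeness would give a model with carrier \<open>nat\<close> refuting it.\<close>

lemma ZF_derives: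
  assumes "bnd \<phi> = 0" "\<And>(E :: nat \<Rightarrow> nat \<Rightarrow> bool) e. zf_model E \<Longrightarrow> sat E e \<phi>"
  shows "ZF \<^bold>\<turnstile> \<phi>"
proof (rule ccontr)
  assume "\<not> ZF \<^bold>\<turnstile> \<phi>"
  then have "consistent (insert (\<^bold>\<not>\<phi>) ZF)" by (auto simp: consistent_def intro: derivable.Raa)
  moreover have "bnd q = 0" if "q \<in> insert (\<^bold>\<not>\<phi>) ZF" for q
    using that assms(1) bnd_ZF by auto
  ultimately obtain E :: "nat \<Rightarrow> nat \<Rightarrow> bool" where E: "\<forall>q\<in>insert (\<^bold>\<not>\<phi>) ZF. \<forall>e. sat E e q"
    using completeness_ZF[of "insert (\<^bold>\<not>\<phi>) ZF"] by blast
  then have "zf_model E" by unfold_locales blast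
  then have "sat E (\<lambda>_. 0) \<phi>" by (rule assms(2))
  moreover have "sat E (\<lambda>_. 0) (\<^bold>\<not>\<phi>)" using E by blast
  ultimately show False by simp
qed

lemma (in flip_gen) ex_extension:
  "\<exists>(h :: nat \<Rightarrow> nat) NN. surj h \<and> (\<forall>x y. Q x y \<longleftrightarrow> h x = h y) \<and> (\<forall>x y. EN x y \<longleftrightarrow> NN (h x) (h y))"
proof (rule quotient_structure)
  show "equivp Q"
    by (rule equivpI) (auto simp: reflp_def symp_def transp_def intro: Q_refl Q_sym Q_trans)
  show "\<exists>x. \<forall>y\<in>Y. \<not> Q x y" if fin: "finite Y" for Y
  proof (rule ccontr)
    assume "\<not> ?thesis"
    \<comment> \<open>Canonical names of different elements of the ground model are inequivalent,
      which already gives infinitely many classes.\<close>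
    then have "\<forall>x. \<exists>y. y \<in> Y \<and> Q (chk x) y" by blast
    then obtain f where f: "\<And>x. f x \<in> Y" "\<And>x. Q (chk x) (f x)" by metis
    have "inj f"
    proof (rule injI)
      fix x y assume "f x = f y"
      then have "Q (chk x) (chk y)" using f(2) Q_sym Q_trans by metis
      then show "x = y" using Eq_chk by (auto simp: Q_def)
    qed
    moreover have "finite (range f)" using fin f(1) by (meson finite_subset image_subsetI)
    ultimately have "finite (UNIV :: nat set)" using finite_imageD by blast
    then show False by simp
  qed
qed (rule EN_cong)

lemma ex_model:
  assumes "consistent ZFC"
  shows "\<exists>(E :: nat \<Rightarrow> nat \<Rightarrow> bool) BB. zf_model E \<and> (\<forall>e. sat E e DC) \<and> zf_model.fam E BB"
proof -
  obtain E :: "nat \<Rightarrow> nat \<Rightarrow> bool" where E: "\<forall>q\<in>ZFC. \<forall>e. sat E e q"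
    using completeness_ZF[OF assms bnd_ZFC] by (auto simp: ZFC_def)
  interpret flip E
    by unfold_locales (use E in \<open>auto simp: ZFC_def\<close>)
  obtain G where G: "generic G" using ex_generic by blast
  interpret flip_gen E G by unfold_locales (rule G)
  obtain h and NN :: "nat \<Rightarrow> nat \<Rightarrow> bool" where h: "surj h" "\<And>x y. Q x y \<longleftrightarrow> h x = h y" "\<And>x y. EN x y \<longleftrightarrow> NN (h x) (h y)"
    using ex_extension by blast
  interpret flip_ext E G h NN by unfold_locales (fact h)+
  show ?thesis using N.zf_model_axioms NN_DC fam_BB by blast
qed

lemma consistent_model:
  fixes E :: "nat \<Rightarrow> nat \<Rightarrow> bool"
  assumes "\<And>q e. q \<in> \<Gamma> \<Longrightarrow> sat E e q"
  shows "consistent \<Gamma>"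
  unfolding consistent_def using soundness[of \<Gamma> "\<^bold>\<bottom>" E "\<lambda>_. 0"] assms by auto

theorem mainTheorem1:
  shows "ZF \<^bold>\<turnstile> CCC_implies CCC3 CCC2 \<and>
         ZF \<^bold>\<turnstile> CCC_implies CCC2 CCC1 \<and>
         (consistent ZFC \<longrightarrow> consistent (ZF \<union> {DC} \<union> {CCC_separated CCC1 CCC2})) \<and>
         (consistent ZFC \<longrightarrow> consistent (ZF \<union> {DC} \<union> {CCC_separated CCC2 CCC3}))"
proof (intro conjI impI)
  show "ZF \<^bold>\<turnstile> CCC_implies CCC3 CCC2"
  proof (rule ZF_derives)
    show "sat E e (CCC_implies CCC3 CCC2)" if "zf_model E" for E :: "nat \<Rightarrow> nat \<Rightarrow> bool" and e
      unfolding sat_CCC_implies using zf_model.CCC3_imp_CCC2[OF that] by blast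
  qed (simp add: CCC_implies_def CCC3_def CCC2_def fm_defs)
  show "ZF \<^bold>\<turnstile> CCC_implies CCC2 CCC1"
  proof (rule ZF_derives)
    show "sat E e (CCC_implies CCC2 CCC1)" if "zf_model E" for E :: "nat \<Rightarrow> nat \<Rightarrow> bool" and e
      unfolding sat_CCC_implies using zf_model.CCC2_imp_CCC1[OF that] by blast
  qed (simp add: CCC_implies_def CCC2_def CCC1_def fm_defs)
next
  assume "consistent ZFC"
  then obtain E :: "nat \<Rightarrow> nat \<Rightarrow> bool" and BB where E: "zf_model E" "\<And>e. sat E e DC" "zf_model.fam E BB"
    using ex_model by blast
  have "sat E e (CCC_separated CCC1 CCC2)" for e
    unfolding sat_CCC_separated by (rule zf_model.CCC1_not_CCC2[OF E(1,3)])
  then show "consistent (ZF \<union> {DC} \<union> {CCC_separated CCC1 CCC2})"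
    by (intro consistent_model[of _ E]) (use zf_model.ZF[OF E(1)] E(2) in auto)
next
  assume "consistent ZFC"
  then obtain E :: "nat \<Rightarrow> nat \<Rightarrow> bool" and BB where E: "zf_model E" "\<And>e. sat E e DC" "zf_model.fam E BB"
    using ex_model by blast
  have "sat E e (CCC_separated CCC2 CCC3)" for e
    unfolding sat_CCC_separated by (rule zf_model.CCC2_not_CCC3[OF E(1,3)])
  then show "consistent (ZF \<union> {DC} \<union> {CCC_separated CCC2 CCC3})"
    by (intro consistent_model[of _ E]) (use zf_model.ZF[OF E(1)] E(2) in auto)
qed

end
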